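(* For any small restriction category $\mathbf{X}$, the Yoneda embedding $\mathbf{y}_r\colon\mathbf{X}\to\mathsf{PSh}_r(\mathbf{X})$ exhibits $\mathsf{PSh}_r(\mathbf{X})$ as the free restriction cocompletion of $\mathbf{X}$; that is, $\mathsf{PSh}_r(\mathbf{X})$ is a cocomplete restriction category and, for every cocomplete restriction category $\mathcal{E}$, the functor $$(-)\circ\mathbf{y}_r\colon\mathbf{rCocomp}(\mathsf{PSh}_r(\mathbf{X}),\mathcal{E})\to\mathbf{rCat}(\mathbf{X},\mathcal{E})$$ is an equivalence of categories.
   Context: A restriction category is a category $\mathbf{X}$ with an assignment $f\mapsto\bar f$, $\mathbf{X}(A,B)\to\mathbf{X}(A,A)$, such that (R1) $f\bar f=f$; (R2) $\bar g\bar f=\bar f\bar g$ for $f\colon A\to B$, $g\colon A\to C$; (R3) $\overline{g\bar f}=\bar g\bar f$ for $f\colon A\to B$, $g\colon A\to C$; (R4) $\bar h f=f\,\overline{hf}$ for $f\colon A\to B$, $h\colon B\to C$. A map $f$ is a restriction idempotent if $f=\bar f$, and total if $\bar f=1$; objects and total maps form a subcategory $\mathsf{Total}(\mathbf{X})$. A restriction functor is a functor $F$ with $F(\bar f)=\overline{F(f)}$; a restriction transformation is a natural transformation with total components. $\mathbf{rCat}$ is the 2-category of restriction categories, restriction functors and restriction transformations. A restriction category is split if every restriction idempotent $e$ splits ($e=mr$ with $rm=1$). Colimits are small colimits; cocomplete categories are those with small colimits. A restriction category $\mathbf{Y}$ is cocomplete if it is split, $\mathsf{Total}(\mathbf{Y})$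 is cocomplete, and the inclusion $\mathsf{Total}(\mathbf{Y})\hookrightarrow\mathbf{Y}$ preserves colimits. A restriction functor $F\colon\mathbf{Y}\to\mathbf{Z}$ is cocontinuous if the induced functor $\mathsf{Total}(\mathbf{Y})\to\mathsf{Total}(\mathbf{Z})$ preserves colimits. $\mathbf{rCocomp}$ is the 2-category of cocomplete restriction categories, cocontinuous restriction functors and restriction transformations. For a presheaf $P$, $x\in PA$ and $g\colon B\to A$, write $x\cdot g=P(g)(x)$. A restriction presheaf on $\mathbf{X}$ is a presheaf $P\colon\mathbf{X}^{\mathrm{op}}\to\mathbf{Set}$ with assignments $PA\to\mathbf{X}(A,A)$, $x\mapsto\bar x$, where $\bar x$ is a restriction idempotent and: (A1) $x\cdot\bar x=x$; (A2) $\overline{x\cdot\bar f}=\bar x\circ\bar f$ for every restriction idempotent $\bar f\colon A\to A$; (A3) $\bar x\circ g=g\circ\overline{x\cdot g}$ for every $g\colon B\to A$. $\mathsf{PSh}_r(\mathbf{X})$ is the restriction category of restriction presheaves and arbitrary natural transformations, where the restriction of $\alpha\colon P\Rightarrow Q$ is $\bar\alpha\colon P\Rightarrow P$, $\bar\alpha_A(x)=x\cdot\overline{\alpha_A(x)}$. Each representable $\mathbf{X}(-,A)$ is a restriction presheaf via $f\mapsto\bar f$, so the Yoneda embedding factors through a restriction functor $\mathbf{y}_r\colon\mathbf{X}\to\mathsf{PSh}_r(\mathbf{X})$. *)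

theory Defs
  imports Main "HOL-Library.FuncSet"
begin

unbundle cardinal_syntax

section \<open>Size\<close>

text \<open>
  Smallness is relative to a type \<open>'u\<close> whose cardinality is infinite and regular: a set over \<open>'u\<close> is
  small if it is of strictly smaller cardinality than \<open>'u\<close>.  If the cardinality of \<open>'u\<close> is
  inaccessible, then up to bijection the small sets are the elements of a Grothendieck universe and
  the small categories below are, up to isomorphism, the categories internal to it.  Strong
  inaccessibility is not demanded, since in HOL no uncountable type can be shown to have this
  property.
\<close>

definition universe :: "'u itself \<Rightarrow> bool" where
  "universe (_ :: 'u itself) \<longleftrightarrow> infinite (UNIV :: 'u set) \<and> regularCard |UNIV :: 'u set|"

definition small :: "'u set \<Rightarrow> bool" where
  "small S \<longleftrightarrow> |S| <o |UNIV :: 'u set|"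


section \<open>Categories, functors, natural transformations\<close>

record ('o, 'm) cat =
  Obj :: "'o set"
  Arr :: "'m set"
  Dom :: "'m \<Rightarrow> 'o"
  Cod :: "'m \<Rightarrow> 'o"
  Ide :: "'o \<Rightarrow> 'm"
  Comp :: "'m \<Rightarrow> 'm \<Rightarrow> 'm"  (infixl \<open>\<cdot>\<index>\<close> 70)

definition hom :: "('o, 'm, 'z) cat_scheme \<Rightarrow> 'o \<Rightarrow> 'o \<Rightarrow> 'm set" where
  "hom C A B = {f \<in> Arr C. Dom C f = A \<and> Cod C f = B}"

locale category =
  fixes C :: "('o, 'm, 'z) cat_scheme" (structure)
  assumes Dom_Obj: "f \<in> Arr C \<Longrightarrow> Dom C f \<in> Obj C"
    and Cod_Obj: "f \<in> Arr C \<Longrightarrow> Cod C f \<in> Obj C"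
    and Ide_hom: "A \<in> Obj C \<Longrightarrow> Ide C A \<in> hom C A A"
    and Comp_hom: "\<lbrakk>f \<in> hom C A B; g \<in> hom C B D\<rbrakk> \<Longrightarrow> g \<cdot> f \<in> hom C A D"
    and Comp_Ide: "f \<in> hom C A B \<Longrightarrow> f \<cdot> Ide C A = f"
    and Ide_Comp: "f \<in> hom C A B \<Longrightarrow> Ide C B \<cdot> f = f"
    and Comp_assoc:
      "\<lbrakk>f \<in> hom C A B; g \<in> hom C B D; h \<in> hom C D E\<rbrakk> \<Longrightarrow> h \<cdot> (g \<cdot> f) = (h \<cdot> g) \<cdot> f"

definition small_category :: "('u, 'u, 'z) cat_scheme \<Rightarrow> bool" where
  "small_category C \<longleftrightarrow> category C \<and> small (Obj C) \<and> small (Arr C)"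

definition op_cat :: "('o, 'm, 'z) cat_scheme \<Rightarrow> ('o, 'm) cat" where
  "op_cat C = \<lparr>Obj = Obj C, Arr = Arr C, Dom = Cod C, Cod = Dom C, Ide = Ide C,
               Comp = (\<lambda>g f. f \<cdot>\<^bsub>C\<^esub> g)\<rparr>"

definition iso :: "('o, 'm, 'z) cat_scheme \<Rightarrow> 'm \<Rightarrow> bool" where
  "iso C f \<longleftrightarrow> f \<in> Arr C \<and>
     (\<exists>g \<in> hom C (Cod C f) (Dom C f). g \<cdot>\<^bsub>C\<^esub> f = Ide C (Dom C f) \<and> f \<cdot>\<^bsub>C\<^esub> g = Ide C (Cod C f))"

text \<open>
  The object and arrow maps of functors, and the components of natural transformations, are required
  to be extensional, so that equality in HOL is equality of functors and transformations.
\<close>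

record ('o, 'm, 'p, 'n) func =
  FObj :: "'o \<Rightarrow> 'p"
  FArr :: "'m \<Rightarrow> 'n"

definition cat_functor ::
  "('o, 'm, 'y) cat_scheme \<Rightarrow> ('p, 'n, 'z) cat_scheme \<Rightarrow> ('o, 'm, 'p, 'n) func \<Rightarrow> bool" where
  "cat_functor C D F \<longleftrightarrow> category C \<and> category D \<and>
     FObj F \<in> Obj C \<rightarrow>\<^sub>E Obj D \<and> FArr F \<in> Arr C \<rightarrow>\<^sub>E Arr D \<and>
     (\<forall>f \<in> Arr C. Dom D (FArr F f) = FObj F (Dom C f) \<and> Cod D (FArr F f) = FObj F (Cod C f)) \<and>
     (\<forall>A \<in> Obj C. FArr F (Ide C A) = Ide D (FObj F A)) \<and>
     (\<forall>f \<in> Arr C. \<forall>g \<in> Arr C. Cod C f = Dom C g \<longrightarrow>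
        FArr F (g \<cdot>\<^bsub>C\<^esub> f) = FArr F g \<cdot>\<^bsub>D\<^esub> FArr F f)"

definition id_functor :: "('o, 'm, 'z) cat_scheme \<Rightarrow> ('o, 'm, 'o, 'm) func" where
  "id_functor C = \<lparr>FObj = (\<lambda>A \<in> Obj C. A), FArr = (\<lambda>f \<in> Arr C. f)\<rparr>"

definition comp_functor ::
  "('o, 'm, 'z) cat_scheme \<Rightarrow> ('p, 'n, 'q, 'k) func \<Rightarrow> ('o, 'm, 'p, 'n) func \<Rightarrow> ('o, 'm, 'q, 'k) func"
where
  "comp_functor C G F =
     \<lparr>FObj = (\<lambda>A \<in> Obj C. FObj G (FObj F A)), FArr = (\<lambda>f \<in> Arr C. FArr G (FArr F f))\<rparr>"

definition nat_trans ::
  "('o, 'm, 'y) cat_scheme \<Rightarrow> ('p, 'n, 'z) cat_scheme \<Rightarrow>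
   ('o, 'm, 'p, 'n) func \<Rightarrow> ('o, 'm, 'p, 'n) func \<Rightarrow> ('o \<Rightarrow> 'n) \<Rightarrow> bool" where
  "nat_trans C D F G t \<longleftrightarrow> cat_functor C D F \<and> cat_functor C D G \<and>
     t \<in> extensional (Obj C) \<and> (\<forall>A \<in> Obj C. t A \<in> hom D (FObj F A) (FObj G A)) \<and>
     (\<forall>f \<in> Arr C. t (Cod C f) \<cdot>\<^bsub>D\<^esub> FArr F f = FArr G f \<cdot>\<^bsub>D\<^esub> t (Dom C f))"

definition naturally_isomorphic ::
  "('o, 'm, 'y) cat_scheme \<Rightarrow> ('p, 'n, 'z) cat_scheme \<Rightarrow>
   ('o, 'm, 'p, 'n) func \<Rightarrow> ('o, 'm, 'p, 'n) func \<Rightarrow> bool" where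
  "naturally_isomorphic C D F G \<longleftrightarrow> (\<exists>t. nat_trans C D F G t \<and> (\<forall>A \<in> Obj C. iso D (t A)))"

definition equivalence_functor ::
  "('o, 'm, 'y) cat_scheme \<Rightarrow> ('p, 'n, 'z) cat_scheme \<Rightarrow> ('o, 'm, 'p, 'n) func \<Rightarrow> bool" where
  "equivalence_functor C D F \<longleftrightarrow> cat_functor C D F \<and>
     (\<exists>G. cat_functor D C G \<and>
        naturally_isomorphic C C (id_functor C) (comp_functor C G F) \<and>
        naturally_isomorphic D D (comp_functor D F G) (id_functor D))"

text \<open>Arrows of functor categories: families of components with their source and target.\<close>

record ('f, 'o, 'n) trans =
  Src :: 'f
  Tgt :: 'f
  Cmp :: "'o \<Rightarrow> 'n"

definition trans_comp ::
  "('o, 'm, 'y) cat_scheme \<Rightarrow> ('p, 'n, 'z) cat_scheme \<Rightarrow>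
   ('f, 'o, 'n) trans \<Rightarrow> ('f, 'o, 'n) trans \<Rightarrow> ('f, 'o, 'n) trans" where
  "trans_comp C D \<beta> \<alpha> =
     \<lparr>Src = Src \<alpha>, Tgt = Tgt \<beta>, Cmp = (\<lambda>A \<in> Obj C. Cmp \<beta> A \<cdot>\<^bsub>D\<^esub> Cmp \<alpha> A)\<rparr>"


section \<open>Small colimits\<close>

text \<open>
  Diagram shapes \<open>J\<close> range over the small categories with objects and arrows in \<open>'u\<close>.
\<close>

definition cocone ::
  "('j, 'i, 'y) cat_scheme \<Rightarrow> ('o, 'm, 'z) cat_scheme \<Rightarrow> ('j, 'i, 'o, 'm) func \<Rightarrow>
   'o \<Rightarrow> ('j \<Rightarrow> 'm) \<Rightarrow> bool" where
  "cocone J C D c t \<longleftrightarrow> c \<in> Obj C \<and> (\<forall>j \<in> Obj J. t j \<in> hom C (FObj D j) c) \<and>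
     (\<forall>u \<in> Arr J. t (Cod J u) \<cdot>\<^bsub>C\<^esub> FArr D u = t (Dom J u))"

definition colimit ::
  "('j, 'i, 'y) cat_scheme \<Rightarrow> ('o, 'm, 'z) cat_scheme \<Rightarrow> ('j, 'i, 'o, 'm) func \<Rightarrow>
   'o \<Rightarrow> ('j \<Rightarrow> 'm) \<Rightarrow> bool" where
  "colimit J C D c t \<longleftrightarrow> cocone J C D c t \<and>
     (\<forall>c' t'. cocone J C D c' t' \<longrightarrow>
        (\<exists>!h. h \<in> hom C c c' \<and> (\<forall>j \<in> Obj J. h \<cdot>\<^bsub>C\<^esub> t j = t' j)))"

definition cocomplete :: "'u itself \<Rightarrow> ('o, 'm, 'z) cat_scheme \<Rightarrow> bool" where
  "cocomplete (_ :: 'u itself) C \<longleftrightarrow> category C \<and>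
     (\<forall>(J :: ('u, 'u) cat) D. small_category J \<and> cat_functor J C D \<longrightarrow> (\<exists>c t. colimit J C D c t))"

definition preserves_colimits ::
  "'u itself \<Rightarrow> ('o, 'm, 'y) cat_scheme \<Rightarrow> ('p, 'n, 'z) cat_scheme \<Rightarrow> ('o, 'm, 'p, 'n) func \<Rightarrow> bool"
where
  "preserves_colimits (_ :: 'u itself) C C' F \<longleftrightarrow>
     (\<forall>(J :: ('u, 'u) cat) D c t.
        small_category J \<and> cat_functor J C D \<and> colimit J C D c t \<longrightarrow>
        colimit J C' (comp_functor J F D) (FObj F c) (\<lambda>j. FArr F (t j)))"


section \<open>Restriction categories\<close>

record ('o, 'm) rcat = "('o, 'm) cat" +
  Rst :: "'m \<Rightarrow> 'm"

locale restriction_category = category X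
  for X :: "('o, 'm, 'z) rcat_scheme" (structure) +
  assumes Rst_hom: "f \<in> hom X A B \<Longrightarrow> Rst X f \<in> hom X A A"
    and R1: "f \<in> hom X A B \<Longrightarrow> f \<cdot> Rst X f = f"
    and R2: "\<lbrakk>f \<in> hom X A B; g \<in> hom X A C\<rbrakk> \<Longrightarrow> Rst X g \<cdot> Rst X f = Rst X f \<cdot> Rst X g"
    and R3: "\<lbrakk>f \<in> hom X A B; g \<in> hom X A C\<rbrakk> \<Longrightarrow> Rst X (g \<cdot> Rst X f) = Rst X g \<cdot> Rst X f"
    and R4: "\<lbrakk>f \<in> hom X A B; h \<in> hom X B C\<rbrakk> \<Longrightarrow> Rst X h \<cdot> f = f \<cdot> Rst X (h \<cdot> f)"

definition restriction_idempotent :: "('o, 'm, 'z) rcat_scheme \<Rightarrow> 'm \<Rightarrow> bool" where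
  "restriction_idempotent X e \<longleftrightarrow> e \<in> Arr X \<and> e = Rst X e"

definition total_map :: "('o, 'm, 'z) rcat_scheme \<Rightarrow> 'm \<Rightarrow> bool" where
  "total_map X f \<longleftrightarrow> f \<in> Arr X \<and> Rst X f = Ide X (Dom X f)"

definition Total :: "('o, 'm, 'z) rcat_scheme \<Rightarrow> ('o, 'm) cat" where
  "Total X = \<lparr>Obj = Obj X, Arr = {f. total_map X f}, Dom = Dom X, Cod = Cod X, Ide = Ide X,
              Comp = Comp X\<rparr>"

definition split_rcat :: "('o, 'm, 'z) rcat_scheme \<Rightarrow> bool" where
  "split_rcat X \<longleftrightarrow> (\<forall>e. restriction_idempotent X e \<longrightarrow>
     (\<exists>B \<in> Obj X. \<exists>m \<in> hom X B (Dom X e). \<exists>r \<in> hom X (Dom X e) B.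
        e = m \<cdot>\<^bsub>X\<^esub> r \<and> r \<cdot>\<^bsub>X\<^esub> m = Ide X B))"

definition restriction_functor ::
  "('o, 'm, 'y) rcat_scheme \<Rightarrow> ('p, 'n, 'z) rcat_scheme \<Rightarrow> ('o, 'm, 'p, 'n) func \<Rightarrow> bool" where
  "restriction_functor X Y F \<longleftrightarrow> restriction_category X \<and> restriction_category Y \<and>
     cat_functor X Y F \<and> (\<forall>f \<in> Arr X. FArr F (Rst X f) = Rst Y (FArr F f))"

definition restriction_trans ::
  "('o, 'm, 'y) rcat_scheme \<Rightarrow> ('p, 'n, 'z) rcat_scheme \<Rightarrow>
   ('o, 'm, 'p, 'n) func \<Rightarrow> ('o, 'm, 'p, 'n) func \<Rightarrow> ('o \<Rightarrow> 'n) \<Rightarrow> bool" where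
  "restriction_trans X Y F G t \<longleftrightarrow> restriction_functor X Y F \<and> restriction_functor X Y G \<and>
     nat_trans X Y F G t \<and> (\<forall>A \<in> Obj X. total_map Y (t A))"

text \<open>The hom-category \<open>rCat(X, Y)\<close>.\<close>

definition rCat ::
  "('o, 'm, 'y) rcat_scheme \<Rightarrow> ('p, 'n, 'z) rcat_scheme \<Rightarrow>
   (('o, 'm, 'p, 'n) func, (('o, 'm, 'p, 'n) func, 'o, 'n) trans) cat" where
  "rCat X Y =
     \<lparr>Obj = {F. restriction_functor X Y F},
      Arr = {\<alpha>. restriction_trans X Y (Src \<alpha>) (Tgt \<alpha>) (Cmp \<alpha>)},
      Dom = Src, Cod = Tgt,
      Ide = (\<lambda>F. \<lparr>Src = F, Tgt = F, Cmp = (\<lambda>A \<in> Obj X. Ide Y (FObj F A))\<rparr>),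
      Comp = trans_comp X Y\<rparr>"


section \<open>Cocomplete restriction categories\<close>

definition Total_inclusion :: "('o, 'm, 'z) rcat_scheme \<Rightarrow> ('o, 'm, 'o, 'm) func" where
  "Total_inclusion Y = \<lparr>FObj = (\<lambda>A \<in> Obj (Total Y). A), FArr = (\<lambda>f \<in> Arr (Total Y). f)\<rparr>"

definition Total_functor ::
  "('o, 'm, 'z) rcat_scheme \<Rightarrow> ('o, 'm, 'p, 'n) func \<Rightarrow> ('o, 'm, 'p, 'n) func" where
  "Total_functor Y F =
     \<lparr>FObj = (\<lambda>A \<in> Obj (Total Y). FObj F A), FArr = (\<lambda>f \<in> Arr (Total Y). FArr F f)\<rparr>"

definition cocomplete_rcat :: "'u itself \<Rightarrow> ('o, 'm, 'z) rcat_scheme \<Rightarrow> bool" where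
  "cocomplete_rcat U Y \<longleftrightarrow> restriction_category Y \<and> split_rcat Y \<and> cocomplete U (Total Y) \<and>
     preserves_colimits U (Total Y) Y (Total_inclusion Y)"

definition cocontinuous_rfunctor ::
  "'u itself \<Rightarrow> ('o, 'm, 'y) rcat_scheme \<Rightarrow> ('p, 'n, 'z) rcat_scheme \<Rightarrow>
   ('o, 'm, 'p, 'n) func \<Rightarrow> bool" where
  "cocontinuous_rfunctor U Y Z F \<longleftrightarrow> restriction_functor Y Z F \<and>
     preserves_colimits U (Total Y) (Total Z) (Total_functor Y F)"

text \<open>
  The hom-category \<open>rCocomp(Y, Z)\<close>, for cocomplete restriction categories \<open>Y\<close> and \<open>Z\<close>: the full
  subcategory of \<open>rCat(Y, Z)\<close> on the cocontinuous functors.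
\<close>

definition rCocomp ::
  "'u itself \<Rightarrow> ('o, 'm, 'y) rcat_scheme \<Rightarrow> ('p, 'n, 'z) rcat_scheme \<Rightarrow>
   (('o, 'm, 'p, 'n) func, (('o, 'm, 'p, 'n) func, 'o, 'n) trans) cat" where
  "rCocomp U Y Z =
     (rCat Y Z)
       \<lparr>Obj := {F. cocontinuous_rfunctor U Y Z F},
        Arr := {\<alpha> \<in> Arr (rCat Y Z). cocontinuous_rfunctor U Y Z (Src \<alpha>) \<and>
                                    cocontinuous_rfunctor U Y Z (Tgt \<alpha>)}\<rparr>"

text \<open>Precomposition \<open>(-) \<circ> K\<close> with a functor \<open>K\<close> from \<open>X\<close>.\<close>

definition precomp ::
  "('o, 'm, 'z) cat_scheme \<Rightarrow> ('o, 'm, 'p, 'n) func \<Rightarrow>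
   (('p, 'n, 'q, 'k) func, (('p, 'n, 'q, 'k) func, 'p, 'k) trans, 'w) cat_scheme \<Rightarrow>
   (('p, 'n, 'q, 'k) func, (('p, 'n, 'q, 'k) func, 'p, 'k) trans,
    ('o, 'm, 'q, 'k) func, (('o, 'm, 'q, 'k) func, 'o, 'k) trans) func" where
  "precomp X K H =
     \<lparr>FObj = (\<lambda>F \<in> Obj H. comp_functor X F K),
      FArr = (\<lambda>\<alpha> \<in> Arr H. \<lparr>Src = comp_functor X (Src \<alpha>) K, Tgt = comp_functor X (Tgt \<alpha>) K,
                            Cmp = (\<lambda>A \<in> Obj X. Cmp \<alpha> (FObj K A))\<rparr>)\<rparr>"


section \<open>Restriction presheaves\<close>

record 'u set_map =
  SDom :: "'u set"
  SCod :: "'u set"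
  SFun :: "'u \<Rightarrow> 'u"

text \<open>The category of small sets.\<close>

definition Set_cat :: "('u set, 'u set_map) cat" where
  "Set_cat =
     \<lparr>Obj = {S. small S},
      Arr = {f. small (SDom f) \<and> small (SCod f) \<and> SFun f \<in> SDom f \<rightarrow>\<^sub>E SCod f},
      Dom = SDom, Cod = SCod,
      Ide = (\<lambda>S. \<lparr>SDom = S, SCod = S, SFun = (\<lambda>x \<in> S. x)\<rparr>),
      Comp = (\<lambda>g f. \<lparr>SDom = SDom f, SCod = SCod g, SFun = compose (SDom f) (SFun g) (SFun f)\<rparr>)\<rparr>"

text \<open>
  A presheaf together with the assignments \<open>PA \<rightarrow> X(A, A)\<close>; these are indexed by \<open>A\<close> because the sets
  \<open>PA\<close> need not be disjoint.
\<close>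

record 'u rpsh =
  Psh :: "('u, 'u, 'u set, 'u set_map) func"
  PRst :: "'u \<Rightarrow> 'u \<Rightarrow> 'u"

abbreviation elts :: "'u rpsh \<Rightarrow> 'u \<Rightarrow> 'u set" where
  "elts P A \<equiv> FObj (Psh P) A"

definition act :: "'u rpsh \<Rightarrow> 'u \<Rightarrow> 'u \<Rightarrow> 'u" where
  "act P x g = SFun (FArr (Psh P) g) x"

definition restriction_presheaf :: "('u, 'u, 'z) rcat_scheme \<Rightarrow> 'u rpsh \<Rightarrow> bool" where
  "restriction_presheaf X P \<longleftrightarrow>
     cat_functor (op_cat X) Set_cat (Psh P) \<and>
     PRst P \<in> extensional (Obj X) \<and>
     (\<forall>A \<in> Obj X. PRst P A \<in> elts P A \<rightarrow>\<^sub>E hom X A A) \<and>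
     (\<forall>A \<in> Obj X. \<forall>x \<in> elts P A.
        restriction_idempotent X (PRst P A x) \<and>
        act P x (PRst P A x) = x \<and>
        (\<forall>f \<in> hom X A A. restriction_idempotent X f \<longrightarrow>
           PRst P A (act P x f) = PRst P A x \<cdot>\<^bsub>X\<^esub> f) \<and>
        (\<forall>B \<in> Obj X. \<forall>g \<in> hom X B A.
           PRst P A x \<cdot>\<^bsub>X\<^esub> g = g \<cdot>\<^bsub>X\<^esub> PRst P B (act P x g)))"

definition PSh :: "('u, 'u, 'z) rcat_scheme \<Rightarrow> ('u rpsh, ('u rpsh, 'u, 'u set_map) trans) rcat" where
  "PSh X =
     \<lparr>Obj = {P. restriction_presheaf X P},
      Arr = {\<alpha>. restriction_presheaf X (Src \<alpha>) \<and> restriction_presheaf X (Tgt \<alpha>) \<and>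
                nat_trans (op_cat X) Set_cat (Psh (Src \<alpha>)) (Psh (Tgt \<alpha>)) (Cmp \<alpha>)},
      Dom = Src, Cod = Tgt,
      Ide = (\<lambda>P. \<lparr>Src = P, Tgt = P, Cmp = (\<lambda>A \<in> Obj X. Ide Set_cat (elts P A))\<rparr>),
      Comp = trans_comp X Set_cat,
      Rst = (\<lambda>\<alpha>. \<lparr>Src = Src \<alpha>, Tgt = Src \<alpha>,
                  Cmp = (\<lambda>A \<in> Obj X. \<lparr>SDom = elts (Src \<alpha>) A, SCod = elts (Src \<alpha>) A,
                     SFun = (\<lambda>x \<in> elts (Src \<alpha>) A.
                               act (Src \<alpha>) x (PRst (Tgt \<alpha>) A (SFun (Cmp \<alpha> A) x)))\<rparr>)\<rparr>)\<rparr>"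

definition representable :: "('u, 'u, 'z) rcat_scheme \<Rightarrow> 'u \<Rightarrow> 'u rpsh" where
  "representable X A =
     \<lparr>Psh = \<lparr>FObj = (\<lambda>B \<in> Obj X. hom X B A),
             FArr = (\<lambda>g \<in> Arr X. \<lparr>SDom = hom X (Cod X g) A, SCod = hom X (Dom X g) A,
                                  SFun = (\<lambda>f \<in> hom X (Cod X g) A. f \<cdot>\<^bsub>X\<^esub> g)\<rparr>)\<rparr>,
      PRst = (\<lambda>B \<in> Obj X. \<lambda>f \<in> hom X B A. Rst X f)\<rparr>"

definition yoneda ::
  "('u, 'u, 'z) rcat_scheme \<Rightarrow> ('u, 'u, 'u rpsh, ('u rpsh, 'u, 'u set_map) trans) func" where
  "yoneda X =
     \<lparr>FObj = (\<lambda>A \<in> Obj X. representable X A),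
      FArr = (\<lambda>f \<in> Arr X.
        \<lparr>Src = representable X (Dom X f), Tgt = representable X (Cod X f),
         Cmp = (\<lambda>B \<in> Obj X. \<lparr>SDom = hom X B (Dom X f), SCod = hom X B (Cod X f),
                              SFun = (\<lambda>h \<in> hom X B (Dom X f). f \<cdot>\<^bsub>X\<^esub> h)\<rparr>)\<rparr>)\<rparr>"

end

theory Submission
  imports Defs
begin

text \<open>
  Let \<open>F : X \<rightarrow> E\<close> be a restriction functor into a cocomplete restriction category.  As for ordinary
  presheaves, its extension along the Yoneda embedding \<open>y\<close> sends \<open>P\<close> to the colimit of \<open>F\<close> weighted by
  \<open>P\<close>: an object \<open>c\<close> with a universal family of maps \<open>t x : F A \<rightarrow> c\<close>, one for each element \<open>x\<close> of
  \<open>P A\<close>, natural in \<open>x\<close>.  The point specific to restriction categories is that \<open>t x\<close> is partial, with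
  restriction \<open>F e\<close>, where \<open>e\<close> is the restriction of \<open>x\<close>, here also called the domain of \<open>x\<close>.
  Cocompleteness of \<open>E\<close> concerns diagrams of total maps only; but the idempotents \<open>F e\<close> split in \<open>E\<close>,
  and their splittings form a diagram of total maps over the category of elements of \<open>P\<close>.  Its colimit
  in \<open>Total(E)\<close> is a colimit in \<open>E\<close>, which makes it the weighted colimit
  (\<open>colimit_imp_weighted\<close>, \<open>weighted_colimit_exists\<close>); conversely, weighted colimits are colimits of
  such diagrams in \<open>Total(E)\<close> (\<open>weighted_imp_colimit\<close>).

  A functor \<open>W\<close> on presheaves whose value at each \<open>P\<close> is the colimit of \<open>W y\<close> weighted by \<open>P\<close> is called
  a pointwise Kan extension.  The identity is one, by the Yoneda lemma.  The maps out of a weighted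
  colimit are natural families indexed by elements, and the elements of a colimit of presheaves are
  classes of elements of the presheaves in the diagram; so a pointwise Kan extension preserves colimits
  of diagrams of total maps
  (\<open>pointwise_Kan_colimit\<close>).  For the identity this shows that presheaves are cocomplete
  (\<open>cocomplete_PSh\<close>), and in general that pointwise Kan extensions are cocontinuous.  Conversely, a
  cocontinuous functor preserves the presentation of a presheaf as a colimit of splittings, and is a
  pointwise Kan extension (\<open>cocontinuous_pointwise_Kan\<close>).

  Precomposition with \<open>y\<close> is then fully faithful, because transformations out of a pointwise Kan
  extension are the same as transformations out of its restriction to \<open>X\<close>
  (\<open>pointwise_Kan_trans_eq\<close>, \<open>pointwise_Kan_trans_exists\<close>), and it is essentially surjective by the
  existence of weighted colimits (\<open>pointwise_Kan_exists\<close>).  That the maps so obtained are total, or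
  respect restrictions, always has the same reason: a map out of a weighted colimit is determined by
  its composites with the legs, and by (R4) its restriction is too.
\<close>

section \<open>Categories, functors and colimits\<close>

lemma hom_iff: "f \<in> hom C A B \<longleftrightarrow> f \<in> Arr C \<and> Dom C f = A \<and> Cod C f = B"
  by (simp add: hom_def)

lemma (in category) hom_Obj:
  assumes "f \<in> hom C A B"
  shows "A \<in> Obj C" and "B \<in> Obj C"
  using assms Dom_Obj Cod_Obj by (auto simp: hom_iff)

lemma isoI:
  assumes "f \<in> hom C A B" and "g \<in> hom C B A" and "g \<cdot>\<^bsub>C\<^esub> f = Ide C A" and "f \<cdot>\<^bsub>C\<^esub> g = Ide C B"
  shows "iso C f"
  using assms by (auto simp: iso_def hom_iff)

lemma isoE:
  assumes "iso C f" and "f \<in> hom C A B"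
  obtains g where "g \<in> hom C B A" and "g \<cdot>\<^bsub>C\<^esub> f = Ide C A" and "f \<cdot>\<^bsub>C\<^esub> g = Ide C B"
  using assms by (auto simp: iso_def hom_iff)

lemma cat_functorI:
  assumes "category C" and "category D"
    and "FObj F \<in> extensional (Obj C)" and "FArr F \<in> extensional (Arr C)"
    and obj: "\<And>A. A \<in> Obj C \<Longrightarrow> FObj F A \<in> Obj D"
    and arr: "\<And>f A B. f \<in> hom C A B \<Longrightarrow> FArr F f \<in> hom D (FObj F A) (FObj F B)"
    and ide: "\<And>A. A \<in> Obj C \<Longrightarrow> FArr F (Ide C A) = Ide D (FObj F A)"
    and comp: "\<And>f g A B E. \<lbrakk>f \<in> hom C A B; g \<in> hom C B E\<rbrakk> \<Longrightarrow>
                 FArr F (g \<cdot>\<^bsub>C\<^esub> f) = FArr F g \<cdot>\<^bsub>D\<^esub> FArr F f"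
  shows "cat_functor C D F"
  unfolding cat_functor_def using assms
  by (auto simp: PiE_iff hom_iff)

lemma cat_functorD:
  assumes "cat_functor C D F"
  shows "category C" and "category D"
    and "FObj F \<in> extensional (Obj C)" and "FArr F \<in> extensional (Arr C)"
    and "A \<in> Obj C \<Longrightarrow> FObj F A \<in> Obj D"
    and "f \<in> hom C A B \<Longrightarrow> FArr F f \<in> hom D (FObj F A) (FObj F B)"
    and "A \<in> Obj C \<Longrightarrow> FArr F (Ide C A) = Ide D (FObj F A)"
    and "\<lbrakk>f \<in> hom C A B; g \<in> hom C B E\<rbrakk> \<Longrightarrow> FArr F (g \<cdot>\<^bsub>C\<^esub> f) = FArr F g \<cdot>\<^bsub>D\<^esub> FArr F f"
    and "f \<in> Arr C \<Longrightarrow> FArr F f \<in> Arr D"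
    and "f \<in> Arr C \<Longrightarrow> Dom D (FArr F f) = FObj F (Dom C f)"
    and "f \<in> Arr C \<Longrightarrow> Cod D (FArr F f) = FObj F (Cod C f)"
  using assms by (auto simp: cat_functor_def hom_iff PiE_iff)

lemma (in category) cat_functor_id: "cat_functor C C (id_functor C)"
  by (rule cat_functorI)
    (use hom_Obj Ide_hom Comp_hom in \<open>auto simp: id_functor_def hom_iff category_axioms\<close>)

lemma FObj_comp [simp]: "A \<in> Obj C \<Longrightarrow> FObj (comp_functor C G F) A = FObj G (FObj F A)"
  and FArr_comp [simp]: "f \<in> Arr C \<Longrightarrow> FArr (comp_functor C G F) f = FArr G (FArr F f)"
  by (simp_all add: comp_functor_def)

lemma cat_functor_comp:
  assumes F: "cat_functor C D F" and G: "cat_functor D E G"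
  shows "cat_functor C E (comp_functor C G F)"
proof (rule cat_functorI)
  show "category C" "category E" using cat_functorD(1,2) F G by blast+
  interpret C: category C by fact
  fix f g A B K assume f: "f \<in> hom C A B" and g: "g \<in> hom C B K"
  have "g \<cdot>\<^bsub>C\<^esub> f \<in> hom C A K" using f g by (rule C.Comp_hom)
  then show "FArr (comp_functor C G F) (g \<cdot>\<^bsub>C\<^esub> f)
           = FArr (comp_functor C G F) g \<cdot>\<^bsub>E\<^esub> FArr (comp_functor C G F) f"
    using f g cat_functorD(8)[OF F f g]
      cat_functorD(8)[OF G cat_functorD(6)[OF F f] cat_functorD(6)[OF F g]]
    by (auto simp: comp_functor_def hom_iff)
next
  interpret C: category C by (rule cat_functorD(1)[OF F])
  show "FArr (comp_functor C G F) f \<in> hom E (FObj (comp_functor C G F) A) (FObj (comp_functor C G F) B)"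
    if f: "f \<in> hom C A B" for f A B
    using cat_functorD(6)[OF G cat_functorD(6)[OF F f]] f C.hom_Obj[OF f]
    by (simp add: comp_functor_def hom_iff)
  show "FArr (comp_functor C G F) (Ide C A) = Ide E (FObj (comp_functor C G F) A)"
    if A: "A \<in> Obj C" for A
    using A C.Ide_hom[OF A] cat_functorD(7)[OF F A] cat_functorD(7)[OF G cat_functorD(5)[OF F A]]
    by (simp add: comp_functor_def hom_iff)
qed (use cat_functorD(5)[OF F] cat_functorD(5)[OF G] in \<open>auto simp: comp_functor_def\<close>)

lemma nat_transI:
  assumes "cat_functor C D F" and "cat_functor C D G" and "t \<in> extensional (Obj C)"
    and "\<And>A. A \<in> Obj C \<Longrightarrow> t A \<in> hom D (FObj F A) (FObj G A)"
    and "\<And>f A B. f \<in> hom C A B \<Longrightarrow> t B \<cdot>\<^bsub>D\<^esub> FArr F f = FArr G f \<cdot>\<^bsub>D\<^esub> t A"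
  shows "nat_trans C D F G t"
  using assms by (auto simp: nat_trans_def hom_iff)

lemma nat_transD:
  assumes "nat_trans C D F G t"
  shows "cat_functor C D F" and "cat_functor C D G" and "t \<in> extensional (Obj C)"
    and "A \<in> Obj C \<Longrightarrow> t A \<in> hom D (FObj F A) (FObj G A)"
    and "f \<in> hom C A B \<Longrightarrow> t B \<cdot>\<^bsub>D\<^esub> FArr F f = FArr G f \<cdot>\<^bsub>D\<^esub> t A"
  using assms by (auto simp: nat_trans_def hom_iff)

lemma coconeI:
  fixes C :: "('o, 'm, 'z) cat_scheme" (structure)
  assumes "c \<in> Obj C" and "\<And>j. j \<in> Obj J \<Longrightarrow> t j \<in> hom C (FObj D j) c"
    and "\<And>u i j. u \<in> hom J i j \<Longrightarrow> t j \<cdot> FArr D u = t i"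
  shows "cocone J C D c t"
  using assms by (auto simp: cocone_def hom_iff)

lemma coconeD:
  fixes C :: "('o, 'm, 'z) cat_scheme" (structure)
  assumes "cocone J C D c t"
  shows "c \<in> Obj C" and "j \<in> Obj J \<Longrightarrow> t j \<in> hom C (FObj D j) c"
    and "u \<in> hom J i j \<Longrightarrow> t j \<cdot> FArr D u = t i"
  using assms by (auto simp: cocone_def hom_iff)

lemma colimitI:
  fixes C :: "('o, 'm, 'z) cat_scheme" (structure)
  assumes "cocone J C D c t"
    and "\<And>e s. cocone J C D e s \<Longrightarrow> \<exists>h \<in> hom C c e. \<forall>j \<in> Obj J. h \<cdot> t j = s j"
    and "\<And>e h k. \<lbrakk>h \<in> hom C c e; k \<in> hom C c e; \<forall>j \<in> Obj J. h \<cdot> t j = k \<cdot> t j\<rbrakk> \<Longrightarrow> h = k"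
  shows "colimit J C D c t"
  unfolding colimit_def
proof (intro conjI allI impI)
  fix e s assume "cocone J C D e s"
  then obtain h where h: "h \<in> hom C c e" "\<forall>j \<in> Obj J. h \<cdot> t j = s j" using assms(2) by blast
  show "\<exists>!h. h \<in> hom C c e \<and> (\<forall>j \<in> Obj J. h \<cdot> t j = s j)"
  proof (rule ex1I[of _ h])
    show "k = h" if "k \<in> hom C c e \<and> (\<forall>j \<in> Obj J. k \<cdot> t j = s j)" for k
      using assms(3)[of k e h] h that by simp
  qed (use h in blast)
qed (fact assms(1))

lemma colimit_factor:
  fixes C :: "('o, 'm, 'z) cat_scheme" (structure)
  assumes "colimit J C D c t" and "cocone J C D e s"
  obtains h where "h \<in> hom C c e" and "\<And>j. j \<in> Obj J \<Longrightarrow> h \<cdot> t j = s j"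
  using assms unfolding colimit_def by blast

lemma colimit_eqI:
  fixes C :: "('o, 'm, 'z) cat_scheme" (structure)
  assumes col: "colimit J C D c t" and D: "cat_functor J C D"
    and h: "h \<in> hom C c e" and k: "k \<in> hom C c e"
    and eq: "\<And>j. j \<in> Obj J \<Longrightarrow> h \<cdot> t j = k \<cdot> t j"
  shows "h = k"
proof -
  interpret J: category J by (rule cat_functorD(1)[OF D])
  interpret C: category C by (rule cat_functorD(2)[OF D])
  have t: "cocone J C D c t" using col by (simp add: colimit_def)
  have "cocone J C D e (\<lambda>j. h \<cdot> t j)"
  proof (rule coconeI)
    fix u i j assume u: "u \<in> hom J i j"
    note ij = J.hom_Obj[OF u]
    show "h \<cdot> t j \<cdot> FArr D u = h \<cdot> t i"
      using C.Comp_assoc[OF cat_functorD(6)[OF D u] coconeD(2)[OF t ij(2)] h] coconeD(3)[OF t u]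
      by simp
  qed (use C.hom_Obj[OF h] C.Comp_hom[OF coconeD(2)[OF t] h] in auto)
  then show ?thesis using col h k eq unfolding colimit_def by metis
qed

lemma colimit_unique:
  fixes C :: "('o, 'm, 'z) cat_scheme" (structure)
  assumes c: "colimit J C D c t" and c': "colimit J C D c' t'" and D: "cat_functor J C D"
  obtains h k where "h \<in> hom C c c'" and "k \<in> hom C c' c"
    and "k \<cdot> h = Ide C c" and "h \<cdot> k = Ide C c'"
    and "\<And>j. j \<in> Obj J \<Longrightarrow> h \<cdot> t j = t' j"
    and "\<And>j. j \<in> Obj J \<Longrightarrow> k \<cdot> t' j = t j"
proof -
  interpret C: category C by (rule cat_functorD(2)[OF D])
  have t: "cocone J C D c t" and t': "cocone J C D c' t'" using c c' by (auto simp: colimit_def)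
  obtain h where h: "h \<in> hom C c c'" "\<And>j. j \<in> Obj J \<Longrightarrow> h \<cdot> t j = t' j"
    using colimit_factor[OF c t'] by blast
  obtain k where k: "k \<in> hom C c' c" "\<And>j. j \<in> Obj J \<Longrightarrow> k \<cdot> t' j = t j"
    using colimit_factor[OF c' t] by blast
  have "k \<cdot> h = Ide C c"
  proof (rule colimit_eqI[OF c D C.Comp_hom[OF h(1) k(1)]])
    show "k \<cdot> h \<cdot> t j = Ide C c \<cdot> t j" if "j \<in> Obj J" for j
      using C.Comp_assoc[OF coconeD(2)[OF t that] h(1) k(1)] h(2) k(2) that
        C.Ide_Comp[OF coconeD(2)[OF t that]] by simp
  qed (use C.Ide_hom[OF coconeD(1)[OF t]] in simp)
  moreover have "h \<cdot> k = Ide C c'"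
  proof (rule colimit_eqI[OF c' D C.Comp_hom[OF k(1) h(1)]])
    show "h \<cdot> k \<cdot> t' j = Ide C c' \<cdot> t' j" if "j \<in> Obj J" for j
      using C.Comp_assoc[OF coconeD(2)[OF t' that] k(1) h(1)] h(2) k(2) that
        C.Ide_Comp[OF coconeD(2)[OF t' that]] by simp
  qed (use C.Ide_hom[OF coconeD(1)[OF t']] in simp)
  ultimately show ?thesis using h k that by blast
qed

lemma colimit_iso:
  fixes C :: "('o, 'm, 'z) cat_scheme" (structure)
  assumes c: "colimit J C D c t" and D: "cat_functor J C D"
    and h: "h \<in> hom C c c'" and k: "k \<in> hom C c' c"
    and kh: "k \<cdot> h = Ide C c" and hk: "h \<cdot> k = Ide C c'"
    and ht: "\<And>j. j \<in> Obj J \<Longrightarrow> t' j = h \<cdot> t j"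
  shows "colimit J C D c' t'"
proof -
  interpret J: category J by (rule cat_functorD(1)[OF D])
  interpret C: category C by (rule cat_functorD(2)[OF D])
  have t: "cocone J C D c t" using c by (auto simp: colimit_def)
  note tj = coconeD(2)[OF t]
  show ?thesis
  proof (rule colimitI)
    show "cocone J C D c' t'"
    proof (rule coconeI)
      fix u i j assume u: "u \<in> hom J i j"
      note ij = J.hom_Obj[OF u]
      show "t' j \<cdot> FArr D u = t' i"
        using C.Comp_assoc[OF cat_functorD(6)[OF D u] tj[OF ij(2)] h] coconeD(3)[OF t u] ht ij
        by simp
    qed (use C.hom_Obj[OF h] ht C.Comp_hom[OF tj h] in auto)
  next
    fix e s assume "cocone J C D e s"
    then obtain l where l: "l \<in> hom C c e" "\<And>j. j \<in> Obj J \<Longrightarrow> l \<cdot> t j = s j"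
      using colimit_factor[OF c] by blast
    have "l \<cdot> k \<cdot> t' j = s j" if j: "j \<in> Obj J" for j
    proof -
      have "l \<cdot> k \<cdot> t' j = l \<cdot> (k \<cdot> (h \<cdot> t j))"
        using C.Comp_assoc[OF C.Comp_hom[OF tj[OF j] h] k l(1)] ht[OF j] by simp
      also have "\<dots> = s j"
        using C.Comp_assoc[OF tj[OF j] h k] kh C.Ide_Comp[OF tj[OF j]] l(2)[OF j] by simp
      finally show ?thesis .
    qed
    then show "\<exists>l \<in> hom C c' e. \<forall>j \<in> Obj J. l \<cdot> t' j = s j"
      using C.Comp_hom[OF k l(1)] by blast
  next
    fix e l l'
    assume l: "l \<in> hom C c' e" and l': "l' \<in> hom C c' e"
      and eq: "\<forall>j \<in> Obj J. l \<cdot> t' j = l' \<cdot> t' j"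
    have "l \<cdot> h = l' \<cdot> h"
    proof (rule colimit_eqI[OF c D C.Comp_hom[OF h l] C.Comp_hom[OF h l']])
      show "l \<cdot> h \<cdot> t j = l' \<cdot> h \<cdot> t j" if j: "j \<in> Obj J" for j
        using C.Comp_assoc[OF tj[OF j] h l] C.Comp_assoc[OF tj[OF j] h l'] eq ht j by simp
    qed
    then have "l \<cdot> h \<cdot> k = l' \<cdot> h \<cdot> k" by simp
    then show "l = l'"
      using C.Comp_assoc[OF k h l] C.Comp_assoc[OF k h l'] hk C.Comp_Ide[OF l] C.Comp_Ide[OF l']
      by simp
  qed
qed

text \<open>
  A quasi-inverse is obtained by choosing for every object of the codomain a preimage up to
  isomorphism and conjugating arrows by the chosen isomorphisms.
\<close>

lemma equivalence_functorI:
  assumes F: "cat_functor C D F"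
    and full: "\<And>A B g. \<lbrakk>A \<in> Obj C; B \<in> Obj C; g \<in> hom D (FObj F A) (FObj F B)\<rbrakk> \<Longrightarrow>
                 \<exists>f \<in> hom C A B. FArr F f = g"
    and faithful: "\<And>A B f f'. \<lbrakk>f \<in> hom C A B; f' \<in> hom C A B; FArr F f = FArr F f'\<rbrakk> \<Longrightarrow> f = f'"
    and surj: "\<And>Y. Y \<in> Obj D \<Longrightarrow> \<exists>A \<in> Obj C. \<exists>k \<in> hom D (FObj F A) Y. iso D k"
  shows "equivalence_functor C D F"
proof -
  interpret C: category C by (rule cat_functorD(1)[OF F])
  interpret D: category D by (rule cat_functorD(2)[OF F])
  have "\<forall>Y \<in> Obj D. \<exists>A k k'. A \<in> Obj C \<and> k \<in> hom D (FObj F A) Y \<and> k' \<in> hom D Y (FObj F A) \<and>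
          k' \<cdot>\<^bsub>D\<^esub> k = Ide D (FObj F A) \<and> k \<cdot>\<^bsub>D\<^esub> k' = Ide D Y"
    using surj isoE by metis
  then obtain T k k' where T: "\<And>Y. Y \<in> Obj D \<Longrightarrow> T Y \<in> Obj C"
    and k: "\<And>Y. Y \<in> Obj D \<Longrightarrow> k Y \<in> hom D (FObj F (T Y)) Y"
    and k': "\<And>Y. Y \<in> Obj D \<Longrightarrow> k' Y \<in> hom D Y (FObj F (T Y))"
    and k'k: "\<And>Y. Y \<in> Obj D \<Longrightarrow> k' Y \<cdot>\<^bsub>D\<^esub> k Y = Ide D (FObj F (T Y))"
    and kk': "\<And>Y. Y \<in> Obj D \<Longrightarrow> k Y \<cdot>\<^bsub>D\<^esub> k' Y = Ide D Y"
    by metis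
  define lift where "lift A B g = (SOME f. f \<in> hom C A B \<and> FArr F f = g)" for A B g
  have lift: "lift A B g \<in> hom C A B" "FArr F (lift A B g) = g"
    if "A \<in> Obj C" "B \<in> Obj C" "g \<in> hom D (FObj F A) (FObj F B)" for A B g
    using full[OF that] unfolding lift_def by (metis (mono_tags, lifting) someI_ex)+
  define conj where "conj g = k' (Cod D g) \<cdot>\<^bsub>D\<^esub> (g \<cdot>\<^bsub>D\<^esub> k (Dom D g))" for g
  have conj_eq: "conj g = k' Z \<cdot>\<^bsub>D\<^esub> (g \<cdot>\<^bsub>D\<^esub> k Y)" if "g \<in> hom D Y Z" for g Y Z
    using that by (simp add: conj_def hom_iff)
  have conj: "conj g \<in> hom D (FObj F (T Y)) (FObj F (T Z))" if g: "g \<in> hom D Y Z" for g Y Z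
    unfolding conj_eq[OF g]
    using D.Comp_hom[OF D.Comp_hom[OF k[OF D.hom_Obj(1)[OF g]] g] k'[OF D.hom_Obj(2)[OF g]]] .
  define G where "G = \<lparr>FObj = (\<lambda>Y \<in> Obj D. T Y),
    FArr = (\<lambda>g \<in> Arr D. lift (T (Dom D g)) (T (Cod D g)) (conj g))\<rparr>"
  have GO: "FObj G Y = T Y" if "Y \<in> Obj D" for Y using that by (simp add: G_def)
  have GA: "FArr G g \<in> hom C (T Y) (T Z)" "FArr F (FArr G g) = conj g" if g: "g \<in> hom D Y Z" for g Y Z
    using lift[OF T[OF D.hom_Obj(1)[OF g]] T[OF D.hom_Obj(2)[OF g]] conj[OF g]] g
    by (simp_all add: G_def hom_iff)
  \<comment> \<open>the chosen isomorphisms are natural with respect to conjugation\<close>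
  have k_conj: "k Z \<cdot>\<^bsub>D\<^esub> conj g = g \<cdot>\<^bsub>D\<^esub> k Y" if g: "g \<in> hom D Y Z" for g Y Z
  proof -
    note Y = D.hom_Obj(1)[OF g] and Z = D.hom_Obj(2)[OF g]
    have gk: "g \<cdot>\<^bsub>D\<^esub> k Y \<in> hom D (FObj F (T Y)) Z" using D.Comp_hom[OF k[OF Y] g] .
    show ?thesis
      using D.Comp_assoc[OF gk k'[OF Z] k[OF Z]] kk'[OF Z] D.Ide_Comp[OF gk] conj_eq[OF g] by simp
  qed
  have k_eqI: "h = h'" if Z: "Z \<in> Obj D" and h: "h \<in> hom D W (FObj F (T Z))"
    and h': "h' \<in> hom D W (FObj F (T Z))" and eq: "k Z \<cdot>\<^bsub>D\<^esub> h = k Z \<cdot>\<^bsub>D\<^esub> h'" for h h' W Z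
  proof -
    have "k' Z \<cdot>\<^bsub>D\<^esub> (k Z \<cdot>\<^bsub>D\<^esub> h) = k' Z \<cdot>\<^bsub>D\<^esub> (k Z \<cdot>\<^bsub>D\<^esub> h')" using eq by simp
    then show ?thesis
      using D.Comp_assoc[OF h k[OF Z] k'[OF Z]] D.Comp_assoc[OF h' k[OF Z] k'[OF Z]] k'k[OF Z]
        D.Ide_Comp[OF h] D.Ide_Comp[OF h'] by simp
  qed
  have G: "cat_functor D C G"
  proof (rule cat_functorI)
    show "category D" "category C" by unfold_locales
    show "FObj G Y \<in> Obj C" if "Y \<in> Obj D" for Y using that T by (simp add: G_def)
    show "FArr G g \<in> hom C (FObj G Y) (FObj G Z)" if "g \<in> hom D Y Z" for g Y Z
      using GA(1)[OF that] GO D.hom_Obj[OF that] by simp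
    show "FArr G (Ide D Y) = Ide C (FObj G Y)" if Y: "Y \<in> Obj D" for Y
    proof (rule faithful)
      show 1: "FArr G (Ide D Y) \<in> hom C (T Y) (T Y)" using GA(1)[OF D.Ide_hom[OF Y]] .
      show "Ide C (FObj G Y) \<in> hom C (T Y) (T Y)" using C.Ide_hom[OF T[OF Y]] GO[OF Y] by simp
      have "conj (Ide D Y) = Ide D (FObj F (T Y))"
        using conj_eq[OF D.Ide_hom[OF Y]] D.Ide_Comp[OF k[OF Y]] k'k[OF Y] by simp
      then show "FArr F (FArr G (Ide D Y)) = FArr F (Ide C (FObj G Y))"
        using GA(2)[OF D.Ide_hom[OF Y]] cat_functorD(7)[OF F T[OF Y]] GO[OF Y] by simp
    qed
    show "FArr G (h \<cdot>\<^bsub>D\<^esub> g) = FArr G h \<cdot>\<^bsub>C\<^esub> FArr G g"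
      if g: "g \<in> hom D Y Z" and h: "h \<in> hom D Z W" for g h Y Z W
    proof (rule faithful)
      note hg = D.Comp_hom[OF g h]
      note W = D.hom_Obj(2)[OF h] and Y = D.hom_Obj(1)[OF g]
      show "FArr G (h \<cdot>\<^bsub>D\<^esub> g) \<in> hom C (T Y) (T W)" using GA(1)[OF hg] .
      show "FArr G h \<cdot>\<^bsub>C\<^esub> FArr G g \<in> hom C (T Y) (T W)" using C.Comp_hom[OF GA(1)[OF g] GA(1)[OF h]] .
      have "conj (h \<cdot>\<^bsub>D\<^esub> g) = conj h \<cdot>\<^bsub>D\<^esub> conj g"
      proof (rule k_eqI[OF W conj[OF hg] D.Comp_hom[OF conj[OF g] conj[OF h]]])
        have "k W \<cdot>\<^bsub>D\<^esub> (conj h \<cdot>\<^bsub>D\<^esub> conj g) = h \<cdot>\<^bsub>D\<^esub> k Z \<cdot>\<^bsub>D\<^esub> conj g"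
          using D.Comp_assoc[OF conj[OF g] conj[OF h] k[OF W]] k_conj[OF h] by simp
        also have "\<dots> = h \<cdot>\<^bsub>D\<^esub> (g \<cdot>\<^bsub>D\<^esub> k Y)"
          using D.Comp_assoc[OF conj[OF g] k[OF D.hom_Obj(1)[OF h]] h] k_conj[OF g] by simp
        also have "\<dots> = k W \<cdot>\<^bsub>D\<^esub> conj (h \<cdot>\<^bsub>D\<^esub> g)"
          using D.Comp_assoc[OF k[OF Y] g h] k_conj[OF hg] by simp
        finally show "k W \<cdot>\<^bsub>D\<^esub> conj (h \<cdot>\<^bsub>D\<^esub> g) = k W \<cdot>\<^bsub>D\<^esub> (conj h \<cdot>\<^bsub>D\<^esub> conj g)" by simp
      qed
      then show "FArr F (FArr G (h \<cdot>\<^bsub>D\<^esub> g)) = FArr F (FArr G h \<cdot>\<^bsub>C\<^esub> FArr G g)"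
        using GA(2)[OF hg] cat_functorD(8)[OF F GA(1)[OF g] GA(1)[OF h]] GA(2)[OF g] GA(2)[OF h]
        by simp
    qed
  qed (auto simp: G_def)
  have FG: "naturally_isomorphic D D (comp_functor D F G) (id_functor D)"
    unfolding naturally_isomorphic_def
  proof (intro exI conjI ballI)
    show "nat_trans D D (comp_functor D F G) (id_functor D) (\<lambda>Y \<in> Obj D. k Y)"
    proof (rule nat_transI)
      show "cat_functor D D (comp_functor D F G)" by (rule cat_functor_comp[OF G F])
      show "cat_functor D D (id_functor D)" by (rule D.cat_functor_id)
      fix f A B assume f: "f \<in> hom D A B"
      show "(\<lambda>Y\<in>Obj D. k Y) B \<cdot>\<^bsub>D\<^esub> FArr (comp_functor D F G) f
          = FArr (id_functor D) f \<cdot>\<^bsub>D\<^esub> (\<lambda>Y\<in>Obj D. k Y) A"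
        using f k_conj[OF f] GA(2)[OF f] D.hom_Obj[OF f]
        by (simp add: id_functor_def hom_iff)
    qed (use k in \<open>auto simp: id_functor_def GO\<close>)
    show "iso D ((\<lambda>Y\<in>Obj D. k Y) Y)" if "Y \<in> Obj D" for Y
      using isoI[OF k[OF that] k'[OF that] k'k[OF that] kk'[OF that]] that by simp
  qed
  have FO: "FObj F A \<in> Obj D" if "A \<in> Obj C" for A using that cat_functorD(5)[OF F] by blast
  define s where "s A = lift A (T (FObj F A)) (k' (FObj F A))" for A
  define s' where "s' A = lift (T (FObj F A)) A (k (FObj F A))" for A
  have s: "s A \<in> hom C A (T (FObj F A))" "FArr F (s A) = k' (FObj F A)" if "A \<in> Obj C" for A
    unfolding s_def using lift that T FO k' by blast+
  have s': "s' A \<in> hom C (T (FObj F A)) A" "FArr F (s' A) = k (FObj F A)" if "A \<in> Obj C" for A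
    unfolding s'_def using lift that T FO k by blast+
  have GF: "naturally_isomorphic C C (id_functor C) (comp_functor C G F)"
    unfolding naturally_isomorphic_def
  proof (intro exI conjI ballI)
    show "nat_trans C C (id_functor C) (comp_functor C G F) (\<lambda>A \<in> Obj C. s A)"
    proof (rule nat_transI)
      show "cat_functor C C (comp_functor C G F)" by (rule cat_functor_comp[OF F G])
      show "cat_functor C C (id_functor C)" by (rule C.cat_functor_id)
      fix f A B assume f: "f \<in> hom C A B"
      note A = C.hom_Obj(1)[OF f] and B = C.hom_Obj(2)[OF f]
      note Ff = cat_functorD(6)[OF F f]
      note kA = k[OF FO[OF A]] k'[OF FO[OF A]] and kB = k[OF FO[OF B]] k'[OF FO[OF B]]
      have "s B \<cdot>\<^bsub>C\<^esub> f = FArr G (FArr F f) \<cdot>\<^bsub>C\<^esub> s A"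
      proof (rule faithful)
        show "s B \<cdot>\<^bsub>C\<^esub> f \<in> hom C A (T (FObj F B))" using C.Comp_hom[OF f s(1)[OF B]] .
        show "FArr G (FArr F f) \<cdot>\<^bsub>C\<^esub> s A \<in> hom C A (T (FObj F B))"
          using C.Comp_hom[OF s(1)[OF A] GA(1)[OF Ff]] .
        have "conj (FArr F f) \<cdot>\<^bsub>D\<^esub> k' (FObj F A) = k' (FObj F B) \<cdot>\<^bsub>D\<^esub> FArr F f"
          using conj_eq[OF Ff] D.Comp_assoc[OF kA(2) D.Comp_hom[OF kA(1) Ff] kB(2)]
            D.Comp_assoc[OF kA(2) kA(1) Ff] kk'[OF FO[OF A]] D.Comp_Ide[OF Ff] by simp
        then show "FArr F (s B \<cdot>\<^bsub>C\<^esub> f) = FArr F (FArr G (FArr F f) \<cdot>\<^bsub>C\<^esub> s A)"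
          using cat_functorD(8)[OF F f s(1)[OF B]] cat_functorD(8)[OF F s(1)[OF A] GA(1)[OF Ff]]
            s(2)[OF A] s(2)[OF B] GA(2)[OF Ff] by simp
      qed
      then show "(\<lambda>A\<in>Obj C. s A) B \<cdot>\<^bsub>C\<^esub> FArr (id_functor C) f
               = FArr (comp_functor C G F) f \<cdot>\<^bsub>C\<^esub> (\<lambda>A\<in>Obj C. s A) A"
        using f A B by (simp add: id_functor_def hom_iff)
    qed (use s FO in \<open>auto simp: id_functor_def GO\<close>)
    fix A assume A: "A \<in> Obj C"
    have "s' A \<cdot>\<^bsub>C\<^esub> s A = Ide C A"
      by (rule faithful[of _ A A])
        (use A C.Comp_hom[OF s(1)[OF A] s'(1)[OF A]] C.Ide_hom[OF A] s(2)[OF A] s'(2)[OF A] kk'[OF FO[OF A]]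
          cat_functorD(8)[OF F s(1)[OF A] s'(1)[OF A]] cat_functorD(7)[OF F A] in simp_all)
    moreover have "s A \<cdot>\<^bsub>C\<^esub> s' A = Ide C (T (FObj F A))"
      by (rule faithful[of _ "T (FObj F A)" "T (FObj F A)"])
        (use A C.Comp_hom[OF s'(1)[OF A] s(1)[OF A]] C.Ide_hom[OF T[OF FO[OF A]]] s(2)[OF A] s'(2)[OF A]
          k'k[OF FO[OF A]] cat_functorD(8)[OF F s'(1)[OF A] s(1)[OF A]] cat_functorD(7)[OF F T[OF FO[OF A]]] in simp_all)
    ultimately show "iso C ((\<lambda>A\<in>Obj C. s A) A)" using isoI[OF s(1)[OF A] s'(1)[OF A]] A by simp
  qed
  show ?thesis unfolding equivalence_functor_def using F G GF FG by blast
qed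

lemma colimit_cong:
  assumes "\<And>j. j \<in> Obj J \<Longrightarrow> t j = t' j" and "category J"
  shows "colimit J C D c t \<longleftrightarrow> colimit J C D c t'"
proof -
  interpret J: category J by fact
  have "cocone J C D c t \<longleftrightarrow> cocone J C D c t'"
    using assms(1) J.Dom_Obj J.Cod_Obj by (simp add: cocone_def)
  then show ?thesis using assms(1) by (simp add: colimit_def)
qed


section \<open>Restriction categories and their total maps\<close>

context restriction_category
begin

lemma Rst_Ide: "A \<in> Obj X \<Longrightarrow> Rst X (Ide X A) = Ide X A"
  using R1[OF Ide_hom] Ide_Comp[OF Rst_hom[OF Ide_hom]] by metis

lemma Rst_Rst: "f \<in> hom X A B \<Longrightarrow> Rst X (Rst X f) = Rst X f"
  using R3[OF _ Ide_hom, of f A B] Ide_Comp[OF Rst_hom] Rst_Ide hom_Obj(1) by metis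

lemma Rst_idem: "f \<in> hom X A B \<Longrightarrow> Rst X f \<cdot> Rst X f = Rst X f"
  using R3[of f A B f B] R1 by metis

lemma Rst_Comp_Rst:
  assumes f: "f \<in> hom X A B" and g: "g \<in> hom X B C"
  shows "Rst X (Rst X g \<cdot> f) = Rst X (g \<cdot> f)"
proof -
  note gf = Comp_hom[OF f g]
  have "Rst X (Rst X g \<cdot> f) = Rst X f \<cdot> Rst X (g \<cdot> f)" using R4[OF f g] R3[OF gf f] by simp
  also have "\<dots> = Rst X ((g \<cdot> f) \<cdot> Rst X f)" using R2[OF gf f] R3[OF f gf] by simp
  also have "\<dots> = Rst X (g \<cdot> f)"
    using Comp_assoc[OF Rst_hom[OF f] f g] R1[OF f] by simp
  finally show ?thesis .
qed

lemma total_map_iff: "f \<in> hom X A B \<Longrightarrow> total_map X f \<longleftrightarrow> Rst X f = Ide X A"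
  by (simp add: total_map_def hom_iff)

lemma total_Ide: "A \<in> Obj X \<Longrightarrow> total_map X (Ide X A)"
  using Rst_Ide total_map_iff[OF Ide_hom] by blast

lemma Rst_total_Comp:
  assumes "f \<in> hom X A B" and "g \<in> hom X B C" and "total_map X g"
  shows "Rst X (g \<cdot> f) = Rst X f"
  using Rst_Comp_Rst[OF assms(1,2)] assms total_map_iff Ide_Comp by metis

lemma total_Comp:
  assumes "f \<in> hom X A B" and "g \<in> hom X B C" and "total_map X f" and "total_map X g"
  shows "total_map X (g \<cdot> f)"
  using Rst_total_Comp[OF assms(1,2,4)] assms(3) total_map_iff[OF assms(1)]
    total_map_iff[OF Comp_hom[OF assms(1,2)]] by simp

lemma total_section:
  assumes m: "m \<in> hom X A B" and r: "r \<in> hom X B A" and rm: "r \<cdot> m = Ide X A"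
  shows "total_map X m"
proof -
  note A = hom_Obj(1)[OF m]
  have "Rst X (r \<cdot> m) \<cdot> Rst X m = Rst X (r \<cdot> m)"
    using R3[OF m Comp_hom[OF m r]] Comp_assoc[OF Rst_hom[OF m] m r] R1[OF m] by simp
  then have "Rst X m = Ide X A" using rm Rst_Ide[OF A] Ide_Comp[OF Rst_hom[OF m]] by simp
  then show ?thesis using total_map_iff[OF m] by simp
qed

text \<open>
  The section \<open>m\<close> is total, and composition with a total map does not change restrictions.  When
  \<open>m r\<close> is a restriction idempotent, it is therefore the restriction of \<open>r\<close>.
\<close>

lemma Rst_retraction:
  assumes m: "m \<in> hom X A B" and r: "r \<in> hom X B A" and rm: "r \<cdot> m = Ide X A"
  shows "Rst X r = Rst X (m \<cdot> r)"
  using Rst_total_Comp[OF r m total_section[OF assms]] by simp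

end

lemma Total_simps [simp]:
  "Obj (Total X) = Obj X" "Dom (Total X) = Dom X" "Cod (Total X) = Cod X" "Ide (Total X) = Ide X"
  "Comp (Total X) = Comp X" "f \<in> Arr (Total X) \<longleftrightarrow> total_map X f"
  by (simp_all add: Total_def)

lemma hom_Total: "f \<in> hom (Total X) A B \<longleftrightarrow> f \<in> hom X A B \<and> total_map X f"
  by (auto simp: hom_iff total_map_def)

context restriction_category
begin

lemma category_Total: "category (Total X)"
  by unfold_locales
    (use Dom_Obj Cod_Obj Ide_hom Comp_hom Comp_Ide Ide_Comp Comp_assoc total_Comp total_Ide in
      \<open>auto simp: hom_Total total_map_def\<close>)

lemma cat_functor_TotalD:
  assumes D: "cat_functor J (Total X) D"
  shows "cat_functor J X D"
  by (rule cat_functorI)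
    (use cat_functorD[OF D] category_axioms in \<open>auto simp: hom_Total\<close>)

text \<open>
  A map out of the colimit whose composites with the legs are total is total: its restriction is
  the identity after composition with each leg.
\<close>

lemma colimit_Total:
  assumes D: "cat_functor J (Total X) D" and c: "colimit J X D c t"
    and tot: "\<And>j. j \<in> Obj J \<Longrightarrow> total_map X (t j)"
  shows "colimit J (Total X) D c t"
proof (rule colimitI)
  note DX = cat_functor_TotalD[OF D]
  have t: "cocone J X D c t" using c by (simp add: colimit_def)
  show "cocone J (Total X) D c t"
    by (rule coconeI) (use coconeD[OF t] tot in \<open>auto simp: hom_Total\<close>)
  fix e s assume s: "cocone J (Total X) D e s"
  have sX: "cocone J X D e s"
    by (rule coconeI) (use coconeD[OF s] in \<open>auto simp: hom_Total\<close>)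
  obtain h where h: "h \<in> hom X c e" "\<And>j. j \<in> Obj J \<Longrightarrow> h \<cdot> t j = s j"
    using colimit_factor[OF c sX] by blast
  have "Rst X h = Ide X c"
  proof (rule colimit_eqI[OF c DX Rst_hom[OF h(1)] Ide_hom[OF hom_Obj(1)[OF h(1)]]])
    fix j assume j: "j \<in> Obj J"
    note tj = coconeD(2)[OF t j] and sj = coconeD(2)[OF s j, unfolded hom_Total]
    have "Rst X h \<cdot> t j = t j \<cdot> Ide X (FObj D j)"
      using R4[OF tj h(1)] h(2)[OF j] sj total_map_iff[of "s j" "FObj D j" e] by simp
    then show "Rst X h \<cdot> t j = Ide X c \<cdot> t j" using Comp_Ide[OF tj] Ide_Comp[OF tj] by simp
  qed
  then show "\<exists>h \<in> hom (Total X) c e. \<forall>j \<in> Obj J. h \<cdot>\<^bsub>Total X\<^esub> t j = s j"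
    using h total_map_iff[OF h(1)] by (auto simp: hom_Total intro!: bexI[of _ h])
next
  fix e h k
  assume "h \<in> hom (Total X) c e" "k \<in> hom (Total X) c e"
    "\<forall>j \<in> Obj J. h \<cdot>\<^bsub>Total X\<^esub> t j = k \<cdot>\<^bsub>Total X\<^esub> t j"
  then show "h = k"
    using colimit_eqI[OF c cat_functor_TotalD[OF D], of h e k] by (auto simp: hom_Total)
qed

end

lemma comp_Total_inclusion:
  assumes D: "cat_functor J (Total Y) D"
  shows "comp_functor J (Total_inclusion Y) D = D"
proof (rule func.equality)
  show "FObj (comp_functor J (Total_inclusion Y) D) = FObj D"
    by (rule extensionalityI[of _ "Obj J"])
      (use cat_functorD(3,5)[OF D] in \<open>auto simp: comp_functor_def Total_inclusion_def\<close>)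
  show "FArr (comp_functor J (Total_inclusion Y) D) = FArr D"
    by (rule extensionalityI[of _ "Arr J"])
      (use cat_functorD(4,9)[OF D] in \<open>auto simp: comp_functor_def Total_inclusion_def\<close>)
qed simp

lemma comp_Total_functor:
  assumes D: "cat_functor J (Total Y) D"
  shows "comp_functor J (Total_functor Y F) D = comp_functor J F D"
  unfolding comp_functor_def Total_functor_def
  using cat_functorD(5,9)[OF D] by (auto cong: restrict_cong)

text \<open>
  The inclusion acts as the identity on extensional diagrams of total maps, so that preservation says
  that colimits in \<open>Total(Y)\<close> are colimits in \<open>Y\<close>.
\<close>

lemma preserves_Total_inclusion_iff:
  "preserves_colimits U (Total Y) Y (Total_inclusion Y) \<longleftrightarrow>
     (\<forall>(J :: ('u, 'u) cat) D c t.
        small_category J \<and> cat_functor J (Total Y) D \<and> colimit J (Total Y) D c t \<longrightarrow>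
        colimit J Y D c t)" for U :: "'u itself"
proof -
  have "colimit J Y (comp_functor J (Total_inclusion Y) D) (FObj (Total_inclusion Y) c)
          (\<lambda>j. FArr (Total_inclusion Y) (t j)) \<longleftrightarrow> colimit J Y D c t"
    if D: "cat_functor J (Total Y) D" and c: "colimit J (Total Y) D c t"
    for J :: "('u, 'u) cat" and D c t
  proof -
    have t: "cocone J (Total Y) D c t" using c by (simp add: colimit_def)
    have "FObj (Total_inclusion Y) c = c" using coconeD(1)[OF t] by (simp add: Total_inclusion_def)
    moreover have "FArr (Total_inclusion Y) (t j) = t j" if "j \<in> Obj J" for j
      using coconeD(2)[OF t that] by (simp add: Total_inclusion_def hom_Total)
    ultimately show ?thesis
      using colimit_cong[OF _ cat_functorD(1)[OF D]] comp_Total_inclusion[OF D] by metis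
  qed
  then show ?thesis unfolding preserves_colimits_def by blast
qed

lemma preserves_Total_functor_iff:
  "preserves_colimits U (Total Y) (Total Z) (Total_functor Y F) \<longleftrightarrow>
     (\<forall>(J :: ('u, 'u) cat) D c t.
        small_category J \<and> cat_functor J (Total Y) D \<and> colimit J (Total Y) D c t \<longrightarrow>
        colimit J (Total Z) (comp_functor J F D) (FObj F c) (\<lambda>j. FArr F (t j)))" for U :: "'u itself"
proof -
  have "colimit J (Total Z) (comp_functor J (Total_functor Y F) D) (FObj (Total_functor Y F) c)
          (\<lambda>j. FArr (Total_functor Y F) (t j)) \<longleftrightarrow>
        colimit J (Total Z) (comp_functor J F D) (FObj F c) (\<lambda>j. FArr F (t j))"
    if D: "cat_functor J (Total Y) D" and c: "colimit J (Total Y) D c t"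
    for J :: "('u, 'u) cat" and D c t
  proof -
    have t: "cocone J (Total Y) D c t" using c by (simp add: colimit_def)
    have "FObj (Total_functor Y F) c = FObj F c"
      using coconeD(1)[OF t] by (simp add: Total_functor_def)
    moreover have "FArr (Total_functor Y F) (t j) = FArr F (t j)" if "j \<in> Obj J" for j
      using coconeD(2)[OF t that] by (simp add: Total_functor_def hom_Total)
    ultimately show ?thesis
      using colimit_cong[OF _ cat_functorD(1)[OF D], of "\<lambda>j. FArr (Total_functor Y F) (t j)"
          "\<lambda>j. FArr F (t j)"] comp_Total_functor[OF D, of F] by simp
  qed
  then show ?thesis unfolding preserves_colimits_def by blast
qed

text \<open>
  Colimits in \<open>Total(Y)\<close> are unique up to isomorphism, so it suffices to find for each diagram of
  total maps one colimit in \<open>Y\<close> with total legs.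
\<close>

lemma (in restriction_category) cocomplete_rcatI:
  fixes U :: "'u itself"
  assumes "split_rcat X"
    and ex: "\<And>(J :: ('u, 'u) cat) D. \<lbrakk>small_category J; cat_functor J (Total X) D\<rbrakk> \<Longrightarrow>
               \<exists>c t. colimit J X D c t \<and> (\<forall>j \<in> Obj J. total_map X (t j))"
  shows "cocomplete_rcat U X"
  unfolding cocomplete_rcat_def
proof (intro conjI)
  show "cocomplete U (Total X)"
    unfolding cocomplete_def using ex colimit_Total category_Total by metis
  show "preserves_colimits U (Total X) X (Total_inclusion X)"
    unfolding preserves_Total_inclusion_iff
  proof (intro allI impI, elim conjE)
    fix J :: "('u, 'u) cat" and D c' t'
    assume J: "small_category J" and D: "cat_functor J (Total X) D"
      and c': "colimit J (Total X) D c' t'"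
    obtain c t where c: "colimit J X D c t" and t: "\<And>j. j \<in> Obj J \<Longrightarrow> total_map X (t j)"
      using ex[OF J D] by blast
    obtain h k where hk: "h \<in> hom (Total X) c c'" "k \<in> hom (Total X) c' c"
      "k \<cdot> h = Ide X c" "h \<cdot> k = Ide X c'" "\<And>j. j \<in> Obj J \<Longrightarrow> h \<cdot> t j = t' j"
      using colimit_unique[OF colimit_Total[OF D c t] c' D, unfolded Total_simps] by metis
    then show "colimit J X D c' t'"
      using colimit_iso[OF c cat_functor_TotalD[OF D], of h c' k t'] by (simp add: hom_Total)
  qed
qed (fact assms(1) restriction_category_axioms)+

lemma cocomplete_rcatD:
  fixes U :: "'u itself" and J :: "('u, 'u) cat"
  assumes "cocomplete_rcat U Y"
  shows "restriction_category Y" and "split_rcat Y"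
    and "\<lbrakk>small_category J; cat_functor J (Total Y) D\<rbrakk> \<Longrightarrow> \<exists>c t. colimit J (Total Y) D c t"
    and "\<lbrakk>small_category J; cat_functor J (Total Y) D; colimit J (Total Y) D c t\<rbrakk> \<Longrightarrow>
           colimit J Y D c t"
  using assms unfolding cocomplete_rcat_def preserves_Total_inclusion_iff
  by (auto simp: cocomplete_def)

lemma restriction_functorD:
  assumes "restriction_functor X Y F"
  shows "restriction_category X" and "restriction_category Y" and "cat_functor X Y F"
    and "f \<in> hom X A B \<Longrightarrow> FArr F (Rst X f) = Rst Y (FArr F f)"
  using assms by (auto simp: restriction_functor_def hom_iff)

lemma restriction_functor_total:
  assumes F: "restriction_functor X Y F" and f: "total_map X f"
  shows "total_map Y (FArr F f)"
proof -
  interpret X: restriction_category X using restriction_functorD(1)[OF F] .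
  have fh: "f \<in> hom X (Dom X f) (Cod X f)" using f by (simp add: total_map_def hom_iff)
  note F' = restriction_functorD(3)[OF F]
  have "Rst Y (FArr F f) = Ide Y (FObj F (Dom X f))"
    using restriction_functorD(4)[OF F fh] f cat_functorD(7)[OF F' X.hom_Obj(1)[OF fh]]
    by (simp add: total_map_def)
  then show ?thesis using cat_functorD(6)[OF F' fh] by (simp add: total_map_def hom_iff)
qed

lemma restriction_functor_Total:
  assumes F: "restriction_functor Y Z F" and D: "cat_functor J (Total Y) D"
  shows "cat_functor J (Total Z) (comp_functor J F D)"
proof -
  interpret Y: restriction_category Y using restriction_functorD(1)[OF F] .
  interpret Z: restriction_category Z using restriction_functorD(2)[OF F] .
  note FD = cat_functor_comp[OF Y.cat_functor_TotalD[OF D] restriction_functorD(3)[OF F]]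
  show ?thesis
  proof (rule cat_functorI)
    fix f A B assume f: "f \<in> hom J A B"
    have "total_map Z (FArr F (FArr D f))"
      using restriction_functor_total[OF F] cat_functorD(6)[OF D f] by (simp add: hom_Total)
    then show "FArr (comp_functor J F D) f \<in>
        hom (Total Z) (FObj (comp_functor J F D) A) (FObj (comp_functor J F D) B)"
      using cat_functorD(6)[OF FD f] f by (simp add: hom_Total hom_iff)
  qed (use cat_functorD[OF FD] Z.category_Total in auto)
qed

section \<open>Small sets\<close>

lemma small_subset: "small T \<Longrightarrow> S \<subseteq> T \<Longrightarrow> small S"
  unfolding small_def using card_of_mono1 ordLeq_ordLess_trans by blast

lemma small_image:
  fixes f :: "'a \<Rightarrow> 'u"
  assumes "|S| <o |UNIV :: 'u set|"
  shows "small (f ` S)"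
  unfolding small_def using card_of_image assms ordLeq_ordLess_trans by blast

text \<open>
  The objects and arrows of a diagram shape, and the elements of a presheaf, are elements of \<open>'u\<close>.
  Pairs of such elements are coded in \<open>'u\<close>, which is possible because \<open>'u\<close> is infinite.
\<close>

definition pair :: "'u \<times> 'u \<Rightarrow> 'u" where
  "pair = (SOME f. inj f)"

definition unpair :: "'u \<Rightarrow> 'u \<times> 'u" where
  "unpair = inv pair"

lemma inj_pair:
  assumes "universe TYPE('u)"
  shows "inj (pair :: 'u \<times> 'u \<Rightarrow> 'u)"
proof -
  have "|UNIV :: ('u \<times> 'u) set| =o |UNIV :: 'u set|"
    using card_of_Times_same_infinite[of "UNIV :: 'u set"] assms by (simp add: universe_def)
  then have "\<exists>f :: 'u \<times> 'u \<Rightarrow> 'u. inj f"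
    by (metis card_of_ordIso bij_betw_def)
  then show ?thesis unfolding pair_def by (rule someI_ex)
qed

lemma unpair_pair:
  assumes "universe TYPE('u)"
  shows "unpair (pair p) = (p :: 'u \<times> 'u)"
  unfolding unpair_def using inv_f_f[OF inj_pair[OF assms]] .

text \<open>
  An infinite regular cardinal is stable: a small sum of small sets is small.  This bounds the size of
  categories of elements and of colimits of presheaves.
\<close>

lemma small_pair_Sigma:
  fixes S :: "'u set" and T :: "'u \<Rightarrow> 'u set"
  assumes U: "universe TYPE('u)" and S: "small S" and T: "\<And>x. x \<in> S \<Longrightarrow> small (T x)"
  shows "small (pair ` Sigma S T)"
proof (rule small_image)
  have "stable |UNIV :: 'u set|"
    using regularCard_stable[OF card_of_Card_order, of "UNIV :: 'u set"] U
    by (simp add: universe_def Field_card_of)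
  then show "|Sigma S T| <o |UNIV :: 'u set|"
    using S T by (simp add: stable_def small_def)
qed


section \<open>Restriction presheaves\<close>

locale small_restriction_category = restriction_category X
  for X :: "('u, 'u) rcat" (structure) +
  assumes universe: "universe TYPE('u)"
    and small_category: "small_category X"
begin

abbreviation rpresheaf :: "'u rpsh \<Rightarrow> bool" where
  "rpresheaf \<equiv> restriction_presheaf X"

lemma hom_op: "hom (op_cat X) A B = hom X B A"
  by (auto simp: hom_def op_cat_def)

lemma op_cat_simps [simp]:
  "Obj (op_cat X) = Obj X" "Ide (op_cat X) = Ide X" "g \<cdot>\<^bsub>op_cat X\<^esub> f = f \<cdot> g"
  "Arr (op_cat X) = Arr X" "Dom (op_cat X) = Cod X" "Cod (op_cat X) = Dom X"
  by (simp_all add: op_cat_def)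

lemma category_op: "category (op_cat X)"
proof unfold_locales
  fix f g h A B D E
  assume "f \<in> hom (op_cat X) A B" "g \<in> hom (op_cat X) B D" "h \<in> hom (op_cat X) D E"
  then show "h \<cdot>\<^bsub>op_cat X\<^esub> (g \<cdot>\<^bsub>op_cat X\<^esub> f) = (h \<cdot>\<^bsub>op_cat X\<^esub> g) \<cdot>\<^bsub>op_cat X\<^esub> f"
    using Comp_assoc[of h E D g B f A] by (simp add: hom_op)
qed (use Dom_Obj Cod_Obj Ide_hom Comp_hom Comp_Ide Ide_Comp in \<open>auto simp: hom_op\<close>)

end

lemma Set_hom:
  "f \<in> hom Set_cat S T \<longleftrightarrow>
     small S \<and> small T \<and> SDom f = S \<and> SCod f = T \<and> SFun f \<in> S \<rightarrow>\<^sub>E T"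
  by (auto simp: hom_def Set_cat_def)

lemma Set_simps [simp]:
  "S \<in> Obj Set_cat \<longleftrightarrow> small S"
  "Ide Set_cat S = \<lparr>SDom = S, SCod = S, SFun = (\<lambda>x \<in> S. x)\<rparr>"
  "g \<cdot>\<^bsub>Set_cat\<^esub> f = \<lparr>SDom = SDom f, SCod = SCod g, SFun = compose (SDom f) (SFun g) (SFun f)\<rparr>"
  by (auto simp: Set_cat_def)

lemma category_Set: "category Set_cat"
proof unfold_locales
  fix f g h :: "'u set_map" and A B D E
  assume fgh: "f \<in> hom Set_cat A B" "g \<in> hom Set_cat B D" "h \<in> hom Set_cat D E"
  then show "h \<cdot>\<^bsub>Set_cat\<^esub> (g \<cdot>\<^bsub>Set_cat\<^esub> f) = (h \<cdot>\<^bsub>Set_cat\<^esub> g) \<cdot>\<^bsub>Set_cat\<^esub> f"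
    by (auto simp: Set_hom compose_def restrict_def PiE_iff fun_eq_iff)
next
  fix f :: "'u set_map" and A B
  assume f: "f \<in> hom Set_cat A B"
  show "f \<cdot>\<^bsub>Set_cat\<^esub> Ide Set_cat A = f"
    by (rule set_map.equality)
       (use f in \<open>auto simp: Set_hom compose_def restrict_def PiE_iff extensional_def fun_eq_iff\<close>)
  show "Ide Set_cat B \<cdot>\<^bsub>Set_cat\<^esub> f = f"
    by (rule set_map.equality)
       (use f in \<open>auto simp: Set_hom compose_def restrict_def PiE_iff extensional_def fun_eq_iff\<close>)
qed (auto simp: Set_cat_def hom_def compose_def PiE_iff)

text \<open>
  An action and restrictions given on all of \<open>'u\<close> are cut down to the sets \<open>S A\<close>, so that the result
  is extensional.
\<close>

definition mk_presheaf ::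
  "('u, 'u) rcat \<Rightarrow> ('u \<Rightarrow> 'u set) \<Rightarrow> ('u \<Rightarrow> 'u \<Rightarrow> 'u) \<Rightarrow> ('u \<Rightarrow> 'u \<Rightarrow> 'u) \<Rightarrow> 'u rpsh" where
  "mk_presheaf X S a r =
     \<lparr>Psh = \<lparr>FObj = (\<lambda>A \<in> Obj X. S A),
             FArr = (\<lambda>g \<in> Arr X. \<lparr>SDom = S (Cod X g), SCod = S (Dom X g),
                                  SFun = (\<lambda>x \<in> S (Cod X g). a x g)\<rparr>)\<rparr>,
      PRst = (\<lambda>A \<in> Obj X. \<lambda>x \<in> S A. r A x)\<rparr>"

definition presheaf_map ::
  "('u, 'u) rcat \<Rightarrow> 'u rpsh \<Rightarrow> 'u rpsh \<Rightarrow> ('u \<Rightarrow> 'u \<Rightarrow> 'u) \<Rightarrow> ('u rpsh, 'u, 'u set_map) trans" where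
  "presheaf_map X P Q \<phi> =
     \<lparr>Src = P, Tgt = Q,
      Cmp = (\<lambda>A \<in> Obj X. \<lparr>SDom = elts P A, SCod = elts Q A, SFun = (\<lambda>x \<in> elts P A. \<phi> A x)\<rparr>)\<rparr>"

definition app :: "('u rpsh, 'u, 'u set_map) trans \<Rightarrow> 'u \<Rightarrow> 'u \<Rightarrow> 'u" where
  "app \<alpha> A x = SFun (Cmp \<alpha> A) x"

context small_restriction_category
begin

lemma idempotent_hom: "e \<in> hom X A A \<Longrightarrow> restriction_idempotent X e \<longleftrightarrow> Rst X e = e"
  by (auto simp: restriction_idempotent_def hom_iff)

lemma elts_mk [simp]: "A \<in> Obj X \<Longrightarrow> elts (mk_presheaf X S a r) A = S A"
  and PRst_mk [simp]: "A \<in> Obj X \<Longrightarrow> x \<in> S A \<Longrightarrow> PRst (mk_presheaf X S a r) A x = r A x"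
  by (simp_all add: mk_presheaf_def)

lemma act_mk [simp]: "g \<in> hom X B A \<Longrightarrow> x \<in> S A \<Longrightarrow> act (mk_presheaf X S a r) x g = a x g"
  by (simp add: mk_presheaf_def act_def hom_iff)

lemma mk_presheaf:
  assumes S: "\<And>A. A \<in> Obj X \<Longrightarrow> small (S A)"
    and a: "\<And>g A B x. \<lbrakk>g \<in> hom X B A; x \<in> S A\<rbrakk> \<Longrightarrow> a x g \<in> S B"
    and a_Ide: "\<And>A x. \<lbrakk>A \<in> Obj X; x \<in> S A\<rbrakk> \<Longrightarrow> a x (Ide X A) = x"
    and a_Comp: "\<And>f g A B D x. \<lbrakk>f \<in> hom X D B; g \<in> hom X B A; x \<in> S A\<rbrakk> \<Longrightarrow>
                   a x (g \<cdot> f) = a (a x g) f"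
    and r: "\<And>A x. \<lbrakk>A \<in> Obj X; x \<in> S A\<rbrakk> \<Longrightarrow> r A x \<in> hom X A A"
    and r_idem: "\<And>A x. \<lbrakk>A \<in> Obj X; x \<in> S A\<rbrakk> \<Longrightarrow> Rst X (r A x) = r A x"
    and A1: "\<And>A x. \<lbrakk>A \<in> Obj X; x \<in> S A\<rbrakk> \<Longrightarrow> a x (r A x) = x"
    and A2: "\<And>A x f. \<lbrakk>A \<in> Obj X; x \<in> S A; f \<in> hom X A A; Rst X f = f\<rbrakk> \<Longrightarrow>
               r A (a x f) = r A x \<cdot> f"
    and A3: "\<And>A B x g. \<lbrakk>g \<in> hom X B A; x \<in> S A\<rbrakk> \<Longrightarrow> r A x \<cdot> g = g \<cdot> r B (a x g)"
  shows "rpresheaf (mk_presheaf X S a r)"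
proof -
  let ?P = "mk_presheaf X S a r"
  have "cat_functor (op_cat X) Set_cat (Psh ?P)"
  proof (rule cat_functorI)
    show "FArr (Psh ?P) f \<in> hom Set_cat (elts ?P A) (elts ?P B)" if f: "f \<in> hom (op_cat X) A B" for f A B
    proof -
      have f': "f \<in> hom X B A" using f by (simp add: hom_op)
      then have "FArr (Psh ?P) f = \<lparr>SDom = S A, SCod = S B, SFun = (\<lambda>x \<in> S A. a x f)\<rparr>"
        by (simp add: mk_presheaf_def hom_iff)
      then show ?thesis using a[OF f'] S hom_Obj[OF f'] by (auto simp: Set_hom)
    qed
    show "FArr (Psh ?P) (Ide (op_cat X) A) = Ide Set_cat (elts ?P A)" if "A \<in> Obj (op_cat X)" for A
      using that Ide_hom[of A] a_Ide by (auto simp: mk_presheaf_def hom_iff)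
    show "FArr (Psh ?P) (g \<cdot>\<^bsub>op_cat X\<^esub> f) = FArr (Psh ?P) g \<cdot>\<^bsub>Set_cat\<^esub> FArr (Psh ?P) f"
      if "f \<in> hom (op_cat X) A B" "g \<in> hom (op_cat X) B D" for f g A B D
      using that Comp_hom[of g D B f A] a_Comp[of g D B f A] a[of f B A]
      by (auto simp: hom_op mk_presheaf_def hom_iff compose_def)
  qed (use S category_op category_Set in \<open>auto simp: mk_presheaf_def\<close>)
  then show ?thesis
    unfolding restriction_presheaf_def
  proof (intro conjI ballI allI impI)
    fix A x f
    assume A: "A \<in> Obj X" and x: "x \<in> elts ?P A" and f: "f \<in> hom X A A" "restriction_idempotent X f"
    show "PRst ?P A (act ?P x f) = PRst ?P A x \<cdot> f"
      using A2[OF A _ f(1)] a[OF f(1)] f idempotent_hom A x by simp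
  next
    fix A x B g assume "A \<in> Obj X" and "x \<in> elts ?P A" and "B \<in> Obj X" and "g \<in> hom X B A"
    then show "PRst ?P A x \<cdot> g = g \<cdot> PRst ?P B (act ?P x g)" using A3 a by simp
  next
    fix A assume A: "A \<in> Obj X"
    show "PRst ?P A \<in> elts ?P A \<rightarrow>\<^sub>E hom X A A" using A r by (auto simp: mk_presheaf_def)
    fix x assume x: "x \<in> elts ?P A"
    show "act ?P x (PRst ?P A x) = x" using A x act_mk[OF r[OF A]] A1 by simp
    show "restriction_idempotent X (PRst ?P A x)" using A x r[of A x] r_idem idempotent_hom by simp
  qed (simp_all add: mk_presheaf_def)
qed

lemma presheafD:
  assumes P: "rpresheaf P"
  shows elts_small: "A \<in> Obj X \<Longrightarrow> small (elts P A)"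
    and act_elts: "\<lbrakk>g \<in> hom X B A; x \<in> elts P A\<rbrakk> \<Longrightarrow> act P x g \<in> elts P B"
    and act_Ide: "\<lbrakk>A \<in> Obj X; x \<in> elts P A\<rbrakk> \<Longrightarrow> act P x (Ide X A) = x"
    and act_Comp: "\<lbrakk>f \<in> hom X D B; g \<in> hom X B A; x \<in> elts P A\<rbrakk> \<Longrightarrow>
                     act P x (g \<cdot> f) = act P (act P x g) f"
    and PRst_hom: "\<lbrakk>A \<in> Obj X; x \<in> elts P A\<rbrakk> \<Longrightarrow> PRst P A x \<in> hom X A A"
    and Rst_PRst: "\<lbrakk>A \<in> Obj X; x \<in> elts P A\<rbrakk> \<Longrightarrow> Rst X (PRst P A x) = PRst P A x"
    and act_PRst: "\<lbrakk>A \<in> Obj X; x \<in> elts P A\<rbrakk> \<Longrightarrow> act P x (PRst P A x) = x"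
    and PRst_act: "\<lbrakk>x \<in> elts P A; f \<in> hom X A A; Rst X f = f\<rbrakk> \<Longrightarrow>
                     PRst P A (act P x f) = PRst P A x \<cdot> f"
    and PRst_Comp: "\<lbrakk>g \<in> hom X B A; x \<in> elts P A\<rbrakk> \<Longrightarrow>
                      PRst P A x \<cdot> g = g \<cdot> PRst P B (act P x g)"
    and Psh_map: "g \<in> hom X B A \<Longrightarrow> FArr (Psh P) g =
                     \<lparr>SDom = elts P A, SCod = elts P B, SFun = (\<lambda>x \<in> elts P A. act P x g)\<rparr>"
proof -
  have F: "cat_functor (op_cat X) Set_cat (Psh P)" using P by (simp add: restriction_presheaf_def)
  show "A \<in> Obj X \<Longrightarrow> small (elts P A)" using cat_functorD(5)[OF F] by simp
  have FA: "FArr (Psh P) g \<in> hom Set_cat (elts P A) (elts P B)" if "g \<in> hom X B A" for g A B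
    using cat_functorD(6)[OF F] that by (simp add: hom_op)
  show "\<lbrakk>g \<in> hom X B A; x \<in> elts P A\<rbrakk> \<Longrightarrow> act P x g \<in> elts P B"
    using FA[of g B A] by (auto simp: Set_hom act_def)
  show "\<lbrakk>A \<in> Obj X; x \<in> elts P A\<rbrakk> \<Longrightarrow> act P x (Ide X A) = x"
    using cat_functorD(7)[OF F] by (auto simp: act_def)
  show "act P x (g \<cdot> f) = act P (act P x g) f"
    if f: "f \<in> hom X D B" and g: "g \<in> hom X B A" and x: "x \<in> elts P A"
    using cat_functorD(8)[OF F, of g A B f D] f g x FA[OF f] FA[OF g]
    by (simp add: hom_op act_def Set_hom compose_def)
  show "g \<in> hom X B A \<Longrightarrow> FArr (Psh P) g =
          \<lparr>SDom = elts P A, SCod = elts P B, SFun = (\<lambda>x \<in> elts P A. act P x g)\<rparr>"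
    by (rule set_map.equality)
       (use FA[of g B A] in \<open>auto simp: Set_hom PiE_iff extensional_def restrict_def act_def fun_eq_iff\<close>)
qed (use assms hom_Obj in \<open>auto simp: restriction_presheaf_def PiE_iff restriction_idempotent_def hom_iff\<close>)

lemma PRst_act_le:
  assumes P: "rpresheaf P" and g: "g \<in> hom X B A" and x: "x \<in> elts P A"
  shows "PRst P B (act P x g) \<cdot> Rst X g = PRst P B (act P x g)"
  using PRst_act[OF P act_elts[OF P g x] Rst_hom[OF g] Rst_Rst[OF g]]
    act_Comp[OF P Rst_hom[OF g] g x] R1[OF g] by simp


section \<open>The restriction category of restriction presheaves\<close>

lemma PSh_simps [simp]:
  "P \<in> Obj (PSh X) \<longleftrightarrow> rpresheaf P" "Dom (PSh X) = Src" "Cod (PSh X) = Tgt"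
  by (simp_all add: PSh_def)

lemma PSh_homD:
  assumes "\<alpha> \<in> hom (PSh X) P Q"
  shows "rpresheaf P" and "rpresheaf Q" and "Src \<alpha> = P" and "Tgt \<alpha> = Q"
    and "Cmp \<alpha> \<in> extensional (Obj X)"
    and "A \<in> Obj X \<Longrightarrow> Cmp \<alpha> A =
           \<lparr>SDom = elts P A, SCod = elts Q A, SFun = (\<lambda>x \<in> elts P A. app \<alpha> A x)\<rparr>"
    and app_elts: "\<lbrakk>A \<in> Obj X; x \<in> elts P A\<rbrakk> \<Longrightarrow> app \<alpha> A x \<in> elts Q A"
    and app_act: "\<lbrakk>g \<in> hom X B A; x \<in> elts P A\<rbrakk> \<Longrightarrow> app \<alpha> B (act P x g) = act Q (app \<alpha> A x) g"
proof -
  show P: "rpresheaf P" "rpresheaf Q" "Src \<alpha> = P" "Tgt \<alpha> = Q"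
    using assms by (auto simp: hom_def PSh_def)
  have t: "nat_trans (op_cat X) Set_cat (Psh P) (Psh Q) (Cmp \<alpha>)"
    using assms by (auto simp: hom_def PSh_def)
  show "Cmp \<alpha> \<in> extensional (Obj X)" using nat_transD(3)[OF t] by simp
  have h: "Cmp \<alpha> A \<in> hom Set_cat (elts P A) (elts Q A)" if "A \<in> Obj X" for A
    using nat_transD(4)[OF t] that by simp
  show "A \<in> Obj X \<Longrightarrow> Cmp \<alpha> A =
           \<lparr>SDom = elts P A, SCod = elts Q A, SFun = (\<lambda>x \<in> elts P A. app \<alpha> A x)\<rparr>"
    by (rule set_map.equality)
       (use h[of A] in \<open>auto simp: Set_hom PiE_iff extensional_def restrict_def app_def fun_eq_iff\<close>)
  show "\<lbrakk>A \<in> Obj X; x \<in> elts P A\<rbrakk> \<Longrightarrow> app \<alpha> A x \<in> elts Q A"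
    using h[of A] by (auto simp: Set_hom app_def)
  assume g: "g \<in> hom X B A" and x: "x \<in> elts P A"
  note AB = hom_Obj[OF g]
  have "SFun (Cmp \<alpha> B \<cdot>\<^bsub>Set_cat\<^esub> FArr (Psh P) g) x = SFun (FArr (Psh Q) g \<cdot>\<^bsub>Set_cat\<^esub> Cmp \<alpha> A) x"
    using nat_transD(5)[OF t, of g A B] g by (simp only: hom_op)
  moreover have "SDom (Cmp \<alpha> A) = elts P A" using h[OF AB(2)] by (simp add: Set_hom)
  ultimately show "app \<alpha> B (act P x g) = act Q (app \<alpha> A x) g"
    using x by (simp add: Psh_map[OF P(1) g] compose_def app_def act_def[of Q])
qed

lemma PSh_eqI:
  assumes \<alpha>: "\<alpha> \<in> hom (PSh X) P Q" and \<beta>: "\<beta> \<in> hom (PSh X) P Q"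
    and eq: "\<And>A x. \<lbrakk>A \<in> Obj X; x \<in> elts P A\<rbrakk> \<Longrightarrow> app \<alpha> A x = app \<beta> A x"
  shows "\<alpha> = \<beta>"
proof (rule trans.equality)
  show "Cmp \<alpha> = Cmp \<beta>"
  proof (rule extensionalityI[OF PSh_homD(5)[OF \<alpha>] PSh_homD(5)[OF \<beta>]])
    fix A assume A: "A \<in> Obj X"
    show "Cmp \<alpha> A = Cmp \<beta> A"
      unfolding PSh_homD(6)[OF \<alpha> A] PSh_homD(6)[OF \<beta> A] using eq[OF A] by (simp cong: restrict_cong)
  qed
qed (use PSh_homD(3,4)[OF \<alpha>] PSh_homD(3,4)[OF \<beta>] in auto)

lemma presheaf_map:
  assumes P: "rpresheaf P" and Q: "rpresheaf Q"
    and el: "\<And>A x. \<lbrakk>A \<in> Obj X; x \<in> elts P A\<rbrakk> \<Longrightarrow> \<phi> A x \<in> elts Q A"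
    and nat: "\<And>A B g x. \<lbrakk>g \<in> hom X B A; x \<in> elts P A\<rbrakk> \<Longrightarrow> \<phi> B (act P x g) = act Q (\<phi> A x) g"
  shows "presheaf_map X P Q \<phi> \<in> hom (PSh X) P Q"
proof -
  let ?\<alpha> = "presheaf_map X P Q \<phi>"
  have "nat_trans (op_cat X) Set_cat (Psh P) (Psh Q) (Cmp ?\<alpha>)"
  proof (rule nat_transI)
    fix f A B assume "f \<in> hom (op_cat X) A B"
    then have f: "f \<in> hom X B A" by (simp add: hom_op)
    show "Cmp ?\<alpha> B \<cdot>\<^bsub>Set_cat\<^esub> FArr (Psh P) f = FArr (Psh Q) f \<cdot>\<^bsub>Set_cat\<^esub> Cmp ?\<alpha> A"
      using Psh_map[OF P f] Psh_map[OF Q f] hom_Obj[OF f] nat[OF f] act_elts[OF P f] el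
      by (auto simp: presheaf_map_def compose_def)
  next
    show "cat_functor (op_cat X) Set_cat (Psh P)" "cat_functor (op_cat X) Set_cat (Psh Q)"
      using P Q by (simp_all add: restriction_presheaf_def)
  qed (use el elts_small[OF P] elts_small[OF Q] in \<open>auto simp: presheaf_map_def Set_hom\<close>)
  then show ?thesis using P Q by (simp add: hom_def PSh_def presheaf_map_def)
qed

lemma app_presheaf_map [simp]:
  "\<lbrakk>A \<in> Obj X; x \<in> elts P A\<rbrakk> \<Longrightarrow> app (presheaf_map X P Q \<phi>) A x = \<phi> A x"
  by (simp add: presheaf_map_def app_def)

lemma PSh_Ide: "Ide (PSh X) P = presheaf_map X P P (\<lambda>A x. x)"
  by (simp add: PSh_def presheaf_map_def)

lemma PSh_Comp:
  assumes \<alpha>: "\<alpha> \<in> hom (PSh X) P Q" and \<beta>: "\<beta> \<in> hom (PSh X) Q R"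
  shows "\<beta> \<cdot>\<^bsub>PSh X\<^esub> \<alpha> = presheaf_map X P R (\<lambda>A x. app \<beta> A (app \<alpha> A x))"
  using PSh_homD[OF \<alpha>] PSh_homD[OF \<beta>]
  by (auto simp: PSh_def trans_comp_def presheaf_map_def compose_def restrict_def fun_eq_iff)

lemma PSh_Rst:
  assumes \<alpha>: "\<alpha> \<in> hom (PSh X) P Q"
  shows "Rst (PSh X) \<alpha> = presheaf_map X P P (\<lambda>A x. act P x (PRst Q A (app \<alpha> A x)))"
  using PSh_homD[OF \<alpha>] by (simp add: PSh_def presheaf_map_def app_def)

lemma PSh_Ide_hom: "rpresheaf P \<Longrightarrow> Ide (PSh X) P \<in> hom (PSh X) P P"
  unfolding PSh_Ide by (rule presheaf_map) auto

lemma app_Ide [simp]: "\<lbrakk>A \<in> Obj X; x \<in> elts P A\<rbrakk> \<Longrightarrow> app (Ide (PSh X) P) A x = x"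
  by (simp add: PSh_Ide)

lemma PSh_Comp_hom:
  assumes \<alpha>: "\<alpha> \<in> hom (PSh X) P Q" and \<beta>: "\<beta> \<in> hom (PSh X) Q R"
  shows "\<beta> \<cdot>\<^bsub>PSh X\<^esub> \<alpha> \<in> hom (PSh X) P R"
  unfolding PSh_Comp[OF assms]
  by (rule presheaf_map)
     (use PSh_homD[OF \<alpha>] PSh_homD[OF \<beta>] hom_Obj in auto)

lemma app_Comp:
  assumes "\<alpha> \<in> hom (PSh X) P Q" and "\<beta> \<in> hom (PSh X) Q R" and "A \<in> Obj X" and "x \<in> elts P A"
  shows "app (\<beta> \<cdot>\<^bsub>PSh X\<^esub> \<alpha>) A x = app \<beta> A (app \<alpha> A x)"
  using PSh_Comp[OF assms(1,2)] assms(3,4) by simp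

text \<open>
  Naturality of the restriction of \<open>\<alpha>\<close> is (A3) for the elements \<open>\<alpha> x\<close>.
\<close>

lemma PSh_Rst_hom:
  assumes \<alpha>: "\<alpha> \<in> hom (PSh X) P Q"
  shows "Rst (PSh X) \<alpha> \<in> hom (PSh X) P P"
  unfolding PSh_Rst[OF \<alpha>]
proof (rule presheaf_map)
  note P = PSh_homD(1)[OF \<alpha>] and Q = PSh_homD(2)[OF \<alpha>]
  show "rpresheaf P" "rpresheaf P" by fact+
  show el: "act P x (PRst Q A (app \<alpha> A x)) \<in> elts P A" if "A \<in> Obj X" "x \<in> elts P A" for A x
    using act_elts[OF P PRst_hom[OF Q]] app_elts[OF \<alpha>] that by blast
  fix A B g x assume g: "g \<in> hom X B A" and x: "x \<in> elts P A"
  note BA = hom_Obj[OF g]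
  note \<alpha>x = app_elts[OF \<alpha> BA(2) x]
  note gx = act_elts[OF P g x]
  note \<alpha>gx = app_elts[OF \<alpha> BA(1) gx]
  have "act P (act P x g) (PRst Q B (app \<alpha> B (act P x g))) = act P x (g \<cdot> PRst Q B (act Q (app \<alpha> A x) g))"
    using act_Comp[OF P PRst_hom[OF Q BA(1) \<alpha>gx] g x] app_act[OF \<alpha> g x] by simp
  also have "\<dots> = act P x (PRst Q A (app \<alpha> A x) \<cdot> g)" using PRst_Comp[OF Q g \<alpha>x] by simp
  also have "\<dots> = act P (act P x (PRst Q A (app \<alpha> A x))) g"
    using act_Comp[OF P g PRst_hom[OF Q BA(2) \<alpha>x] x] by simp
  finally show "act P (act P x g) (PRst Q B (app \<alpha> B (act P x g)))
      = act P (act P x (PRst Q A (app \<alpha> A x))) g" .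
qed

lemma app_Rst:
  assumes "\<alpha> \<in> hom (PSh X) P Q" and "A \<in> Obj X" and "x \<in> elts P A"
  shows "app (Rst (PSh X) \<alpha>) A x = act P x (PRst Q A (app \<alpha> A x))"
  using PSh_Rst[OF assms(1)] assms(2,3) by simp

lemma PRst_comm:
  assumes "rpresheaf P" and "rpresheaf Q" and "A \<in> Obj X" and "x \<in> elts P A" and "y \<in> elts Q A"
  shows "PRst P A x \<cdot> PRst Q A y = PRst Q A y \<cdot> PRst P A x"
  using R2[OF PRst_hom[OF assms(1,3,4)] PRst_hom[OF assms(2,3,5)]] Rst_PRst assms by simp

text \<open>
  A map of presheaves can only shrink the domain of an element: since \<open>x\<close> is its own restriction to
  its domain, so is \<open>\<alpha> x\<close> by naturality, and (A2) applies.
\<close>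

lemma PRst_app_le:
  assumes \<alpha>: "\<alpha> \<in> hom (PSh X) P Q" and A: "A \<in> Obj X" and x: "x \<in> elts P A"
  shows "PRst Q A (app \<alpha> A x) \<cdot> PRst P A x = PRst Q A (app \<alpha> A x)"
proof -
  note P = PSh_homD(1)[OF \<alpha>] and Q = PSh_homD(2)[OF \<alpha>]
  have "act Q (app \<alpha> A x) (PRst P A x) = app \<alpha> A x"
    using app_act[OF \<alpha> PRst_hom[OF P A x] x] act_PRst[OF P A x] by simp
  then show ?thesis
    using PRst_act[OF Q app_elts[OF \<alpha> A x] PRst_hom[OF P A x] Rst_PRst[OF P A x]] by simp
qed

text \<open>
  The map \<open>\<beta>\<close> is natural, so the restriction of \<open>x\<close> along \<open>\<alpha>\<close> is sent by \<open>\<beta>\<close> to the restriction of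
  \<open>\<beta> x\<close>, whose domain (A2) computes.
\<close>

lemma act_PRst_twice:
  assumes \<alpha>: "\<alpha> \<in> hom (PSh X) P Q" and \<beta>: "\<beta> \<in> hom (PSh X) P R" and A: "A \<in> Obj X" and x: "x \<in> elts P A"
  defines "a \<equiv> PRst Q A (app \<alpha> A x)" and "b \<equiv> PRst R A (app \<beta> A x)"
  shows "act P (act P x a) (PRst R A (app \<beta> A (act P x a))) = act P x (b \<cdot> a)"
proof -
  note P = PSh_homD(1)[OF \<alpha>] and Q = PSh_homD(2)[OF \<alpha>] and R = PSh_homD(2)[OF \<beta>]
  have a: "a \<in> hom X A A" "Rst X a = a" and b: "b \<in> hom X A A" "Rst X b = b"
    unfolding a_def b_def
    using PRst_hom Rst_PRst Q R app_elts[OF \<alpha> A x] app_elts[OF \<beta> A x] A by auto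
  have ab: "a \<cdot> b = b \<cdot> a"
    unfolding a_def b_def using PRst_comm[OF Q R A] app_elts[OF \<alpha> A x] app_elts[OF \<beta> A x] by simp
  have "PRst R A (app \<beta> A (act P x a)) = b \<cdot> a"
    using app_act[OF \<beta> a(1) x] PRst_act[OF R app_elts[OF \<beta> A x] a] by (simp add: b_def)
  moreover have "a \<cdot> (b \<cdot> a) = b \<cdot> a"
    using Comp_assoc[OF a(1) b(1) a(1)] Comp_assoc[OF a(1) a(1) b(1)] ab Rst_idem[OF a(1)] a(2) by simp
  ultimately show ?thesis
    using act_Comp[OF P Comp_hom[OF a(1) b(1)] a(1) x] by simp
qed

lemma category_PSh: "category (PSh X)"
proof unfold_locales
  fix f g h A B D E
  assume f: "f \<in> hom (PSh X) A B" and g: "g \<in> hom (PSh X) B D" and h: "h \<in> hom (PSh X) D E"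
  show "h \<cdot>\<^bsub>PSh X\<^esub> (g \<cdot>\<^bsub>PSh X\<^esub> f) = (h \<cdot>\<^bsub>PSh X\<^esub> g) \<cdot>\<^bsub>PSh X\<^esub> f"
    by (rule PSh_eqI[OF PSh_Comp_hom[OF PSh_Comp_hom[OF f g] h] PSh_Comp_hom[OF f PSh_Comp_hom[OF g h]]])
       (use app_Comp[OF PSh_Comp_hom[OF f g] h] app_Comp[OF f PSh_Comp_hom[OF g h]] app_Comp[OF f g]
          app_Comp[OF g h] app_elts[OF f] in simp)
next
  fix f A B assume f: "f \<in> hom (PSh X) A B"
  note AB = PSh_homD(1,2)[OF f]
  show "f \<cdot>\<^bsub>PSh X\<^esub> Ide (PSh X) A = f"
    by (rule PSh_eqI[OF PSh_Comp_hom[OF PSh_Ide_hom f] f])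
       (use AB app_Comp[OF PSh_Ide_hom f] in auto)
  show "Ide (PSh X) B \<cdot>\<^bsub>PSh X\<^esub> f = f"
    by (rule PSh_eqI[OF PSh_Comp_hom[OF f PSh_Ide_hom] f])
       (use AB app_Comp[OF f PSh_Ide_hom] app_elts[OF f] in auto)
qed (use PSh_Ide_hom PSh_Comp_hom in \<open>auto simp: PSh_def\<close>)

lemma restriction_category_PSh: "restriction_category (PSh X)"
proof -
  interpret PSh: category "PSh X" by (rule category_PSh)
  show ?thesis
  proof unfold_locales
    show "Rst (PSh X) f \<in> hom (PSh X) A A" if "f \<in> hom (PSh X) A B" for f A B
      using PSh_Rst_hom that .
  next
    fix \<alpha> P Q assume \<alpha>: "\<alpha> \<in> hom (PSh X) P Q"
    show "\<alpha> \<cdot>\<^bsub>PSh X\<^esub> Rst (PSh X) \<alpha> = \<alpha>"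
      by (rule PSh_eqI[OF PSh_Comp_hom[OF PSh_Rst_hom[OF \<alpha>] \<alpha>] \<alpha>])
         (use app_Comp[OF PSh_Rst_hom[OF \<alpha>] \<alpha>] app_Rst[OF \<alpha>] app_elts[OF \<alpha>] PSh_homD(2)[OF \<alpha>]
            app_act[OF \<alpha> PRst_hom] act_PRst in simp)
  next
    fix \<alpha> \<beta> P Q R assume \<alpha>: "\<alpha> \<in> hom (PSh X) P Q" and \<beta>: "\<beta> \<in> hom (PSh X) P R"
    note Q = PSh_homD(2)[OF \<alpha>] and R = PSh_homD(2)[OF \<beta>]
    note \<alpha>' = PSh_Rst_hom[OF \<alpha>] and \<beta>' = PSh_Rst_hom[OF \<beta>]
    let ?a = "\<lambda>A x. PRst Q A (app \<alpha> A x)" and ?b = "\<lambda>A x. PRst R A (app \<beta> A x)"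
    have ab: "?a A x \<in> hom X A A" "?b A x \<in> hom X A A" "Rst X (?a A x) = ?a A x"
      "Rst X (?b A x) = ?b A x" "?a A x \<cdot> ?b A x = ?b A x \<cdot> ?a A x"
      if "A \<in> Obj X" "x \<in> elts P A" for A x
      using that PRst_hom Rst_PRst Q R app_elts[OF \<alpha>] app_elts[OF \<beta>] PRst_comm by auto
    have *: "act P (act P x (?a A x)) (PRst R A (app \<beta> A (act P x (?a A x)))) = act P x (?b A x \<cdot> ?a A x)"
      and **: "act P (act P x (?b A x)) (PRst Q A (app \<alpha> A (act P x (?b A x)))) = act P x (?b A x \<cdot> ?a A x)"
      if "A \<in> Obj X" "x \<in> elts P A" for A x
      using act_PRst_twice[OF \<alpha> \<beta> that] act_PRst_twice[OF \<beta> \<alpha> that] ab(5)[OF that] by simp_all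
    have el: "act P x (?a A x) \<in> elts P A" "act P x (?b A x) \<in> elts P A"
      if "A \<in> Obj X" "x \<in> elts P A" for A x
      using act_elts[OF PSh_homD(1)[OF \<alpha>]] ab that by blast+
    show "Rst (PSh X) \<beta> \<cdot>\<^bsub>PSh X\<^esub> Rst (PSh X) \<alpha> = Rst (PSh X) \<alpha> \<cdot>\<^bsub>PSh X\<^esub> Rst (PSh X) \<beta>"
    proof (rule PSh_eqI[OF PSh_Comp_hom[OF \<alpha>' \<beta>'] PSh_Comp_hom[OF \<beta>' \<alpha>']])
      fix A x assume A: "A \<in> Obj X" and x: "x \<in> elts P A"
      show "app (Rst (PSh X) \<beta> \<cdot>\<^bsub>PSh X\<^esub> Rst (PSh X) \<alpha>) A x = app (Rst (PSh X) \<alpha> \<cdot>\<^bsub>PSh X\<^esub> Rst (PSh X) \<beta>) A x"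
        unfolding app_Comp[OF \<alpha>' \<beta>' A x] app_Comp[OF \<beta>' \<alpha>' A x]
        using app_Rst[OF \<alpha> A] app_Rst[OF \<beta> A] x el[OF A x] *[OF A x] **[OF A x] by simp
    qed
    note \<beta>\<alpha>' = PSh_Comp_hom[OF \<alpha>' \<beta>]
    show "Rst (PSh X) (\<beta> \<cdot>\<^bsub>PSh X\<^esub> Rst (PSh X) \<alpha>) = Rst (PSh X) \<beta> \<cdot>\<^bsub>PSh X\<^esub> Rst (PSh X) \<alpha>"
    proof (rule PSh_eqI[OF PSh_Rst_hom[OF \<beta>\<alpha>'] PSh_Comp_hom[OF \<alpha>' \<beta>']])
      fix A x assume A: "A \<in> Obj X" and x: "x \<in> elts P A"
      note h = ab[OF A x]
      have "PRst R A (app \<beta> A (act P x (?a A x))) = ?b A x \<cdot> ?a A x"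
        using app_act[OF \<beta> h(1) x] PRst_act[OF R app_elts[OF \<beta> A x] h(1) h(3)] by simp
      then show "app (Rst (PSh X) (\<beta> \<cdot>\<^bsub>PSh X\<^esub> Rst (PSh X) \<alpha>)) A x = app (Rst (PSh X) \<beta> \<cdot>\<^bsub>PSh X\<^esub> Rst (PSh X) \<alpha>) A x"
        using app_Rst[OF \<beta>\<alpha>' A x] app_Comp[OF \<alpha>' \<beta> A x] app_Comp[OF \<alpha>' \<beta>' A x] app_Rst[OF \<alpha> A x]
          app_Rst[OF \<beta> A el(1)[OF A x]] *[OF A x] by simp
    qed
  next
    fix \<alpha> \<beta> P Q R assume \<alpha>: "\<alpha> \<in> hom (PSh X) P Q" and \<beta>: "\<beta> \<in> hom (PSh X) Q R"
    note Q = PSh_homD(2)[OF \<alpha>] and R = PSh_homD(2)[OF \<beta>]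
    note \<beta>\<alpha> = PSh_Comp_hom[OF \<alpha> \<beta>]
    note \<beta>\<alpha>' = PSh_Rst_hom[OF \<beta>\<alpha>] and \<beta>' = PSh_Rst_hom[OF \<beta>]
    show "Rst (PSh X) \<beta> \<cdot>\<^bsub>PSh X\<^esub> \<alpha> = \<alpha> \<cdot>\<^bsub>PSh X\<^esub> Rst (PSh X) (\<beta> \<cdot>\<^bsub>PSh X\<^esub> \<alpha>)"
    proof (rule PSh_eqI[OF PSh_Comp_hom[OF \<alpha> \<beta>'] PSh_Comp_hom[OF \<beta>\<alpha>' \<alpha>]])
      fix A x assume A: "A \<in> Obj X" and x: "x \<in> elts P A"
      note \<alpha>x = app_elts[OF \<alpha> A x]
      note r = PRst_hom[OF R A app_elts[OF \<beta> A \<alpha>x]]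
      show "app (Rst (PSh X) \<beta> \<cdot>\<^bsub>PSh X\<^esub> \<alpha>) A x = app (\<alpha> \<cdot>\<^bsub>PSh X\<^esub> Rst (PSh X) (\<beta> \<cdot>\<^bsub>PSh X\<^esub> \<alpha>)) A x"
        using app_Comp[OF \<alpha> \<beta>' A x] app_Comp[OF \<beta>\<alpha>' \<alpha> A x] app_Rst[OF \<beta> A \<alpha>x] app_Rst[OF \<beta>\<alpha> A x]
          app_Comp[OF \<alpha> \<beta> A x] app_act[OF \<alpha> r x] by simp
    qed
  qed
qed

sublocale PSh: restriction_category "PSh X"
  by (rule restriction_category_PSh)

text \<open>
  Let \<open>e\<close> be the domain of \<open>\<alpha> x\<close>.  As \<open>e\<close> lies below the domain of \<open>x\<close>, the domain of \<open>x \<cdot> e\<close> is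
  \<open>e\<close>; hence \<open>x \<cdot> e = x\<close>, the condition for totality, holds just when \<open>x\<close> has domain \<open>e\<close>.
\<close>

lemma total_PSh_iff:
  assumes \<alpha>: "\<alpha> \<in> hom (PSh X) P Q"
  shows "total_map (PSh X) \<alpha> \<longleftrightarrow>
           (\<forall>A \<in> Obj X. \<forall>x \<in> elts P A. PRst Q A (app \<alpha> A x) = PRst P A x)" (is "_ \<longleftrightarrow> ?R")
proof -
  note P = PSh_homD(1)[OF \<alpha>] and Q = PSh_homD(2)[OF \<alpha>]
  have "total_map (PSh X) \<alpha> \<longleftrightarrow> (\<forall>A \<in> Obj X. \<forall>x \<in> elts P A. act P x (PRst Q A (app \<alpha> A x)) = x)"
  proof
    assume "total_map (PSh X) \<alpha>"
    then have "Rst (PSh X) \<alpha> = Ide (PSh X) P" using PSh.total_map_iff[OF \<alpha>] by simp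
    then show "\<forall>A \<in> Obj X. \<forall>x \<in> elts P A. act P x (PRst Q A (app \<alpha> A x)) = x"
      using app_Rst[OF \<alpha>] by simp
  next
    assume "\<forall>A \<in> Obj X. \<forall>x \<in> elts P A. act P x (PRst Q A (app \<alpha> A x)) = x"
    then have "Rst (PSh X) \<alpha> = Ide (PSh X) P"
      by (intro PSh_eqI[OF PSh_Rst_hom[OF \<alpha>] PSh_Ide_hom[OF P]]) (simp add: app_Rst[OF \<alpha>])
    then show "total_map (PSh X) \<alpha>" using PSh.total_map_iff[OF \<alpha>] by simp
  qed
  also have "\<dots> \<longleftrightarrow> ?R"
  proof (intro ball_cong refl)
    fix A x assume A: "A \<in> Obj X" and x: "x \<in> elts P A"
    note \<alpha>x = app_elts[OF \<alpha> A x]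
    have "PRst P A (act P x (PRst Q A (app \<alpha> A x))) = PRst Q A (app \<alpha> A x)"
      using PRst_act[OF P x PRst_hom[OF Q A \<alpha>x] Rst_PRst[OF Q A \<alpha>x]] PRst_app_le[OF \<alpha> A x]
        PRst_comm[OF P Q A x \<alpha>x] by simp
    then show "act P x (PRst Q A (app \<alpha> A x)) = x \<longleftrightarrow> PRst Q A (app \<alpha> A x) = PRst P A x"
      using act_PRst[OF P A x] by metis
  qed
  finally show ?thesis .
qed

text \<open>A restriction idempotent \<open>\<epsilon>\<close> on \<open>P\<close> splits through the presheaf of its fixed elements.\<close>

lemma split_PSh: "split_rcat (PSh X)"
  unfolding split_rcat_def
proof (intro allI impI)
  fix \<epsilon> assume idem: "restriction_idempotent (PSh X) \<epsilon>"
  define P where "P = Src \<epsilon>"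
  have \<epsilon>: "\<epsilon> \<in> hom (PSh X) P P" and R\<epsilon>: "Rst (PSh X) \<epsilon> = \<epsilon>"
    using idem PSh_Rst_hom[of \<epsilon> P "Tgt \<epsilon>"]
    by (auto simp: restriction_idempotent_def P_def hom_iff)
  have P: "rpresheaf P" using PSh_homD(1)[OF \<epsilon>] .
  have \<epsilon>\<epsilon>: "app \<epsilon> A (app \<epsilon> A x) = app \<epsilon> A x" if "A \<in> Obj X" "x \<in> elts P A" for A x
    using PSh.Rst_idem[OF \<epsilon>] R\<epsilon> app_Comp[OF \<epsilon> \<epsilon>] that by metis
  define Q where "Q = mk_presheaf X (\<lambda>A. {x \<in> elts P A. app \<epsilon> A x = x}) (act P) (PRst P)"
  have Q: "rpresheaf Q"
    unfolding Q_def
    by (rule mk_presheaf)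
       (use small_subset[OF elts_small[OF P]] presheafD[OF P] app_act[OF \<epsilon>] hom_Obj in auto)
  have Q_elts: "x \<in> elts Q A \<longleftrightarrow> x \<in> elts P A \<and> app \<epsilon> A x = x" if "A \<in> Obj X" for A x
    using that by (simp add: Q_def)
  have Q_act: "act Q x g = act P x g" if "g \<in> hom X B A" "x \<in> elts Q A" for x g A B
    using that hom_Obj[of g B A] by (simp add: Q_def)
  define m where "m = presheaf_map X Q P (\<lambda>A x. x)"
  define r where "r = presheaf_map X P Q (app \<epsilon>)"
  have m: "m \<in> hom (PSh X) Q P"
    unfolding m_def by (rule presheaf_map) (use Q P Q_elts Q_act in auto)
  have r: "r \<in> hom (PSh X) P Q"
    unfolding r_def by (rule presheaf_map) (use Q P Q_elts Q_act \<epsilon>\<epsilon> app_elts[OF \<epsilon>] app_act[OF \<epsilon>] hom_Obj in auto)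
  have "\<epsilon> = m \<cdot>\<^bsub>PSh X\<^esub> r"
    by (rule PSh_eqI[OF \<epsilon> PSh_Comp_hom[OF r m]])
       (use app_Comp[OF r m] app_elts[OF r] in \<open>simp add: m_def r_def\<close>)
  moreover have "r \<cdot>\<^bsub>PSh X\<^esub> m = Ide (PSh X) Q"
    by (rule PSh_eqI[OF PSh_Comp_hom[OF m r] PSh_Ide_hom[OF Q]])
       (use app_Comp[OF m r] Q_elts in \<open>simp add: m_def r_def\<close>)
  ultimately have "\<exists>B \<in> Obj (PSh X). \<exists>m \<in> hom (PSh X) B P. \<exists>r \<in> hom (PSh X) P B.
      \<epsilon> = m \<cdot>\<^bsub>PSh X\<^esub> r \<and> r \<cdot>\<^bsub>PSh X\<^esub> m = Ide (PSh X) B"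
    using PSh.hom_Obj(1)[OF m] m r by blast
  then show "\<exists>B \<in> Obj (PSh X). \<exists>m \<in> hom (PSh X) B (Dom (PSh X) \<epsilon>).
      \<exists>r \<in> hom (PSh X) (Dom (PSh X) \<epsilon>) B. \<epsilon> = m \<cdot>\<^bsub>PSh X\<^esub> r \<and> r \<cdot>\<^bsub>PSh X\<^esub> m = Ide (PSh X) B"
    by (simp only: P_def PSh_simps(2))
qed

end

section \<open>The Yoneda embedding\<close>

context small_restriction_category
begin

abbreviation yo :: "'u \<Rightarrow> 'u rpsh" where
  "yo \<equiv> representable X"

text \<open>The map \<open>y A \<rightarrow> P\<close> that corresponds to the element \<open>x\<close> of \<open>P A\<close> under the Yoneda lemma.\<close>

definition point :: "'u rpsh \<Rightarrow> 'u \<Rightarrow> 'u \<Rightarrow> ('u rpsh, 'u, 'u set_map) trans" where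
  "point P A x = presheaf_map X (yo A) P (\<lambda>B f. act P x f)"

lemma representable_eq:
  "yo A = mk_presheaf X (\<lambda>B. hom X B A) (\<lambda>h g. h \<cdot> g) (\<lambda>B. Rst X)"
  by (simp add: representable_def mk_presheaf_def)

lemma elts_yo [simp]: "B \<in> Obj X \<Longrightarrow> elts (yo A) B = hom X B A"
  and PRst_yo: "h \<in> hom X B A \<Longrightarrow> PRst (yo A) B h = Rst X h"
  and act_yo: "\<lbrakk>h \<in> hom X B A; g \<in> hom X D B\<rbrakk> \<Longrightarrow> act (yo A) h g = h \<cdot> g"
  using hom_Obj[of h B A] unfolding representable_eq by auto

lemma rpresheaf_yo: "rpresheaf (yo A)"
  unfolding representable_eq
proof (rule mk_presheaf)
  show "small (hom X B A)" for B
    by (rule small_subset[of "Arr X"]) (use small_category in \<open>auto simp: small_category_def hom_def\<close>)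
  show "Rst X (x \<cdot> f) = Rst X x \<cdot> f" if "x \<in> hom X B A" "f \<in> hom X B B" "Rst X f = f" for B x f
    using R3[OF that(2,1)] that(3) by simp
qed (use Comp_hom Comp_Ide Comp_assoc Rst_hom Rst_Rst R1 R4 in auto)

lemma point_hom:
  assumes P: "rpresheaf P" and A: "A \<in> Obj X" and x: "x \<in> elts P A"
  shows "point P A x \<in> hom (PSh X) (yo A) P"
  unfolding point_def
  by (rule presheaf_map[OF rpresheaf_yo P])
     (use act_elts[OF P _ x] act_yo act_Comp[OF P _ _ x] hom_Obj in auto)

lemma app_point: "f \<in> hom X B A \<Longrightarrow> app (point P A x) B f = act P x f"
  using hom_Obj[of f B A] by (simp add: point_def)

lemma app_point_Ide: "\<lbrakk>rpresheaf P; A \<in> Obj X; x \<in> elts P A\<rbrakk> \<Longrightarrow> app (point P A x) A (Ide X A) = x"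
  using app_point[OF Ide_hom] act_Ide by simp

lemma Comp_point:
  assumes \<alpha>: "\<alpha> \<in> hom (PSh X) P Q" and A: "A \<in> Obj X" and x: "x \<in> elts P A"
  shows "\<alpha> \<cdot>\<^bsub>PSh X\<^esub> point P A x = point Q A (app \<alpha> A x)"
proof -
  note P = PSh_homD(1)[OF \<alpha>] and Q = PSh_homD(2)[OF \<alpha>]
  note p = point_hom[OF P A x]
  show ?thesis
    by (rule PSh_eqI[OF PSh_Comp_hom[OF p \<alpha>] point_hom[OF Q A app_elts[OF \<alpha> A x]]])
       (use app_Comp[OF p \<alpha>] app_point app_act[OF \<alpha> _ x] in auto)
qed

lemma FObj_yoneda [simp]: "A \<in> Obj X \<Longrightarrow> FObj (yoneda X) A = yo A"
  by (simp add: yoneda_def)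

lemma yoneda_eq_point:
  assumes f: "f \<in> hom X A B"
  shows "FArr (yoneda X) f = point (yo B) A f"
  using f hom_Obj[OF f] act_yo[OF f]
  by (auto simp: yoneda_def point_def presheaf_map_def hom_iff fun_eq_iff restrict_def)

lemma yoneda_hom:
  assumes f: "f \<in> hom X A B"
  shows "FArr (yoneda X) f \<in> hom (PSh X) (yo A) (yo B)"
  unfolding yoneda_eq_point[OF f]
  using point_hom[OF rpresheaf_yo] f hom_Obj[OF f] by simp

lemma point_yoneda:
  assumes P: "rpresheaf P" and f: "f \<in> hom X B A" and x: "x \<in> elts P A"
  shows "point P A x \<cdot>\<^bsub>PSh X\<^esub> FArr (yoneda X) f = point P B (act P x f)"
  unfolding yoneda_eq_point[OF f]
  using Comp_point[OF point_hom[OF P _ x], of B f] hom_Obj[OF f] f app_point[OF f] by simp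

lemma yoneda_Ide: "A \<in> Obj X \<Longrightarrow> FArr (yoneda X) (Ide X A) = Ide (PSh X) (yo A)"
  by (rule PSh_eqI[OF yoneda_hom[OF Ide_hom] PSh_Ide_hom[OF rpresheaf_yo]])
     (auto simp: yoneda_eq_point[OF Ide_hom] app_point act_yo[OF Ide_hom] Ide_Comp)

lemma point_Ide: "A \<in> Obj X \<Longrightarrow> point (yo A) A (Ide X A) = Ide (PSh X) (yo A)"
  using yoneda_Ide yoneda_eq_point[OF Ide_hom] by simp

text \<open>
  The identity of \<open>y A\<close> is the point at the identity of \<open>A\<close>, so that \<open>\<alpha>\<close>, as the composite of \<open>\<alpha>\<close>
  and this point, is the point at the image of the identity.
\<close>

lemma eq_point:
  assumes \<alpha>: "\<alpha> \<in> hom (PSh X) (yo A) P" and A: "A \<in> Obj X"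
  shows "\<alpha> = point P A (app \<alpha> A (Ide X A))"
  using Comp_point[OF \<alpha> A, of "Ide X A"] point_Ide[OF A] PSh.Comp_Ide[OF \<alpha>] A Ide_hom by simp

text \<open>
  Evaluated at \<open>f\<close>, the two sides are the two sides of (A3) for \<open>x\<close> and \<open>f\<close>.
\<close>

lemma Rst_point:
  assumes P: "rpresheaf P" and A: "A \<in> Obj X" and x: "x \<in> elts P A"
  shows "Rst (PSh X) (point P A x) = FArr (yoneda X) (PRst P A x)"
proof (rule PSh_eqI[OF PSh_Rst_hom[OF point_hom[OF P A x]] yoneda_hom[OF PRst_hom[OF P A x]]])
  fix B f assume B: "B \<in> Obj X" and "f \<in> elts (yo A) B"
  then have f: "f \<in> hom X B A" by simp
  have "app (Rst (PSh X) (point P A x)) B f = f \<cdot> PRst P B (act P x f)"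
    using app_Rst[OF point_hom[OF P A x] B] f B app_point[OF f]
      act_yo[OF f PRst_hom[OF P B act_elts[OF P f x]]] by simp
  also have "\<dots> = app (FArr (yoneda X) (PRst P A x)) B f"
    using yoneda_eq_point[OF PRst_hom[OF P A x]] app_point[OF f] act_yo[OF PRst_hom[OF P A x] f]
      PRst_Comp[OF P f x] by simp
  finally show "app (Rst (PSh X) (point P A x)) B f = app (FArr (yoneda X) (PRst P A x)) B f" .
qed

lemma restriction_functor_yoneda: "restriction_functor X (PSh X) (yoneda X)"
  unfolding restriction_functor_def
proof (intro conjI ballI)
  show "cat_functor X (PSh X) (yoneda X)"
  proof (rule cat_functorI)
    show "FArr (yoneda X) (g \<cdot> f) = FArr (yoneda X) g \<cdot>\<^bsub>PSh X\<^esub> FArr (yoneda X) f"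
      if f: "f \<in> hom X A B" and g: "g \<in> hom X B D" for f g A B D
      using point_yoneda[OF rpresheaf_yo f, of g D] g hom_Obj[OF g] act_yo[OF g f]
        yoneda_eq_point[OF g] yoneda_eq_point[OF Comp_hom[OF f g]] by simp
  qed (use yoneda_hom hom_Obj rpresheaf_yo yoneda_Ide category_axioms category_PSh in \<open>auto simp: yoneda_def[of X]\<close>)
  fix f assume "f \<in> Arr X"
  then have f: "f \<in> hom X (Dom X f) (Cod X f)" by (simp add: hom_iff)
  show "FArr (yoneda X) (Rst X f) = Rst (PSh X) (FArr (yoneda X) f)"
    using Rst_point[OF rpresheaf_yo hom_Obj(1)[OF f], of f] f PRst_yo[OF f] yoneda_eq_point[OF f]
      hom_Obj[OF f] by simp
qed (rule restriction_category_axioms restriction_category_PSh)+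


section \<open>Weighted colimits\<close>

text \<open>
  A weighted cocone is a natural transformation from \<open>P\<close> to the presheaf \<open>E(F -, e)\<close>; its components
  are arbitrary maps of \<open>E\<close>.  A weighted colimit is a universal one, whose leg at \<open>x\<close> is moreover
  defined exactly where \<open>x\<close> is.
\<close>

definition weighted_cocone ::
  "('u, 'u, 'eo, 'em) func \<Rightarrow> ('eo, 'em) rcat \<Rightarrow> 'u rpsh \<Rightarrow> 'eo \<Rightarrow> ('u \<Rightarrow> 'u \<Rightarrow> 'em) \<Rightarrow> bool" where
  "weighted_cocone F E P e u \<longleftrightarrow> e \<in> Obj E \<and>
     (\<forall>A \<in> Obj X. \<forall>x \<in> elts P A. u A x \<in> hom E (FObj F A) e) \<and>
     (\<forall>A B. \<forall>f \<in> hom X A B. \<forall>y \<in> elts P B. u B y \<cdot>\<^bsub>E\<^esub> FArr F f = u A (act P y f))"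

definition weighted_colimit ::
  "('u, 'u, 'eo, 'em) func \<Rightarrow> ('eo, 'em) rcat \<Rightarrow> 'u rpsh \<Rightarrow> 'eo \<Rightarrow> ('u \<Rightarrow> 'u \<Rightarrow> 'em) \<Rightarrow> bool" where
  "weighted_colimit F E P c t \<longleftrightarrow> weighted_cocone F E P c t \<and>
     (\<forall>A \<in> Obj X. \<forall>x \<in> elts P A. Rst E (t A x) = FArr F (PRst P A x)) \<and>
     (\<forall>e u. weighted_cocone F E P e u \<longrightarrow>
        (\<exists>!h. h \<in> hom E c e \<and> (\<forall>A \<in> Obj X. \<forall>x \<in> elts P A. h \<cdot>\<^bsub>E\<^esub> t A x = u A x)))"

lemma weighted_coconeI:
  assumes "e \<in> Obj E" and "\<And>A x. \<lbrakk>A \<in> Obj X; x \<in> elts P A\<rbrakk> \<Longrightarrow> u A x \<in> hom E (FObj F A) e"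
    and "\<And>f A B y. \<lbrakk>f \<in> hom X A B; y \<in> elts P B\<rbrakk> \<Longrightarrow> u B y \<cdot>\<^bsub>E\<^esub> FArr F f = u A (act P y f)"
  shows "weighted_cocone F E P e u"
  using assms by (simp add: weighted_cocone_def)

lemma weighted_coconeD:
  assumes "weighted_cocone F E P e u"
  shows "e \<in> Obj E" and "\<lbrakk>A \<in> Obj X; x \<in> elts P A\<rbrakk> \<Longrightarrow> u A x \<in> hom E (FObj F A) e"
    and "\<lbrakk>f \<in> hom X A B; y \<in> elts P B\<rbrakk> \<Longrightarrow> u B y \<cdot>\<^bsub>E\<^esub> FArr F f = u A (act P y f)"
  using assms by (auto simp: weighted_cocone_def)

text \<open>
  Naturality and (A1) force each component to be restricted to the domain of \<open>x\<close>.
\<close>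

lemma weighted_cocone_PRst:
  assumes "weighted_cocone F E P e u" and P: "rpresheaf P" and A: "A \<in> Obj X" and x: "x \<in> elts P A"
  shows "u A x \<cdot>\<^bsub>E\<^esub> FArr F (PRst P A x) = u A x"
  using weighted_coconeD(3)[OF assms(1) PRst_hom[OF P A x] x] act_PRst[OF P A x] by simp

lemma weighted_colimitI:
  assumes "weighted_cocone F E P c t"
    and "\<And>A x. \<lbrakk>A \<in> Obj X; x \<in> elts P A\<rbrakk> \<Longrightarrow> Rst E (t A x) = FArr F (PRst P A x)"
    and "\<And>e u. weighted_cocone F E P e u \<Longrightarrow>
           \<exists>h \<in> hom E c e. \<forall>A \<in> Obj X. \<forall>x \<in> elts P A. h \<cdot>\<^bsub>E\<^esub> t A x = u A x"
    and "\<And>e h k. \<lbrakk>h \<in> hom E c e; k \<in> hom E c e;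
            \<And>A x. \<lbrakk>A \<in> Obj X; x \<in> elts P A\<rbrakk> \<Longrightarrow> h \<cdot>\<^bsub>E\<^esub> t A x = k \<cdot>\<^bsub>E\<^esub> t A x\<rbrakk> \<Longrightarrow> h = k"
  shows "weighted_colimit F E P c t"
  unfolding weighted_colimit_def
proof (intro conjI allI impI ballI)
  fix e u assume "weighted_cocone F E P e u"
  then obtain h where h: "h \<in> hom E c e" "\<forall>A \<in> Obj X. \<forall>x \<in> elts P A. h \<cdot>\<^bsub>E\<^esub> t A x = u A x"
    using assms(3) by blast
  show "\<exists>!h. h \<in> hom E c e \<and> (\<forall>A \<in> Obj X. \<forall>x \<in> elts P A. h \<cdot>\<^bsub>E\<^esub> t A x = u A x)"
  proof (rule ex1I[of _ h])
    show "k = h" if "k \<in> hom E c e \<and> (\<forall>A \<in> Obj X. \<forall>x \<in> elts P A. k \<cdot>\<^bsub>E\<^esub> t A x = u A x)" for k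
      using assms(4)[of k e h] h that by simp
  qed (use h in blast)
qed (use assms(1,2) in auto)

lemma weighted_colimitD:
  assumes "weighted_colimit F E P c t"
  shows "weighted_cocone F E P c t"
    and "\<lbrakk>A \<in> Obj X; x \<in> elts P A\<rbrakk> \<Longrightarrow> Rst E (t A x) = FArr F (PRst P A x)"
  using assms by (auto simp: weighted_colimit_def)

lemma weighted_colimit_factor:
  assumes "weighted_colimit F E P c t" and "weighted_cocone F E P e u"
  obtains h where "h \<in> hom E c e"
    and "\<And>A x. \<lbrakk>A \<in> Obj X; x \<in> elts P A\<rbrakk> \<Longrightarrow> h \<cdot>\<^bsub>E\<^esub> t A x = u A x"
  using assms unfolding weighted_colimit_def by blast

lemma weighted_colimit_eqI:
  assumes c: "weighted_colimit F E P c t" and F: "restriction_functor X E F" and P: "rpresheaf P"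
    and h: "h \<in> hom E c e" and k: "k \<in> hom E c e"
    and eq: "\<And>A x. \<lbrakk>A \<in> Obj X; x \<in> elts P A\<rbrakk> \<Longrightarrow> h \<cdot>\<^bsub>E\<^esub> t A x = k \<cdot>\<^bsub>E\<^esub> t A x"
  shows "h = k"
proof -
  interpret E: restriction_category E by (rule restriction_functorD(2)[OF F])
  note FX = restriction_functorD(3)[OF F]
  note t = weighted_colimitD(1)[OF c]
  have "weighted_cocone F E P e (\<lambda>A x. h \<cdot>\<^bsub>E\<^esub> t A x)"
  proof (rule weighted_coconeI)
    fix f A B y assume f: "f \<in> hom X A B" and y: "y \<in> elts P B"
    show "h \<cdot>\<^bsub>E\<^esub> t B y \<cdot>\<^bsub>E\<^esub> FArr F f = h \<cdot>\<^bsub>E\<^esub> t A (act P y f)"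
      using E.Comp_assoc[OF cat_functorD(6)[OF FX f] weighted_coconeD(2)[OF t hom_Obj(2)[OF f] y] h]
        weighted_coconeD(3)[OF t f y] by simp
  qed (use E.hom_Obj[OF h] E.Comp_hom[OF weighted_coconeD(2)[OF t] h] in auto)
  then have "\<exists>!h'. h' \<in> hom E c e \<and>
      (\<forall>A \<in> Obj X. \<forall>x \<in> elts P A. h' \<cdot>\<^bsub>E\<^esub> t A x = h \<cdot>\<^bsub>E\<^esub> t A x)"
    using c unfolding weighted_colimit_def by blast
  then show ?thesis using h k eq by metis
qed


section \<open>The category of elements\<close>

text \<open>
  Objects are the elements \<open>(A, x)\<close> of \<open>P\<close>, and an arrow to \<open>(B, y)\<close> is determined by its underlying
  arrow \<open>f\<close> of \<open>X\<close> and \<open>y\<close>, its source being \<open>y \<cdot> f\<close>.  In particular the domain of \<open>x\<close> is an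
  endomorphism of \<open>(A, x)\<close>.
\<close>

definition elements :: "'u rpsh \<Rightarrow> ('u, 'u) cat" where
  "elements P =
     \<lparr>Obj = pair ` (SIGMA A:Obj X. elts P A),
      Arr = pair ` (SIGMA f:Arr X. elts P (Cod X f)),
      Dom = (\<lambda>a. case unpair a of (f, y) \<Rightarrow> pair (Dom X f, act P y f)),
      Cod = (\<lambda>a. case unpair a of (f, y) \<Rightarrow> pair (Cod X f, y)),
      Ide = (\<lambda>i. case unpair i of (A, x) \<Rightarrow> pair (Ide X A, x)),
      Comp = (\<lambda>b a. case unpair b of (g, z) \<Rightarrow> case unpair a of (f, y) \<Rightarrow> pair (g \<cdot> f, z))\<rparr>"

lemma unpair [simp]: "unpair (pair p) = (p :: 'u \<times> 'u)"
  by (rule unpair_pair[OF universe])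

lemma pair_inject [simp]: "pair p = pair (q :: 'u \<times> 'u) \<longleftrightarrow> p = q"
  using inj_pair[OF universe] by (simp add: inj_eq)

lemma elements_simps [simp]:
  "Ide (elements P) (pair (A, x)) = pair (Ide X A, x)"
  "pair (g, z) \<cdot>\<^bsub>elements P\<^esub> pair (f, y) = pair (g \<cdot> f, z)"
  "Obj (elements P) = pair ` (SIGMA A:Obj X. elts P A)"
  by (simp_all add: elements_def)

lemma elements_Obj: "pair (A, x) \<in> Obj (elements P) \<longleftrightarrow> A \<in> Obj X \<and> x \<in> elts P A"
  by auto

lemma elements_homI:
  "\<lbrakk>f \<in> hom X A B; y \<in> elts P B\<rbrakk> \<Longrightarrow>
     pair (f, y) \<in> hom (elements P) (pair (A, act P y f)) (pair (B, y))"
  by (auto simp: hom_def elements_def)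

lemma elements_homE:
  assumes "a \<in> hom (elements P) i j"
  obtains f A B y where "f \<in> hom X A B" and "y \<in> elts P B" and "a = pair (f, y)"
    and "i = pair (A, act P y f)" and "j = pair (B, y)"
  using assms by (auto simp: hom_def elements_def)

lemma category_elements:
  assumes P: "rpresheaf P"
  shows "category (elements P)"
proof unfold_locales
  fix f assume "f \<in> Arr (elements P)"
  then have "f \<in> hom (elements P) (Dom (elements P) f) (Cod (elements P) f)" by (simp add: hom_iff)
  then show "Dom (elements P) f \<in> Obj (elements P)" "Cod (elements P) f \<in> Obj (elements P)"
    using act_elts[OF P] hom_Obj by (metis elements_homE elements_Obj)+
next
  fix A assume "A \<in> Obj (elements P)"
  then obtain B x where "A = pair (B, x)" "B \<in> Obj X" "x \<in> elts P B" by auto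
  then show "Ide (elements P) A \<in> hom (elements P) A A"
    using elements_homI[OF Ide_hom, of B x P] act_Ide[OF P] by simp
next
  fix a b i j k assume "a \<in> hom (elements P) i j" "b \<in> hom (elements P) j k"
  then show "b \<cdot>\<^bsub>elements P\<^esub> a \<in> hom (elements P) i k"
  proof (elim elements_homE)
    fix f A B y g B' D z
    assume f: "f \<in> hom X A B" and g: "g \<in> hom X B' D" and z: "z \<in> elts P D"
      and a: "a = pair (f, y)" "i = pair (A, act P y f)" "j = pair (B, y)"
      and b: "b = pair (g, z)" "j = pair (B', act P z g)" "k = pair (D, z)"
    have "B' = B" and y: "y = act P z g" using a(3) b(2) by auto
    then have g': "g \<in> hom X B D" using g by simp
    show ?thesis
      using elements_homI[OF Comp_hom[OF f g'] z] act_Comp[OF P f g' z] by (simp add: a b(1,3) y)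
  qed
next
  fix a i j assume "a \<in> hom (elements P) i j"
  then show "a \<cdot>\<^bsub>elements P\<^esub> Ide (elements P) i = a" "Ide (elements P) j \<cdot>\<^bsub>elements P\<^esub> a = a"
    using Comp_Ide Ide_Comp by (auto elim!: elements_homE)
next
  fix a b d i j k l
  assume "a \<in> hom (elements P) i j" "b \<in> hom (elements P) j k" "d \<in> hom (elements P) k l"
  then show "d \<cdot>\<^bsub>elements P\<^esub> (b \<cdot>\<^bsub>elements P\<^esub> a) = (d \<cdot>\<^bsub>elements P\<^esub> b) \<cdot>\<^bsub>elements P\<^esub> a"
    using Comp_assoc by (auto elim!: elements_homE)
qed

lemma small_elements: "rpresheaf P \<Longrightarrow> small_category (elements P)"
  unfolding small_category_def
  using category_elements small_category elts_small[of P] Cod_Obj small_pair_Sigma[OF universe]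
  by (simp add: elements_def small_category_def)

end

text \<open>
  Splittings in \<open>E\<close> of the idempotents \<open>F e\<close>, where \<open>e\<close> is the domain of an element \<open>x\<close> of \<open>P\<close>: the
  object \<open>S A x\<close> is the domain of \<open>x\<close> as a subobject of \<open>F A\<close>.  Through these splittings the partial
  data of a weighted cocone become data in \<open>Total(E)\<close>, where colimits are known to exist.
\<close>

locale element_splitting = small_restriction_category X + E: restriction_category E
  for X :: "('u, 'u) rcat" (structure) and E :: "('eo, 'em) rcat" +
  fixes F :: "('u, 'u, 'eo, 'em) func" and P :: "'u rpsh"
    and S :: "'u \<Rightarrow> 'u \<Rightarrow> 'eo" and m r :: "'u \<Rightarrow> 'u \<Rightarrow> 'em"
  assumes F: "restriction_functor X E F" and P: "restriction_presheaf X P"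
    and m: "\<lbrakk>A \<in> Obj X; x \<in> elts P A\<rbrakk> \<Longrightarrow> m A x \<in> hom E (S A x) (FObj F A)"
    and r: "\<lbrakk>A \<in> Obj X; x \<in> elts P A\<rbrakk> \<Longrightarrow> r A x \<in> hom E (FObj F A) (S A x)"
    and mr: "\<lbrakk>A \<in> Obj X; x \<in> elts P A\<rbrakk> \<Longrightarrow> m A x \<cdot>\<^bsub>E\<^esub> r A x = FArr F (PRst P A x)"
    and rm: "\<lbrakk>A \<in> Obj X; x \<in> elts P A\<rbrakk> \<Longrightarrow> r A x \<cdot>\<^bsub>E\<^esub> m A x = Ide E (S A x)"
begin

abbreviation comp_E :: "'em \<Rightarrow> 'em \<Rightarrow> 'em"  (infixl \<open>\<bullet>\<close> 70) where
  "g \<bullet> f \<equiv> g \<cdot>\<^bsub>E\<^esub> f"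

definition diagram :: "('u, 'u, 'eo, 'em) func" where
  "diagram =
     \<lparr>FObj = (\<lambda>i \<in> Obj (elements P). case unpair i of (A, x) \<Rightarrow> S A x),
      FArr = (\<lambda>a \<in> Arr (elements P). case unpair a of (f, y) \<Rightarrow>
                r (Cod X f) y \<bullet> (FArr F f \<bullet> m (Dom X f) (act P y f)))\<rparr>"

lemmas F_functor = restriction_functorD(3)[OF F]

lemma Rst_F: "f \<in> hom X A B \<Longrightarrow> FArr F (Rst X f) = Rst E (FArr F f)"
  using restriction_functorD(4)[OF F] .

lemma F_hom: "f \<in> hom X A B \<Longrightarrow> FArr F f \<in> hom E (FObj F A) (FObj F B)"
  by (rule cat_functorD(6)[OF F_functor])

lemma F_Comp: "\<lbrakk>f \<in> hom X A B; g \<in> hom X B D\<rbrakk> \<Longrightarrow> FArr F (g \<cdot> f) = FArr F g \<bullet> FArr F f"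
  by (rule cat_functorD(8)[OF F_functor])

lemma diagram_Obj: "\<lbrakk>A \<in> Obj X; x \<in> elts P A\<rbrakk> \<Longrightarrow> FObj diagram (pair (A, x)) = S A x"
  by (simp add: diagram_def)

lemma diagram_Arr:
  "\<lbrakk>f \<in> hom X A B; y \<in> elts P B\<rbrakk> \<Longrightarrow>
     FArr diagram (pair (f, y)) = r B y \<bullet> (FArr F f \<bullet> m A (act P y f))"
  using elements_homI[of f A B y P] by (simp add: diagram_def hom_iff)

lemma diagram_hom:
  assumes f: "f \<in> hom X A B" and y: "y \<in> elts P B"
  shows "FArr diagram (pair (f, y)) \<in> hom E (S A (act P y f)) (S B y)"
  unfolding diagram_Arr[OF assms]
  using E.Comp_hom[OF E.Comp_hom[OF m F_hom[OF f]] r] hom_Obj[OF f] act_elts[OF P f y] y by blast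

lemma m_cancel:
  assumes A: "A \<in> Obj X" and x: "x \<in> elts P A"
    and h: "h \<in> hom E K (S A x)" and k: "k \<in> hom E K (S A x)" and eq: "m A x \<bullet> h = m A x \<bullet> k"
  shows "h = k"
proof -
  have "r A x \<bullet> (m A x \<bullet> h) = r A x \<bullet> (m A x \<bullet> k)" using eq by simp
  then show ?thesis
    using E.Comp_assoc[OF h m[OF A x] r[OF A x]] E.Comp_assoc[OF k m[OF A x] r[OF A x]]
      rm[OF A x] E.Ide_Comp[OF h] E.Ide_Comp[OF k] by simp
qed

lemma F_PRst_m:
  assumes A: "A \<in> Obj X" and x: "x \<in> elts P A"
  shows "FArr F (PRst P A x) \<bullet> m A x = m A x"
  using E.Comp_assoc[OF m[OF A x] r[OF A x] m[OF A x]] mr[OF A x] rm[OF A x] E.Comp_Ide[OF m[OF A x]]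
  by simp

lemma r_F_PRst:
  assumes A: "A \<in> Obj X" and x: "x \<in> elts P A"
  shows "r A x \<bullet> FArr F (PRst P A x) = r A x"
  using E.Comp_assoc[OF r[OF A x] m[OF A x] r[OF A x]] mr[OF A x] rm[OF A x] E.Ide_Comp[OF r[OF A x]]
  by simp

lemma total_m: "\<lbrakk>A \<in> Obj X; x \<in> elts P A\<rbrakk> \<Longrightarrow> total_map E (m A x)"
  using E.total_section[OF m r rm] .

lemma Rst_r:
  assumes A: "A \<in> Obj X" and x: "x \<in> elts P A"
  shows "Rst E (r A x) = FArr F (PRst P A x)"
  using E.Rst_retraction[OF m[OF A x] r[OF A x] rm[OF A x]] mr[OF A x]
    Rst_F[OF PRst_hom[OF P A x]] Rst_PRst[OF P A x] by simp

text \<open>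
  The arrows of the diagram are the restrictions of the maps \<open>F(f)\<close> to the domains of definition, so
  that both \<open>m\<close> and \<open>r\<close> are natural.
\<close>

lemma m_natural:
  assumes f: "f \<in> hom X A B" and y: "y \<in> elts P B"
  shows "m B y \<bullet> FArr diagram (pair (f, y)) = FArr F f \<bullet> m A (act P y f)"
proof -
  note A = hom_Obj(1)[OF f] and B = hom_Obj(2)[OF f] and x = act_elts[OF P f y]
  let ?x = "act P y f"
  note fm = E.Comp_hom[OF m[OF A x] F_hom[OF f]]
  have "m B y \<bullet> FArr diagram (pair (f, y)) = FArr F (PRst P B y) \<bullet> (FArr F f \<bullet> m A ?x)"
    using diagram_Arr[OF f y] E.Comp_assoc[OF fm r[OF B y] m[OF B y]] mr[OF B y] by simp
  also have "\<dots> = FArr F (PRst P B y \<cdot> f) \<bullet> m A ?x"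
    using E.Comp_assoc[OF m[OF A x] F_hom[OF f] F_hom[OF PRst_hom[OF P B y]]]
      F_Comp[OF f PRst_hom[OF P B y]] by simp
  also have "\<dots> = FArr F f \<bullet> (FArr F (PRst P A ?x) \<bullet> m A ?x)"
    using PRst_Comp[OF P f y] F_Comp[OF PRst_hom[OF P A x] f]
      E.Comp_assoc[OF m[OF A x] F_hom[OF PRst_hom[OF P A x]] F_hom[OF f]] by simp
  finally show ?thesis using F_PRst_m[OF A x] by simp
qed

lemma r_natural:
  assumes f: "f \<in> hom X A B" and y: "y \<in> elts P B"
  shows "FArr diagram (pair (f, y)) \<bullet> r A (act P y f) = r B y \<bullet> FArr F f"
proof -
  note A = hom_Obj(1)[OF f] and B = hom_Obj(2)[OF f] and x = act_elts[OF P f y]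
  let ?x = "act P y f"
  note fm = E.Comp_hom[OF m[OF A x] F_hom[OF f]]
  have "FArr diagram (pair (f, y)) \<bullet> r A ?x = r B y \<bullet> (FArr F f \<bullet> FArr F (PRst P A ?x))"
    using diagram_Arr[OF f y] E.Comp_assoc[OF r[OF A x] fm r[OF B y]]
      E.Comp_assoc[OF r[OF A x] m[OF A x] F_hom[OF f]] mr[OF A x] by simp
  also have "\<dots> = r B y \<bullet> (FArr F (PRst P B y) \<bullet> FArr F f)"
    using PRst_Comp[OF P f y] F_Comp[OF PRst_hom[OF P A x] f] F_Comp[OF f PRst_hom[OF P B y]] by simp
  also have "\<dots> = r B y \<bullet> FArr F f"
    using E.Comp_assoc[OF F_hom[OF f] F_hom[OF PRst_hom[OF P B y]] r[OF B y]] r_F_PRst[OF B y] by simp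
  finally show ?thesis .
qed

text \<open>
  If \<open>x = y \<cdot> f\<close>, then \<open>f\<close> is defined on the domain of \<open>x\<close>.  Hence \<open>F f\<close>, restricted to the domain of
  \<open>x\<close>, is total, and corestriction to the domain of \<open>y\<close> loses nothing.
\<close>

lemma total_diagram:
  assumes f: "f \<in> hom X A B" and y: "y \<in> elts P B"
  shows "total_map E (FArr diagram (pair (f, y)))"
proof -
  note A = hom_Obj(1)[OF f] and B = hom_Obj(2)[OF f] and x = act_elts[OF P f y]
  let ?x = "act P y f" and ?D = "FArr diagram (pair (f, y))"
  note D = diagram_hom[OF f y]
  note fm = E.Comp_hom[OF m[OF A x] F_hom[OF f]]
  have RD: "Rst E ?D = Rst E (FArr F f \<bullet> m A ?x)"
    using E.Rst_total_Comp[OF D m[OF B y] total_m[OF B y]] m_natural[OF f y] by simp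
  have "Rst X f \<cdot> PRst P A ?x = PRst P A ?x"
    using PRst_act_le[OF P f y] R2[OF f PRst_hom[OF P A x]] Rst_PRst[OF P A x] by simp
  then have "FArr F (Rst X f) \<bullet> m A ?x = m A ?x"
    using E.Comp_assoc[OF m[OF A x] F_hom[OF PRst_hom[OF P A x]] F_hom[OF Rst_hom[OF f]]]
      F_Comp[OF PRst_hom[OF P A x] Rst_hom[OF f]] F_PRst_m[OF A x] by simp
  then have "m A ?x \<bullet> Rst E ?D = m A ?x \<bullet> Ide E (S A ?x)"
    using RD E.R4[OF m[OF A x] F_hom[OF f]] Rst_F[OF f] E.Comp_Ide[OF m[OF A x]] by simp
  then have "Rst E ?D = Ide E (S A ?x)"
    using m_cancel[OF A x E.Rst_hom[OF D] E.Ide_hom[OF E.hom_Obj(1)[OF D]]] by blast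
  then show ?thesis using E.total_map_iff[OF D] by simp
qed

lemma diagram: "cat_functor (elements P) (Total E) diagram"
proof (rule cat_functorI)
  show "category (elements P)" "category (Total E)"
    by (rule category_elements[OF P], rule E.category_Total)
  show "FObj diagram \<in> extensional (Obj (elements P))" "FArr diagram \<in> extensional (Arr (elements P))"
    by (auto simp: diagram_def)
  show "FObj diagram i \<in> Obj (Total E)" if "i \<in> Obj (elements P)" for i
    using that diagram_Obj E.hom_Obj(1)[OF m] by auto
  show "FArr diagram a \<in> hom (Total E) (FObj diagram i) (FObj diagram j)"
    if "a \<in> hom (elements P) i j" for a i j
    using that diagram_hom total_diagram diagram_Obj hom_Obj act_elts[OF P]
    by (auto simp: hom_Total elim!: elements_homE)
  show "FArr diagram (Ide (elements P) i) = Ide (Total E) (FObj diagram i)"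
    if i_Obj: "i \<in> Obj (elements P)" for i
  proof -
    obtain A x where i: "i = pair (A, x)" and A: "A \<in> Obj X" and x: "x \<in> elts P A"
      using i_Obj by auto
    have "FArr diagram (pair (Ide X A, x)) = r A x \<bullet> m A x"
      using diagram_Arr[OF Ide_hom[OF A] x] act_Ide[OF P A x] cat_functorD(7)[OF F_functor A]
        E.Ide_Comp[OF m[OF A x]] by simp
    then show ?thesis using i diagram_Obj[OF A x] rm[OF A x] by simp
  qed
  show "FArr diagram (b \<cdot>\<^bsub>elements P\<^esub> a) = FArr diagram b \<cdot>\<^bsub>Total E\<^esub> FArr diagram a"
    if a: "a \<in> hom (elements P) i j" and b: "b \<in> hom (elements P) j k" for a b i j k
  proof -
    from a obtain f A B y where f: "f \<in> hom X A B" and y: "y \<in> elts P B" and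
      a': "a = pair (f, y)" "i = pair (A, act P y f)" "j = pair (B, y)" by (rule elements_homE)
    from b obtain g B' C z where g: "g \<in> hom X B' C" and z: "z \<in> elts P C" and
      b': "b = pair (g, z)" "j = pair (B', act P z g)" "k = pair (C, z)" by (rule elements_homE)
    have B': "B' = B" and yz: "y = act P z g" using a'(3) b'(2) by auto
    note g = g[unfolded B']
    note gf = Comp_hom[OF f g]
    note C = hom_Obj(2)[OF g]
    have x: "act P z (g \<cdot> f) = act P y f" using act_Comp[OF P f g z] yz by simp
    note Df = diagram_hom[OF f y] and Dg = diagram_hom[OF g z, folded yz]
    note mx = m[OF hom_Obj(1)[OF f] act_elts[OF P f y]] and my = m[OF hom_Obj(2)[OF f] y]
    have "FArr diagram (pair (g \<cdot> f, z)) = FArr diagram (pair (g, z)) \<bullet> FArr diagram (pair (f, y))"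
    proof (rule m_cancel[OF C z])
      show "FArr diagram (pair (g \<cdot> f, z)) \<in> hom E (S A (act P y f)) (S C z)"
        using diagram_hom[OF gf z] x by simp
      show "FArr diagram (pair (g, z)) \<bullet> FArr diagram (pair (f, y)) \<in> hom E (S A (act P y f)) (S C z)"
        using E.Comp_hom[OF Df Dg] .
      have "m C z \<bullet> (FArr diagram (pair (g, z)) \<bullet> FArr diagram (pair (f, y)))
          = FArr F g \<bullet> m B y \<bullet> FArr diagram (pair (f, y))"
        using E.Comp_assoc[OF Df Dg m[OF C z]] m_natural[OF g z] yz by simp
      also have "\<dots> = FArr F g \<bullet> (FArr F f \<bullet> m A (act P y f))"
        using E.Comp_assoc[OF Df my F_hom[OF g]] m_natural[OF f y] by simp
      also have "\<dots> = m C z \<bullet> FArr diagram (pair (g \<cdot> f, z))"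
        using E.Comp_assoc[OF mx F_hom[OF f] F_hom[OF g]] F_Comp[OF f g] m_natural[OF gf z] x by simp
      finally show "m C z \<bullet> FArr diagram (pair (g \<cdot> f, z)) =
          m C z \<bullet> (FArr diagram (pair (g, z)) \<bullet> FArr diagram (pair (f, y)))" by simp
    qed
    then show ?thesis using a'(1) b'(1) by simp
  qed
qed

text \<open>
  Composition with \<open>r\<close> and with \<open>m\<close> turns cocones under the diagram of splittings into weighted cocones
  and back.
\<close>

lemma cocone_imp_weighted:
  assumes s: "cocone (elements P) E diagram e s"
  shows "weighted_cocone F E P e (\<lambda>A x. s (pair (A, x)) \<bullet> r A x)"
proof (rule weighted_coconeI)
  have sh: "s (pair (A, x)) \<in> hom E (S A x) e" if "A \<in> Obj X" "x \<in> elts P A" for A x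
    using coconeD(2)[OF s, of "pair (A, x)"] that diagram_Obj by auto
  show "e \<in> Obj E" using coconeD(1)[OF s] .
  show "s (pair (A, x)) \<bullet> r A x \<in> hom E (FObj F A) e" if "A \<in> Obj X" "x \<in> elts P A" for A x
    using E.Comp_hom[OF r sh] that by blast
  fix f A B y assume f: "f \<in> hom X A B" and y: "y \<in> elts P B"
  note A = hom_Obj(1)[OF f] and B = hom_Obj(2)[OF f] and x = act_elts[OF P f y]
  show "s (pair (B, y)) \<bullet> r B y \<bullet> FArr F f = s (pair (A, act P y f)) \<bullet> r A (act P y f)"
    using E.Comp_assoc[OF F_hom[OF f] r[OF B y] sh[OF B y]] r_natural[OF f y]
      E.Comp_assoc[OF r[OF A x] diagram_hom[OF f y] sh[OF B y]]
      coconeD(3)[OF s elements_homI[OF f y]] by simp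
qed

lemma weighted_imp_cocone:
  assumes u: "weighted_cocone F E P e u"
  shows "cocone (elements P) E diagram e (\<lambda>i. case unpair i of (A, x) \<Rightarrow> u A x \<bullet> m A x)"
proof (rule coconeI)
  note uh = weighted_coconeD(2)[OF u]
  show "e \<in> Obj E" using weighted_coconeD(1)[OF u] .
  show "(case unpair i of (A, x) \<Rightarrow> u A x \<bullet> m A x) \<in> hom E (FObj diagram i) e"
    if "i \<in> Obj (elements P)" for i
    using that E.Comp_hom[OF m uh] diagram_Obj by auto
  fix a i j assume "a \<in> hom (elements P) i j"
  then obtain f A B y where f: "f \<in> hom X A B" and y: "y \<in> elts P B"
    and a: "a = pair (f, y)" and i: "i = pair (A, act P y f)" and j: "j = pair (B, y)"
    by (rule elements_homE)
  note A = hom_Obj(1)[OF f] and B = hom_Obj(2)[OF f] and x = act_elts[OF P f y]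
  have "u B y \<bullet> m B y \<bullet> FArr diagram (pair (f, y)) = u A (act P y f) \<bullet> m A (act P y f)"
    using E.Comp_assoc[OF diagram_hom[OF f y] m[OF B y] uh[OF B y]] m_natural[OF f y]
      E.Comp_assoc[OF m[OF A x] F_hom[OF f] uh[OF B y]] weighted_coconeD(3)[OF u f y] by simp
  then show "(case unpair j of (A, x) \<Rightarrow> u A x \<bullet> m A x) \<bullet> FArr diagram a
      = (case unpair i of (A, x) \<Rightarrow> u A x \<bullet> m A x)" by (simp add: a i j)
qed

lemma u_m_r:
  assumes u: "weighted_cocone F E P e u" and A: "A \<in> Obj X" and x: "x \<in> elts P A"
  shows "u A x \<bullet> m A x \<bullet> r A x = u A x"
  using E.Comp_assoc[OF r[OF A x] m[OF A x] weighted_coconeD(2)[OF u A x]] mr[OF A x]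
    weighted_cocone_PRst[OF u P A x] by simp

lemma s_r_m:
  assumes A: "A \<in> Obj X" and x: "x \<in> elts P A" and s: "s \<in> hom E (S A x) e"
  shows "s \<bullet> r A x \<bullet> m A x = s"
  using E.Comp_assoc[OF m[OF A x] r[OF A x] s] rm[OF A x] E.Comp_Ide[OF s] by simp

text \<open>
  Since \<open>r A x\<close> is the retraction onto the domain of \<open>x\<close>, a total leg \<open>S A x \<rightarrow> c\<close> becomes a leg
  \<open>F A \<rightarrow> c\<close> defined exactly on that domain.
\<close>

lemma colimit_imp_weighted:
  assumes c: "colimit (elements P) E diagram c \<iota>"
    and tot: "\<And>i. i \<in> Obj (elements P) \<Longrightarrow> total_map E (\<iota> i)"
  shows "weighted_colimit F E P c (\<lambda>A x. \<iota> (pair (A, x)) \<bullet> r A x)"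
proof (rule weighted_colimitI)
  have \<iota>: "cocone (elements P) E diagram c \<iota>" using c by (simp add: colimit_def)
  have \<iota>h: "\<iota> (pair (A, x)) \<in> hom E (S A x) c" if "A \<in> Obj X" "x \<in> elts P A" for A x
    using coconeD(2)[OF \<iota>, of "pair (A, x)"] that diagram_Obj by auto
  show "weighted_cocone F E P c (\<lambda>A x. \<iota> (pair (A, x)) \<bullet> r A x)"
    by (rule cocone_imp_weighted[OF \<iota>])
  show "Rst E (\<iota> (pair (A, x)) \<bullet> r A x) = FArr F (PRst P A x)"
    if A: "A \<in> Obj X" and x: "x \<in> elts P A" for A x
    using E.Rst_total_Comp[OF r[OF A x] \<iota>h[OF A x]] tot[of "pair (A, x)"] Rst_r[OF A x] A x by auto
  show "\<exists>h \<in> hom E c e. \<forall>A \<in> Obj X. \<forall>x \<in> elts P A. h \<bullet> (\<iota> (pair (A, x)) \<bullet> r A x) = u A x"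
    if u: "weighted_cocone F E P e u" for e u
  proof -
    obtain h where h: "h \<in> hom E c e" and h\<iota>: "\<And>i. i \<in> Obj (elements P) \<Longrightarrow>
        h \<bullet> \<iota> i = (case unpair i of (A, x) \<Rightarrow> u A x \<bullet> m A x)"
      using colimit_factor[OF c weighted_imp_cocone[OF u]] by blast
    have "h \<bullet> (\<iota> (pair (A, x)) \<bullet> r A x) = u A x" if A: "A \<in> Obj X" and x: "x \<in> elts P A" for A x
      using E.Comp_assoc[OF r[OF A x] \<iota>h[OF A x] h] h\<iota>[of "pair (A, x)"] u_m_r[OF u A x] A x by simp
    then show ?thesis using h by blast
  qed
  show "h = k" if h: "h \<in> hom E c e" and k: "k \<in> hom E c e"
    and eq: "\<And>A x. \<lbrakk>A \<in> Obj X; x \<in> elts P A\<rbrakk> \<Longrightarrow>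
      h \<bullet> (\<iota> (pair (A, x)) \<bullet> r A x) = k \<bullet> (\<iota> (pair (A, x)) \<bullet> r A x)" for e h k
  proof (rule colimit_eqI[OF c E.cat_functor_TotalD[OF diagram] h k])
    fix i assume "i \<in> Obj (elements P)"
    then obtain A x where i: "i = pair (A, x)" and A: "A \<in> Obj X" and x: "x \<in> elts P A" by auto
    have "h \<bullet> \<iota> i \<bullet> r A x \<bullet> m A x = k \<bullet> \<iota> i \<bullet> r A x \<bullet> m A x"
      using eq[OF A x] E.Comp_assoc[OF r[OF A x] \<iota>h[OF A x] h] E.Comp_assoc[OF r[OF A x] \<iota>h[OF A x] k] i
      by simp
    then show "h \<bullet> \<iota> i = k \<bullet> \<iota> i"
      using s_r_m[OF A x E.Comp_hom[OF \<iota>h[OF A x] h]] s_r_m[OF A x E.Comp_hom[OF \<iota>h[OF A x] k]] i by simp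
  qed
qed

text \<open>
  The leg at \<open>x\<close> is defined on the domain of \<open>x\<close>, so its composite with \<open>m A x\<close> is total; a colimit
  in \<open>E\<close> with total legs is a colimit in \<open>Total(E)\<close>.
\<close>

lemma weighted_imp_colimit:
  assumes c: "weighted_colimit F E P c t"
  defines "\<iota> \<equiv> \<lambda>i. case unpair i of (A, x) \<Rightarrow> t A x \<bullet> m A x"
  shows "colimit (elements P) (Total E) diagram c \<iota>"
proof (rule E.colimit_Total[OF diagram])
  note t = weighted_colimitD(1)[OF c]
  note th = weighted_coconeD(2)[OF t]
  show "colimit (elements P) E diagram c \<iota>"
  proof (rule colimitI)
    show "cocone (elements P) E diagram c \<iota>" unfolding \<iota>_def by (rule weighted_imp_cocone[OF t])
    show "\<exists>h \<in> hom E c e. \<forall>i \<in> Obj (elements P). h \<bullet> \<iota> i = s i"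
      if s: "cocone (elements P) E diagram e s" for e s
    proof -
      have sh: "s (pair (A, x)) \<in> hom E (S A x) e" if "A \<in> Obj X" "x \<in> elts P A" for A x
        using coconeD(2)[OF s, of "pair (A, x)"] that diagram_Obj by auto
      obtain h where h: "h \<in> hom E c e"
        and ht: "\<And>A x. \<lbrakk>A \<in> Obj X; x \<in> elts P A\<rbrakk> \<Longrightarrow> h \<bullet> t A x = s (pair (A, x)) \<bullet> r A x"
        using weighted_colimit_factor[OF c cocone_imp_weighted[OF s]] by blast
      have "h \<bullet> \<iota> i = s i" if "i \<in> Obj (elements P)" for i
      proof -
        obtain A x where i: "i = pair (A, x)" and A: "A \<in> Obj X" and x: "x \<in> elts P A" using \<open>i \<in> _\<close> by auto
        show ?thesis
          using E.Comp_assoc[OF m[OF A x] th[OF A x] h] ht[OF A x] s_r_m[OF A x sh[OF A x]]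
          by (simp add: i \<iota>_def)
      qed
      then show ?thesis using h by blast
    qed
    show "h = k" if h: "h \<in> hom E c e" and k: "k \<in> hom E c e"
      and eq: "\<forall>i \<in> Obj (elements P). h \<bullet> \<iota> i = k \<bullet> \<iota> i" for e h k
    proof (rule weighted_colimit_eqI[OF c F P h k])
      fix A x assume A: "A \<in> Obj X" and x: "x \<in> elts P A"
      have "h \<bullet> (t A x \<bullet> m A x) = k \<bullet> (t A x \<bullet> m A x)"
        using eq[rule_format, of "pair (A, x)"] A x by (simp add: \<iota>_def)
      then have "h \<bullet> (t A x \<bullet> m A x \<bullet> r A x) = k \<bullet> (t A x \<bullet> m A x \<bullet> r A x)"
        using E.Comp_assoc[OF r[OF A x] E.Comp_hom[OF m[OF A x] th[OF A x]] h]
          E.Comp_assoc[OF r[OF A x] E.Comp_hom[OF m[OF A x] th[OF A x]] k] by simp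
      then show "h \<bullet> t A x = k \<bullet> t A x" using u_m_r[OF t A x] by simp
    qed
  qed
  fix i assume "i \<in> Obj (elements P)"
  then obtain A x where i: "i = pair (A, x)" and A: "A \<in> Obj X" and x: "x \<in> elts P A" by auto
  note tm = E.Comp_hom[OF m[OF A x] th[OF A x]]
  have "m A x \<bullet> Rst E (t A x \<bullet> m A x) = m A x \<bullet> Ide E (S A x)"
    using E.R4[OF m[OF A x] th[OF A x]] weighted_colimitD(2)[OF c A x] F_PRst_m[OF A x]
      E.Comp_Ide[OF m[OF A x]] by simp
  then have "Rst E (t A x \<bullet> m A x) = Ide E (S A x)"
    using m_cancel[OF A x E.Rst_hom[OF tm] E.Ide_hom[OF E.hom_Obj(1)[OF tm]]] by blast
  then show "total_map E (\<iota> i)" using E.total_map_iff[OF tm] by (simp add: i \<iota>_def)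
qed

end

context small_restriction_category
begin

lemma element_splitting_exists:
  assumes F: "restriction_functor X E F" and split: "split_rcat E" and P: "rpresheaf P"
  obtains S m r where "element_splitting X E F P S m r"
proof -
  interpret E: restriction_category E by (rule restriction_functorD(2)[OF F])
  note FX = restriction_functorD(3)[OF F]
  have "\<exists>S m r. m \<in> hom E S (FObj F A) \<and> r \<in> hom E (FObj F A) S \<and>
          m \<cdot>\<^bsub>E\<^esub> r = FArr F (PRst P A x) \<and> r \<cdot>\<^bsub>E\<^esub> m = Ide E S"
    if A: "A \<in> Obj X" and x: "x \<in> elts P A" for A x
  proof -
    note e = cat_functorD(6)[OF FX PRst_hom[OF P A x]]
    have "restriction_idempotent E (FArr F (PRst P A x))"
      using e restriction_functorD(4)[OF F PRst_hom[OF P A x]] Rst_PRst[OF P A x]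
      by (simp add: restriction_idempotent_def hom_iff)
    then obtain S m r where "m \<in> hom E S (Dom E (FArr F (PRst P A x)))"
      "r \<in> hom E (Dom E (FArr F (PRst P A x))) S"
      "FArr F (PRst P A x) = m \<cdot>\<^bsub>E\<^esub> r" "r \<cdot>\<^bsub>E\<^esub> m = Ide E S"
      using split unfolding split_rcat_def by blast
    moreover have "Dom E (FArr F (PRst P A x)) = FObj F A" using e by (simp add: hom_iff)
    ultimately show ?thesis by metis
  qed
  then obtain S m r where Smr: "\<And>A x. \<lbrakk>A \<in> Obj X; x \<in> elts P A\<rbrakk> \<Longrightarrow>
      m A x \<in> hom E (S A x) (FObj F A) \<and> r A x \<in> hom E (FObj F A) (S A x) \<and>
      m A x \<cdot>\<^bsub>E\<^esub> r A x = FArr F (PRst P A x) \<and> r A x \<cdot>\<^bsub>E\<^esub> m A x = Ide E (S A x)"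
    by metis
  have "element_splitting X E F P S m r"
    by unfold_locales (use F P Smr in auto)
  then show thesis by (rule that)
qed

text \<open>
  Colimits in \<open>Total(E)\<close> over the category of elements of \<open>P\<close> are preserved by the inclusion in
  \<open>E\<close>, whence they compute weighted colimits.
\<close>

lemma weighted_colimit_exists:
  fixes E :: "('eo, 'em) rcat"
  assumes F: "restriction_functor X E F" and E: "cocomplete_rcat TYPE('u) E" and P: "rpresheaf P"
  shows "\<exists>c t. weighted_colimit F E P c t"
proof -
  obtain S m r where "element_splitting X E F P S m r"
    using element_splitting_exists[OF F cocomplete_rcatD(2)[OF E] P] by blast
  then interpret element_splitting X E F P S m r .
  obtain c \<iota> where c: "colimit (elements P) (Total E) diagram c \<iota>"
    using cocomplete_rcatD(3)[OF E small_elements[OF P] diagram] by blast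
  have "cocone (elements P) (Total E) diagram c \<iota>" using c by (simp add: colimit_def)
  then have "total_map E (\<iota> i)" if "i \<in> Obj (elements P)" for i
    using coconeD(2) that by (metis hom_Total)
  then show ?thesis
    using colimit_imp_weighted[OF cocomplete_rcatD(4)[OF E small_elements[OF P] diagram c]] by blast
qed

end

lemma restriction_functor_comp:
  assumes F: "restriction_functor X Y F" and G: "restriction_functor Y Z G"
  shows "restriction_functor X Z (comp_functor X G F)"
  unfolding restriction_functor_def
proof (intro conjI ballI)
  interpret X: restriction_category X by (rule restriction_functorD(1)[OF F])
  show "restriction_category X" "restriction_category Z"
    by (rule restriction_functorD(1)[OF F], rule restriction_functorD(2)[OF G])
  show "cat_functor X Z (comp_functor X G F)"
    by (rule cat_functor_comp[OF restriction_functorD(3)[OF F] restriction_functorD(3)[OF G]])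
  fix f assume "f \<in> Arr X"
  then have f: "f \<in> hom X (Dom X f) (Cod X f)" by (simp add: hom_iff)
  have "Rst X f \<in> Arr X" using X.Rst_hom[OF f] by (simp add: hom_iff)
  then show "FArr (comp_functor X G F) (Rst X f) = Rst Z (FArr (comp_functor X G F) f)"
    using f restriction_functorD(4)[OF F f]
      restriction_functorD(4)[OF G cat_functorD(6)[OF restriction_functorD(3)[OF F] f]]
    by (simp add: hom_iff)
qed

lemma (in restriction_category) restriction_functor_id: "restriction_functor X X (id_functor X)"
  unfolding restriction_functor_def
  using cat_functor_id Rst_hom restriction_category_axioms by (auto simp: id_functor_def hom_iff)

lemma comp_id_functor:
  assumes D: "cat_functor J C D"
  shows "comp_functor J (id_functor C) D = D"
proof (rule func.equality)
  show "FObj (comp_functor J (id_functor C) D) = FObj D"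
    by (rule extensionalityI[of _ "Obj J"])
      (use cat_functorD(3,5)[OF D] in \<open>auto simp: comp_functor_def id_functor_def\<close>)
  show "FArr (comp_functor J (id_functor C) D) = FArr D"
    by (rule extensionalityI[of _ "Arr J"])
      (use cat_functorD(4,9)[OF D] in \<open>auto simp: comp_functor_def id_functor_def\<close>)
qed simp


section \<open>Pointwise Kan extensions along the Yoneda embedding\<close>

context small_restriction_category
begin

lemma weighted_colimit_cong:
  assumes "\<And>A x. \<lbrakk>A \<in> Obj X; x \<in> elts P A\<rbrakk> \<Longrightarrow> t A x = t' A x" and P: "rpresheaf P"
    and "weighted_colimit F E P c t"
  shows "weighted_colimit F E P c t'"
proof -
  have "weighted_cocone F E P c t'"
    using weighted_colimitD(1)[OF assms(3)] assms(1) act_elts[OF P] hom_Obj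
    by (auto simp: weighted_cocone_def)
  then show ?thesis using assms(1,3) by (simp add: weighted_colimit_def)
qed

text \<open>
  The value of \<open>W\<close> at every \<open>P\<close> is the colimit, weighted by \<open>P\<close>, of the values of \<open>W\<close> at representables,
  and the legs are the images of the points of \<open>P\<close>: the functor \<open>W\<close> is the pointwise left Kan
  extension of its restriction along the Yoneda embedding.
\<close>

definition pointwise_Kan ::
  "('eo, 'em) rcat \<Rightarrow> ('u rpsh, ('u rpsh, 'u, 'u set_map) trans, 'eo, 'em) func \<Rightarrow> bool" where
  "pointwise_Kan E W \<longleftrightarrow> restriction_functor (PSh X) E W \<and>
     (\<forall>P. rpresheaf P \<longrightarrow>
        weighted_colimit (comp_functor X W (yoneda X)) E P (FObj W P) (\<lambda>A x. FArr W (point P A x)))"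

lemma point_weighted_cocone:
  assumes W: "restriction_functor (PSh X) E W" and P: "rpresheaf P"
  shows "weighted_cocone (comp_functor X W (yoneda X)) E P (FObj W P) (\<lambda>A x. FArr W (point P A x))"
proof (rule weighted_coconeI)
  note W' = restriction_functorD(3)[OF W]
  show "FObj W P \<in> Obj E" using cat_functorD(5)[OF W', of P] P by simp
  show "FArr W (point P A x) \<in> hom E (FObj (comp_functor X W (yoneda X)) A) (FObj W P)"
    if "A \<in> Obj X" "x \<in> elts P A" for A x
    using cat_functorD(6)[OF W' point_hom[OF P that]] that by simp
  show "FArr W (point P B y) \<cdot>\<^bsub>E\<^esub> FArr (comp_functor X W (yoneda X)) f = FArr W (point P A (act P y f))"
    if f: "f \<in> hom X A B" and y: "y \<in> elts P B" for f A B y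
    using cat_functorD(8)[OF W' yoneda_hom[OF f] point_hom[OF P hom_Obj(2)[OF f] y]]
      point_yoneda[OF P f y] f by (simp add: hom_iff)
qed

text \<open>
  The condition on the domains of the legs in a weighted colimit comes for free for points, because
  \<open>W\<close> preserves restrictions.
\<close>

lemma Rst_W_point:
  assumes W: "restriction_functor (PSh X) E W" and P: "rpresheaf P"
    and A: "A \<in> Obj X" and x: "x \<in> elts P A"
  shows "Rst E (FArr W (point P A x)) = FArr (comp_functor X W (yoneda X)) (PRst P A x)"
  using restriction_functorD(4)[OF W point_hom[OF P A x]] Rst_point[OF P A x] PRst_hom[OF P A x]
  by (simp add: hom_iff)

text \<open>
  By the Yoneda lemma, the components \<open>y A \<rightarrow> Q\<close> of a weighted cocone under \<open>P\<close> amount to elements of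
  \<open>Q\<close>, one for each element of \<open>P\<close>, and hence to a map \<open>P \<rightarrow> Q\<close>: the Yoneda embedding is dense.
\<close>

lemma yoneda_dense:
  assumes P: "rpresheaf P"
  shows "weighted_colimit (yoneda X) (PSh X) P P (point P)"
proof (rule weighted_colimitI)
  note Y = restriction_functorD(3)[OF restriction_functor_yoneda]
  show "weighted_cocone (yoneda X) (PSh X) P P (point P)"
    by (rule weighted_coconeI) (use P point_hom[OF P] point_yoneda[OF P] in auto)
  show "Rst (PSh X) (point P A x) = FArr (yoneda X) (PRst P A x)" if "A \<in> Obj X" "x \<in> elts P A" for A x
    using Rst_point[OF P that] .
  show "\<exists>h \<in> hom (PSh X) P Q. \<forall>A \<in> Obj X. \<forall>x \<in> elts P A. h \<cdot>\<^bsub>PSh X\<^esub> point P A x = u A x"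
    if u: "weighted_cocone (yoneda X) (PSh X) P Q u" for Q u
  proof -
    have Q: "rpresheaf Q" using weighted_coconeD(1)[OF u] by simp
    have uh: "u A x \<in> hom (PSh X) (yo A) Q" if "A \<in> Obj X" "x \<in> elts P A" for A x
      using weighted_coconeD(2)[OF u that] that by simp
    define h where "h = presheaf_map X P Q (\<lambda>A x. app (u A x) A (Ide X A))"
    have h: "h \<in> hom (PSh X) P Q"
      unfolding h_def
    proof (rule presheaf_map[OF P Q])
      show "app (u A x) A (Ide X A) \<in> elts Q A" if "A \<in> Obj X" "x \<in> elts P A" for A x
        using app_elts[OF uh[OF that] that(1)] Ide_hom[OF that(1)] that(1) by simp
      fix A B g x assume g: "g \<in> hom X B A" and x: "x \<in> elts P A"
      note A = hom_Obj(2)[OF g] and B = hom_Obj(1)[OF g]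
      have IB: "Ide X B \<in> elts (yo B) B" and IA: "Ide X A \<in> elts (yo A) A" using A B Ide_hom by simp_all
      have "app (u B (act P x g)) B (Ide X B) = app (u A x) B g"
        using weighted_coconeD(3)[OF u g x] app_Comp[OF yoneda_hom[OF g] uh[OF A x] B IB]
          yoneda_eq_point[OF g] app_point[OF Ide_hom[OF B]] act_yo[OF g Ide_hom[OF B]] Comp_Ide[OF g]
        by simp
      also have "\<dots> = act Q (app (u A x) A (Ide X A)) g"
        using app_act[OF uh[OF A x] g IA] act_yo[OF Ide_hom[OF A] g] Ide_Comp[OF g] by simp
      finally show "app (u B (act P x g)) B (Ide X B) = act Q (app (u A x) A (Ide X A)) g" .
    qed
    have "h \<cdot>\<^bsub>PSh X\<^esub> point P A x = u A x" if "A \<in> Obj X" "x \<in> elts P A" for A x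
      using Comp_point[OF h that] eq_point[OF uh[OF that] that(1)] that by (simp add: h_def)
    then show ?thesis using h by blast
  qed
  show "h = k" if h: "h \<in> hom (PSh X) P Q" and k: "k \<in> hom (PSh X) P Q"
    and eq: "\<And>A x. \<lbrakk>A \<in> Obj X; x \<in> elts P A\<rbrakk> \<Longrightarrow>
               h \<cdot>\<^bsub>PSh X\<^esub> point P A x = k \<cdot>\<^bsub>PSh X\<^esub> point P A x" for Q h k
  proof (rule PSh_eqI[OF h k])
    fix A x assume A: "A \<in> Obj X" and x: "x \<in> elts P A"
    show "app h A x = app k A x"
      using arg_cong[OF eq[OF A x], of "\<lambda>\<alpha>. app \<alpha> A (Ide X A)"] Comp_point[OF h A x] Comp_point[OF k A x]
        app_point_Ide[OF PSh_homD(2)[OF h] A app_elts[OF h A x]]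
        app_point_Ide[OF PSh_homD(2)[OF h] A app_elts[OF k A x]] by simp
  qed
qed

text \<open>
  This is density again.  Through this instance, the effect of pointwise Kan extensions on colimits
  yields the colimits of presheaves themselves.
\<close>

lemma pointwise_Kan_id: "pointwise_Kan (PSh X) (id_functor (PSh X))"
  unfolding pointwise_Kan_def comp_id_functor[OF restriction_functorD(3)[OF restriction_functor_yoneda]]
proof (intro conjI allI impI)
  fix P assume P: "rpresheaf P"
  have "point P A x = FArr (id_functor (PSh X)) (point P A x)" if "A \<in> Obj X" "x \<in> elts P A" for A x
    using point_hom[OF P that] by (simp add: id_functor_def hom_iff)
  moreover have "FObj (id_functor (PSh X)) P = P" using P by (simp add: id_functor_def)
  ultimately show "weighted_colimit (yoneda X) (PSh X) P (FObj (id_functor (PSh X)) P)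
      (\<lambda>A x. FArr (id_functor (PSh X)) (point P A x))"
    using weighted_colimit_cong[OF _ P yoneda_dense[OF P]] by simp
qed (rule PSh.restriction_functor_id)

end


section \<open>Colimits of restriction presheaves\<close>

text \<open>
  The equivalence relation on pairs of an index \<open>i\<close> and an element of the \<open>i\<close>-th presheaf of a diagram
  at \<open>A\<close> whose classes are the elements of the colimit at \<open>A\<close>.
\<close>

inductive glued ::
  "('u, 'u) cat \<Rightarrow> ('u, 'u, 'u rpsh, ('u rpsh, 'u, 'u set_map) trans) func \<Rightarrow> 'u \<Rightarrow>
   'u \<times> 'u \<Rightarrow> 'u \<times> 'u \<Rightarrow> bool"
  for J D A where
  arrow: "\<lbrakk>u \<in> hom J i j; z \<in> elts (FObj D i) A\<rbrakk> \<Longrightarrow> glued J D A (i, z) (j, app (FArr D u) A z)"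
| refl: "\<lbrakk>i \<in> Obj J; z \<in> elts (FObj D i) A\<rbrakk> \<Longrightarrow> glued J D A (i, z) (i, z)"
| sym: "glued J D A p q \<Longrightarrow> glued J D A q p"
| trans: "\<lbrakk>glued J D A p q; glued J D A q q'\<rbrakk> \<Longrightarrow> glued J D A p q'"

context small_restriction_category
begin

text \<open>
  At each \<open>A\<close>, the legs exhibit the set of elements of \<open>c\<close> as the quotient of the disjoint union of
  the sets of elements by the gluing relation.
\<close>

definition pointwise_colimit ::
  "('u, 'u) cat \<Rightarrow> ('u, 'u, 'u rpsh, ('u rpsh, 'u, 'u set_map) trans) func \<Rightarrow> 'u rpsh \<Rightarrow>
   ('u \<Rightarrow> ('u rpsh, 'u, 'u set_map) trans) \<Rightarrow> bool" where
  "pointwise_colimit J D c \<iota> \<longleftrightarrow> cocone J (Total (PSh X)) D c \<iota> \<and>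
     (\<forall>A \<in> Obj X. \<forall>x \<in> elts c A. \<exists>i \<in> Obj J. \<exists>z \<in> elts (FObj D i) A. x = app (\<iota> i) A z) \<and>
     (\<forall>A \<in> Obj X. \<forall>i \<in> Obj J. \<forall>j \<in> Obj J. \<forall>z \<in> elts (FObj D i) A. \<forall>w \<in> elts (FObj D j) A.
        app (\<iota> i) A z = app (\<iota> j) A w \<longrightarrow> glued J D A (i, z) (j, w))"

text \<open>
  A cocone under \<open>W D\<close> in \<open>E\<close> gives, by composition with \<open>W\<close> of the points of the presheaves
  \<open>D i\<close>, a map \<open>W(y A) \<rightarrow> e\<close> for each pair \<open>(i, z)\<close>.  As glued pairs give equal maps, they form a
  weighted cocone under \<open>c\<close>.
\<close>

lemma pointwise_Kan_colimit:
  assumes W: "pointwise_Kan E W" and D: "cat_functor J (Total (PSh X)) D"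
    and c: "pointwise_colimit J D c \<iota>"
  shows "colimit J E (comp_functor J W D) (FObj W c) (\<lambda>j. FArr W (\<iota> j))"
proof -
  have W': "restriction_functor (PSh X) E W" using W by (simp add: pointwise_Kan_def)
  note WF = restriction_functorD(3)[OF W']
  note DP = PSh.cat_functor_TotalD[OF D]
  interpret E: restriction_category E by (rule restriction_functorD(2)[OF W'])
  interpret J: category J by (rule cat_functorD(1)[OF D])
  let ?F = "comp_functor X W (yoneda X)"
  have F: "restriction_functor X E ?F" by (rule restriction_functor_comp[OF restriction_functor_yoneda W'])
  have Kan: "weighted_colimit ?F E P (FObj W P) (\<lambda>A x. FArr W (point P A x))" if "rpresheaf P" for P
    using W that by (simp add: pointwise_Kan_def)
  have \<iota>T: "cocone J (Total (PSh X)) D c \<iota>" using c by (simp add: pointwise_colimit_def)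
  have \<iota>: "cocone J (PSh X) D c \<iota>"
    by (rule coconeI) (use coconeD[OF \<iota>T] in \<open>auto simp: hom_Total\<close>)
  have cP: "rpresheaf c" using coconeD(1)[OF \<iota>] by simp
  note \<iota>h = coconeD(2)[OF \<iota>]
  have DO: "rpresheaf (FObj D i)" if "i \<in> Obj J" for i using cat_functorD(5)[OF DP that] by simp
  note Wp = cat_functorD(6)[OF WF point_hom]
  have surj: "\<exists>i z. i \<in> Obj J \<and> z \<in> elts (FObj D i) A \<and> x = app (\<iota> i) A z"
    if "A \<in> Obj X" "x \<in> elts c A" for A x
    using c that unfolding pointwise_colimit_def by blast
  have W\<iota>p: "FArr W (\<iota> i) \<cdot>\<^bsub>E\<^esub> FArr W (point (FObj D i) A z) = FArr W (point c A (app (\<iota> i) A z))"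
    if "i \<in> Obj J" "A \<in> Obj X" "z \<in> elts (FObj D i) A" for i A z
    using cat_functorD(8)[OF WF point_hom[OF DO[OF that(1)] that(2,3)] \<iota>h[OF that(1)]]
      Comp_point[OF \<iota>h[OF that(1)] that(2,3)] by simp
  show ?thesis
  proof (rule colimitI)
    show "cocone J E (comp_functor J W D) (FObj W c) (\<lambda>j. FArr W (\<iota> j))"
    proof (rule coconeI)
      show "FObj W c \<in> Obj E" using cat_functorD(5)[OF WF coconeD(1)[OF \<iota>]] .
      show "FArr W (\<iota> j) \<in> hom E (FObj (comp_functor J W D) j) (FObj W c)" if "j \<in> Obj J" for j
        using cat_functorD(6)[OF WF \<iota>h[OF that]] that by simp
      show "FArr W (\<iota> j) \<cdot>\<^bsub>E\<^esub> FArr (comp_functor J W D) u = FArr W (\<iota> i)" if u: "u \<in> hom J i j" for u i j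
        using cat_functorD(8)[OF WF cat_functorD(6)[OF DP u] \<iota>h[OF J.hom_Obj(2)[OF u]]]
          coconeD(3)[OF \<iota> u] u by (simp add: hom_iff)
    qed
  next
    fix e s assume s: "cocone J E (comp_functor J W D) e s"
    have sh: "s i \<in> hom E (FObj W (FObj D i)) e" if "i \<in> Obj J" for i
      using coconeD(2)[OF s that] that by simp
    define v where "v A = (\<lambda>(i, z). s i \<cdot>\<^bsub>E\<^esub> FArr W (point (FObj D i) A z))" for A
    have v_glued: "v A p = v A q" if A: "A \<in> Obj X" and "glued J D A p q" for A p q
      using that(2)
    proof induction
      case (arrow u i j z)
      note i = J.hom_Obj(1)[OF arrow(1)] and j = J.hom_Obj(2)[OF arrow(1)]
      note Du = cat_functorD(6)[OF DP arrow(1)]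
      note pz = point_hom[OF DO[OF i] A arrow(2)]
      have "s j \<cdot>\<^bsub>E\<^esub> FArr W (FArr D u) = s i"
        using coconeD(3)[OF s arrow(1)] arrow(1) by (simp add: hom_iff)
      moreover have "FArr W (point (FObj D j) A (app (FArr D u) A z))
          = FArr W (FArr D u) \<cdot>\<^bsub>E\<^esub> FArr W (point (FObj D i) A z)"
        using cat_functorD(8)[OF WF pz Du] Comp_point[OF Du A arrow(2)] by simp
      ultimately show ?case
        using E.Comp_assoc[OF cat_functorD(6)[OF WF pz] cat_functorD(6)[OF WF Du] sh[OF j]]
        by (simp add: v_def)
    qed auto
    \<comment> \<open>the value is independent of the choice of \<open>p\<close>, since any two choices are glued\<close>
    define u where "u A x = v A (SOME p. fst p \<in> Obj J \<and> snd p \<in> elts (FObj D (fst p)) A \<and>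
                                         x = app (\<iota> (fst p)) A (snd p))" for A x
    have u_\<iota>: "u A (app (\<iota> i) A z) = s i \<cdot>\<^bsub>E\<^esub> FArr W (point (FObj D i) A z)"
      if A: "A \<in> Obj X" and i: "i \<in> Obj J" and z: "z \<in> elts (FObj D i) A" for A i z
    proof -
      define p where "p = (SOME p. fst p \<in> Obj J \<and> snd p \<in> elts (FObj D (fst p)) A \<and>
                             app (\<iota> i) A z = app (\<iota> (fst p)) A (snd p))"
      have "\<exists>p. fst p \<in> Obj J \<and> snd p \<in> elts (FObj D (fst p)) A \<and>
              app (\<iota> i) A z = app (\<iota> (fst p)) A (snd p)"
        using i z by (intro exI[of _ "(i, z)"]) simp
      then have p: "fst p \<in> Obj J \<and> snd p \<in> elts (FObj D (fst p)) A \<and>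
              app (\<iota> i) A z = app (\<iota> (fst p)) A (snd p)"
        unfolding p_def by (rule someI_ex)
      then have "glued J D A (i, z) (fst p, snd p)"
        using c A i z unfolding pointwise_colimit_def by blast
      then have "v A (i, z) = v A p" using v_glued[OF A] by simp
      then show ?thesis by (simp add: u_def p_def[symmetric] v_def)
    qed
    have u: "weighted_cocone ?F E c e u"
    proof (rule weighted_coconeI)
      show "e \<in> Obj E" by (rule coconeD(1)[OF s])
      show "u A x \<in> hom E (FObj ?F A) e" if A: "A \<in> Obj X" and x: "x \<in> elts c A" for A x
      proof -
        obtain i z where i: "i \<in> Obj J" and z: "z \<in> elts (FObj D i) A" and xz: "x = app (\<iota> i) A z"
          using surj[OF A x] by blast
        show ?thesis
          unfolding xz using u_\<iota>[OF A i z] E.Comp_hom[OF Wp[OF DO[OF i] A z] sh[OF i]] A by simp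
      qed
      fix f A B y assume f: "f \<in> hom X A B" and y: "y \<in> elts c B"
      note A = hom_Obj(1)[OF f] and B = hom_Obj(2)[OF f]
      obtain i z where i: "i \<in> Obj J" and z: "z \<in> elts (FObj D i) B" and yz: "y = app (\<iota> i) B z"
        using surj[OF B y] by blast
      have "u B y \<cdot>\<^bsub>E\<^esub> FArr ?F f
          = s i \<cdot>\<^bsub>E\<^esub> (FArr W (point (FObj D i) B z) \<cdot>\<^bsub>E\<^esub> FArr ?F f)"
        using u_\<iota>[OF B i z] yz
          E.Comp_assoc[OF cat_functorD(6)[OF restriction_functorD(3)[OF F] f] _ sh[OF i]]
          Wp[OF DO[OF i] B z] B by simp
      also have "\<dots> = s i \<cdot>\<^bsub>E\<^esub> FArr W (point (FObj D i) A (act (FObj D i) z f))"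
        using weighted_coconeD(3)[OF point_weighted_cocone[OF W' DO[OF i]] f z] by simp
      also have "\<dots> = u A (act c y f)"
        using u_\<iota>[OF A i act_elts[OF DO[OF i] f z]] app_act[OF \<iota>h[OF i] f z] yz by simp
      finally show "u B y \<cdot>\<^bsub>E\<^esub> FArr ?F f = u A (act c y f)" .
    qed
    obtain h where h: "h \<in> hom E (FObj W c) e"
      and hu: "\<And>A x. \<lbrakk>A \<in> Obj X; x \<in> elts c A\<rbrakk> \<Longrightarrow> h \<cdot>\<^bsub>E\<^esub> FArr W (point c A x) = u A x"
      using weighted_colimit_factor[OF Kan[OF cP] u] by blast
    have "h \<cdot>\<^bsub>E\<^esub> FArr W (\<iota> i) = s i" if i: "i \<in> Obj J" for i
    proof (rule weighted_colimit_eqI[OF Kan[OF DO[OF i]] F DO[OF i] _ sh[OF i]])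
      note W\<iota> = cat_functorD(6)[OF WF \<iota>h[OF i]]
      show "h \<cdot>\<^bsub>E\<^esub> FArr W (\<iota> i) \<in> hom E (FObj W (FObj D i)) e" using E.Comp_hom[OF W\<iota> h] .
      fix A z assume A: "A \<in> Obj X" and z: "z \<in> elts (FObj D i) A"
      show "h \<cdot>\<^bsub>E\<^esub> FArr W (\<iota> i) \<cdot>\<^bsub>E\<^esub> FArr W (point (FObj D i) A z) = s i \<cdot>\<^bsub>E\<^esub> FArr W (point (FObj D i) A z)"
        using E.Comp_assoc[OF Wp[OF DO[OF i] A z] W\<iota> h] W\<iota>p[OF i A z]
          hu[OF A app_elts[OF \<iota>h[OF i] A z]] u_\<iota>[OF A i z] by simp
    qed
    then show "\<exists>h \<in> hom E (FObj W c) e. \<forall>j \<in> Obj J. h \<cdot>\<^bsub>E\<^esub> FArr W (\<iota> j) = s j" using h by blast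
  next
    fix e h k
    assume h: "h \<in> hom E (FObj W c) e" and k: "k \<in> hom E (FObj W c) e"
      and eq: "\<forall>j \<in> Obj J. h \<cdot>\<^bsub>E\<^esub> FArr W (\<iota> j) = k \<cdot>\<^bsub>E\<^esub> FArr W (\<iota> j)"
    show "h = k"
    proof (rule weighted_colimit_eqI[OF Kan[OF cP] F cP h k])
      fix A x assume A: "A \<in> Obj X" and x: "x \<in> elts c A"
      obtain i z where i: "i \<in> Obj J" and z: "z \<in> elts (FObj D i) A" and xz: "x = app (\<iota> i) A z"
        using surj[OF A x] by blast
      note W\<iota> = cat_functorD(6)[OF WF \<iota>h[OF i]]
      show "h \<cdot>\<^bsub>E\<^esub> FArr W (point c A x) = k \<cdot>\<^bsub>E\<^esub> FArr W (point c A x)"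
        using E.Comp_assoc[OF Wp[OF DO[OF i] A z] W\<iota> h] E.Comp_assoc[OF Wp[OF DO[OF i] A z] W\<iota> k]
          W\<iota>p[OF i A z] eq i xz by simp
    qed
  qed
qed

lemma pointwise_colimit_total:
  assumes "pointwise_colimit J D c \<iota>" and "j \<in> Obj J"
  shows "total_map (PSh X) (\<iota> j)"
  using assms coconeD(2)[of J "Total (PSh X)" D c \<iota> j] by (simp add: pointwise_colimit_def hom_Total)

lemma pointwise_Kan_colimit_Total:
  assumes W: "pointwise_Kan E W" and D: "cat_functor J (Total (PSh X)) D"
    and c: "pointwise_colimit J D c \<iota>"
  shows "colimit J (Total E) (comp_functor J W D) (FObj W c) (\<lambda>j. FArr W (\<iota> j))"
proof -
  have W': "restriction_functor (PSh X) E W" using W by (simp add: pointwise_Kan_def)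
  interpret E: restriction_category E by (rule restriction_functorD(2)[OF W'])
  show ?thesis
    by (rule E.colimit_Total[OF restriction_functor_Total[OF W' D] pointwise_Kan_colimit[OF W D c]])
       (rule restriction_functor_total[OF W' pointwise_colimit_total[OF c]])
qed

text \<open>
  The identity functor is a pointwise Kan extension.
\<close>

lemma pointwise_colimit_colimit:
  assumes D: "cat_functor J (Total (PSh X)) D" and c: "pointwise_colimit J D c \<iota>"
  shows "colimit J (PSh X) D c \<iota>"
proof -
  have \<iota>: "cocone J (Total (PSh X)) D c \<iota>" using c by (simp add: pointwise_colimit_def)
  have "FObj (id_functor (PSh X)) c = c" using coconeD(1)[OF \<iota>] by (simp add: id_functor_def)
  moreover have "FArr (id_functor (PSh X)) (\<iota> j) = \<iota> j" if "j \<in> Obj J" for j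
    using coconeD(2)[OF \<iota> that] by (simp add: id_functor_def hom_iff total_map_def)
  ultimately show ?thesis
    using pointwise_Kan_colimit[OF pointwise_Kan_id D c]
      comp_id_functor[OF PSh.cat_functor_TotalD[OF D]]
      colimit_cong[OF _ cat_functorD(1)[OF D], of "\<lambda>j. FArr (id_functor (PSh X)) (\<iota> j)" \<iota>,
        THEN iffD1] by simp
qed

text \<open>
  The colimit is formed on chosen representatives of the classes of glued pairs.  Restrictions
  descend to the classes because the maps of the diagram, being total, preserve them.
\<close>

lemma pointwise_colimit_exists:
  assumes J: "small_category J" and D: "cat_functor J (Total (PSh X)) D"
  shows "\<exists>c \<iota>. pointwise_colimit J D c \<iota>"
proof -
  interpret J: category J by (rule cat_functorD(1)[OF D])
  note DP = PSh.cat_functor_TotalD[OF D]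
  have DO: "rpresheaf (FObj D i)" if "i \<in> Obj J" for i using cat_functorD(5)[OF DP that] by simp
  define pairs where "pairs A = (SIGMA i:Obj J. elts (FObj D i) A)" for A
  define gact where "gact p g = (fst p, act (FObj D (fst p)) (snd p) g)" for p and g :: 'u
  define grst where "grst A p = PRst (FObj D (fst p)) A (snd p)" for A and p :: "'u \<times> 'u"
  \<comment> \<open>glued pairs satisfy the same predicate, so that the choice yields one representative for each class\<close>
  define cls where "cls A p = pair (SOME q. glued J D A p q)" for A p
  have glued_pairs: "p \<in> pairs A \<and> q \<in> pairs A" if "glued J D A p q" and A: "A \<in> Obj X" for A p q
    using that(1)
  proof induction
    case (arrow u i j z)
    then show ?case
      using J.hom_Obj[OF arrow(1)] app_elts[OF cat_functorD(6)[OF DP arrow(1)] A arrow(2)]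
      by (simp add: pairs_def)
  qed (auto simp: pairs_def)
  have glued_act: "glued J D B (gact p g) (gact q g)" if "glued J D A p q" and g: "g \<in> hom X B A" for A B p q g
    using that(1)
  proof induction
    case (arrow u i j z)
    note i = J.hom_Obj(1)[OF arrow(1)]
    show ?case
      using glued.arrow[OF arrow(1) act_elts[OF DO[OF i] g arrow(2)]]
        app_act[OF cat_functorD(6)[OF DP arrow(1)] g arrow(2)] by (simp add: gact_def)
  next
    case (refl i z)
    then show ?case using glued.refl[OF refl(1) act_elts[OF DO[OF refl(1)] g refl(2)]] by (simp add: gact_def)
  qed (blast intro: glued.sym glued.trans)+
  have glued_rst: "grst A p = grst A q" if "glued J D A p q" and A: "A \<in> Obj X" for A p q
    using that(1)
  proof induction
    case (arrow u i j z)
    have Du: "FArr D u \<in> hom (PSh X) (FObj D i) (FObj D j)" "total_map (PSh X) (FArr D u)"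
      using cat_functorD(6)[OF D arrow(1)] by (simp_all add: hom_Total)
    then show ?case using total_PSh_iff[OF Du(1)] A arrow(2) by (simp add: grst_def)
  qed auto
  have refl: "glued J D A p p" if "p \<in> pairs A" for p A
    using that glued.refl by (auto simp: pairs_def)
  have cls: "glued J D A p (unpair (cls A p))" if "p \<in> pairs A" for p A
    unfolding cls_def unpair using refl[OF that] by (rule someI)
  have cls_eqI: "cls A p = cls A q" if "glued J D A p q" for p q A
  proof -
    have "glued J D A p = glued J D A q" using that by (intro ext) (blast intro: glued.sym glued.trans)
    then show ?thesis by (simp add: cls_def)
  qed
  have cls_eqD: "glued J D A p q" if "cls A p = cls A q" "p \<in> pairs A" "q \<in> pairs A" for p q A
    using cls[OF that(2)] cls[OF that(3)] that(1) glued.sym glued.trans by metis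
  define S where "S A = cls A ` pairs A" for A
  define c where "c = mk_presheaf X S (\<lambda>x g. cls (Dom X g) (gact (unpair x) g)) (\<lambda>A x. grst A (unpair x))"
  have pairs_fst: "fst p \<in> Obj J" "snd p \<in> elts (FObj D (fst p)) A" if "p \<in> pairs A" for p A
    using that by (auto simp: pairs_def)
  have gact_pairs: "gact p g \<in> pairs B" if "g \<in> hom X B A" "p \<in> pairs A" for p g A B
    using act_elts[OF DO that(1)] that(2) by (auto simp: gact_def pairs_def)
  have gact_Comp: "gact p (g \<cdot> f) = gact (gact p g) f"
    if "f \<in> hom X K B" "g \<in> hom X B A" "p \<in> pairs A" for f g K B A p
    using act_Comp[OF DO that(1,2)] pairs_fst[OF that(3)] by (simp add: gact_def)
  have cact: "cls B (gact (unpair (cls A p)) g) = cls B (gact p g)"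
    if "g \<in> hom X B A" "p \<in> pairs A" for p g A B
    using cls_eqI[OF glued_act[OF cls[OF that(2)] that(1)]] by simp
  have crst: "grst A (unpair (cls A p)) = grst A p" if "A \<in> Obj X" "p \<in> pairs A" for p A
    using glued_rst[OF cls[OF that(2)] that(1)] by simp
  have cP: "rpresheaf c"
    unfolding c_def
  proof (rule mk_presheaf)
    fix A assume A: "A \<in> Obj X"
    have "small (pair ` pairs A)"
      unfolding pairs_def
      by (rule small_pair_Sigma[OF universe])
         (use J elts_small[OF DO _] A in \<open>auto simp: small_category_def\<close>)
    moreover have "S A \<subseteq> pair ` pairs A"
    proof
      fix x assume "x \<in> S A"
      then obtain p where p: "p \<in> pairs A" "x = cls A p" by (auto simp: S_def)
      have "unpair x \<in> pairs A" using glued_pairs[OF cls[OF p(1)] A] p(2) by simp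
      moreover have "x = pair (unpair x)" by (simp add: p(2) cls_def)
      ultimately show "x \<in> pair ` pairs A" by blast
    qed
    ultimately show "small (S A)" by (rule small_subset)
  next
    fix A x assume A: "A \<in> Obj X" and "x \<in> S A"
    then obtain p where p: "p \<in> pairs A" and x: "x = cls A p" by (auto simp: S_def)
    note P = DO[OF pairs_fst(1)[OF p]] and z = pairs_fst(2)[OF p]
    have gr: "grst A p \<in> hom X A A" "Rst X (grst A p) = grst A p"
      using PRst_hom[OF P A z] Rst_PRst[OF P A z] by (simp_all add: grst_def)
    show "grst A (unpair x) \<in> hom X A A" "Rst X (grst A (unpair x)) = grst A (unpair x)"
      using gr crst[OF A p] x by simp_all
    have "gact p (Ide X A) = p" using act_Ide[OF P A z] by (simp add: gact_def)
    then show "cls (Dom X (Ide X A)) (gact (unpair x) (Ide X A)) = x"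
      using cact[OF Ide_hom[OF A] p] x Ide_hom[OF A] by (simp add: hom_iff)
    have "gact p (grst A p) = p" using act_PRst[OF P A z] by (simp add: gact_def grst_def)
    then show "cls (Dom X (grst A (unpair x))) (gact (unpair x) (grst A (unpair x))) = x"
      using cact[OF gr(1) p] x gr(1) crst[OF A p] by (simp add: hom_iff)
    fix f assume f: "f \<in> hom X A A" "Rst X f = f"
    show "grst A (unpair (cls (Dom X f) (gact (unpair x) f))) = grst A (unpair x) \<cdot> f"
      using cact[OF f(1) p] crst[OF A gact_pairs[OF f(1) p]] crst[OF A p] PRst_act[OF P z f] x f(1)
      by (simp add: hom_iff grst_def gact_def)
  next
    fix A B x g assume g: "g \<in> hom X B A" and "x \<in> S A"
    then obtain p where p: "p \<in> pairs A" and x: "x = cls A p" by (auto simp: S_def)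
    note A = hom_Obj(2)[OF g] and B = hom_Obj(1)[OF g]
    note P = DO[OF pairs_fst(1)[OF p]] and z = pairs_fst(2)[OF p]
    have Dg: "Dom X g = B" using g by (simp add: hom_iff)
    show "cls (Dom X g) (gact (unpair x) g) \<in> S B"
      unfolding Dg x cact[OF g p] S_def using gact_pairs[OF g p] by blast
    show "grst A (unpair x) \<cdot> g = g \<cdot> grst B (unpair (cls (Dom X g) (gact (unpair x) g)))"
      unfolding Dg x cact[OF g p] crst[OF A p] crst[OF B gact_pairs[OF g p]]
      using PRst_Comp[OF P g z] by (simp add: grst_def gact_def)
    fix f K assume f: "f \<in> hom X K B"
    have Df: "Dom X f = K" "Dom X (g \<cdot> f) = K" using f Comp_hom[OF f g] by (simp_all add: hom_iff)
    show "cls (Dom X (g \<cdot> f)) (gact (unpair x) (g \<cdot> f))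
        = cls (Dom X f) (gact (unpair (cls (Dom X g) (gact (unpair x) g))) f)"
      unfolding Dg Df x cact[OF g p] cact[OF Comp_hom[OF f g] p] cact[OF f gact_pairs[OF g p]]
      using gact_Comp[OF f g p] by simp
  qed
  have c_elts: "elts c A = S A" if "A \<in> Obj X" for A using that by (simp add: c_def)
  have c_act: "act c (cls A p) g = cls B (gact p g)" if g: "g \<in> hom X B A" and p: "p \<in> pairs A" for g A B p
    using act_mk[OF g, of "cls A p" S] cact[OF g p] p g by (simp add: c_def S_def hom_iff)
  have c_rst: "PRst c A (cls A p) = grst A p" if "A \<in> Obj X" "p \<in> pairs A" for A p
    using crst[OF that] that by (simp add: c_def S_def)
  define \<iota> where "\<iota> i = presheaf_map X (FObj D i) c (\<lambda>A z. cls A (i, z))" for i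
  have in_pairs: "(i, z) \<in> pairs A" if "i \<in> Obj J" "z \<in> elts (FObj D i) A" for i z A
    using that by (simp add: pairs_def)
  have \<iota>h: "\<iota> i \<in> hom (PSh X) (FObj D i) c" if i: "i \<in> Obj J" for i
    unfolding \<iota>_def
  proof (rule presheaf_map[OF DO[OF i] cP])
    show "cls A (i, z) \<in> elts c A" if "A \<in> Obj X" "z \<in> elts (FObj D i) A" for A z
      using in_pairs[OF i that(2)] c_elts[OF that(1)] by (simp add: S_def)
    show "cls B (i, act (FObj D i) z g) = act c (cls A (i, z)) g"
      if "g \<in> hom X B A" "z \<in> elts (FObj D i) A" for g A B z
      using c_act[OF that(1) in_pairs[OF i that(2)]] by (simp add: gact_def)
  qed
  have app_\<iota>: "app (\<iota> i) A z = cls A (i, z)" if "A \<in> Obj X" "z \<in> elts (FObj D i) A" for i A z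
    using that by (simp add: \<iota>_def)
  have \<iota>_total: "total_map (PSh X) (\<iota> i)" if i: "i \<in> Obj J" for i
    using total_PSh_iff[OF \<iota>h[OF i]] app_\<iota> c_rst in_pairs[OF i] by (simp add: grst_def)
  have "cocone J (Total (PSh X)) D c \<iota>"
  proof (rule coconeI)
    show "c \<in> Obj (Total (PSh X))" using cP by simp
    show "\<iota> j \<in> hom (Total (PSh X)) (FObj D j) c" if "j \<in> Obj J" for j
      using \<iota>h \<iota>_total that by (simp add: hom_Total)
    fix u i j assume u: "u \<in> hom J i j"
    note i = J.hom_Obj(1)[OF u] and j = J.hom_Obj(2)[OF u]
    note Du = cat_functorD(6)[OF DP u]
    have "\<iota> j \<cdot>\<^bsub>PSh X\<^esub> FArr D u = \<iota> i"
    proof (rule PSh_eqI[OF PSh_Comp_hom[OF Du \<iota>h[OF j]] \<iota>h[OF i]])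
      fix A z assume A: "A \<in> Obj X" and z: "z \<in> elts (FObj D i) A"
      show "app (\<iota> j \<cdot>\<^bsub>PSh X\<^esub> FArr D u) A z = app (\<iota> i) A z"
        using app_Comp[OF Du \<iota>h[OF j] A z] app_\<iota>[OF A z] app_\<iota>[OF A app_elts[OF Du A z]]
          cls_eqI[OF glued.arrow[OF u z]] by simp
    qed
    then show "\<iota> j \<cdot>\<^bsub>Total (PSh X)\<^esub> FArr D u = \<iota> i" by simp
  qed
  moreover have "\<exists>i \<in> Obj J. \<exists>z \<in> elts (FObj D i) A. x = app (\<iota> i) A z"
    if A: "A \<in> Obj X" and x: "x \<in> elts c A" for A x
  proof -
    obtain i z where "i \<in> Obj J" "z \<in> elts (FObj D i) A" "x = cls A (i, z)"
      using x c_elts[OF A] by (auto simp: S_def pairs_def)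
    then show ?thesis using app_\<iota>[OF A] by metis
  qed
  moreover have "glued J D A (i, z) (j, w)"
    if "A \<in> Obj X" "i \<in> Obj J" "j \<in> Obj J" "z \<in> elts (FObj D i) A" "w \<in> elts (FObj D j) A"
      "app (\<iota> i) A z = app (\<iota> j) A w" for A i j z w
    using cls_eqD[OF _ in_pairs[OF that(2,4)] in_pairs[OF that(3,5)]] that app_\<iota> by simp
  ultimately show ?thesis unfolding pointwise_colimit_def by blast
qed

text \<open>
  The two conditions on a pointwise colimit are transported along the isomorphism between two colimits
  of the same diagram.
\<close>

lemma colimit_pointwise:
  assumes J: "small_category J" and D: "cat_functor J (Total (PSh X)) D"
    and c': "colimit J (Total (PSh X)) D c' \<iota>'"
  shows "pointwise_colimit J D c' \<iota>'"
proof -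
  obtain c \<iota> where c: "pointwise_colimit J D c \<iota>" using pointwise_colimit_exists[OF J D] by blast
  have "colimit J (Total (PSh X)) D c \<iota>"
    using PSh.colimit_Total[OF D pointwise_colimit_colimit[OF D c] pointwise_colimit_total[OF c]] .
  then obtain h k where h: "h \<in> hom (PSh X) c c'" and k: "k \<in> hom (PSh X) c' c"
    and hk: "h \<cdot>\<^bsub>PSh X\<^esub> k = Ide (PSh X) c'"
    and h\<iota>: "\<And>j. j \<in> Obj J \<Longrightarrow> h \<cdot>\<^bsub>PSh X\<^esub> \<iota> j = \<iota>' j" and k\<iota>: "\<And>j. j \<in> Obj J \<Longrightarrow> k \<cdot>\<^bsub>PSh X\<^esub> \<iota>' j = \<iota> j"
    using colimit_unique[OF _ c' D, unfolded Total_simps hom_Total] by metis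
  have \<iota>': "cocone J (Total (PSh X)) D c' \<iota>'" using c' by (simp add: colimit_def)
  have \<iota>: "cocone J (Total (PSh X)) D c \<iota>" using c by (simp add: pointwise_colimit_def)
  have \<iota>h: "\<iota> j \<in> hom (PSh X) (FObj D j) c" if "j \<in> Obj J" for j
    using coconeD(2)[OF \<iota> that] by (simp add: hom_Total)
  have \<iota>h': "\<iota>' j \<in> hom (PSh X) (FObj D j) c'" if "j \<in> Obj J" for j
    using coconeD(2)[OF \<iota>' that] by (simp add: hom_Total)
  have "\<exists>i \<in> Obj J. \<exists>z \<in> elts (FObj D i) A. x = app (\<iota>' i) A z"
    if A: "A \<in> Obj X" and x: "x \<in> elts c' A" for A x
  proof -
    obtain i z where i: "i \<in> Obj J" and z: "z \<in> elts (FObj D i) A" and kx: "app k A x = app (\<iota> i) A z"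
      using c A app_elts[OF k A x] unfolding pointwise_colimit_def by blast
    have "x = app h A (app k A x)" using app_Comp[OF k h A x] hk A x by simp
    also have "\<dots> = app (\<iota>' i) A z" using app_Comp[OF \<iota>h[OF i] h A z] h\<iota>[OF i] kx by simp
    finally show ?thesis using i z by blast
  qed
  moreover have "glued J D A (i, z) (j, w)"
    if A: "A \<in> Obj X" and i: "i \<in> Obj J" and j: "j \<in> Obj J" and z: "z \<in> elts (FObj D i) A"
      and w: "w \<in> elts (FObj D j) A" and eq: "app (\<iota>' i) A z = app (\<iota>' j) A w" for A i j z w
  proof -
    have "app (\<iota> i) A z = app (\<iota> j) A w"
      using app_Comp[OF \<iota>h'[OF i] k A z] app_Comp[OF \<iota>h'[OF j] k A w] k\<iota>[OF i] k\<iota>[OF j] eq by simp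
    then show ?thesis using c A i j z w unfolding pointwise_colimit_def by blast
  qed
  ultimately show ?thesis using \<iota>' unfolding pointwise_colimit_def by blast
qed

theorem cocomplete_PSh: "cocomplete_rcat TYPE('u) (PSh X)"
proof (rule PSh.cocomplete_rcatI[OF split_PSh])
  fix J :: "('u, 'u) cat" and D
  assume J: "small_category J" and D: "cat_functor J (Total (PSh X)) D"
  then obtain c \<iota> where c: "pointwise_colimit J D c \<iota>" using pointwise_colimit_exists by blast
  then show "\<exists>c t. colimit J (PSh X) D c t \<and> (\<forall>j \<in> Obj J. total_map (PSh X) (t j))"
    using pointwise_colimit_colimit[OF D c] pointwise_colimit_total by blast
qed

text \<open>
  Every colimit of a diagram of total maps of presheaves is pointwise, so it is preserved.
\<close>

theorem pointwise_Kan_cocontinuous: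
  assumes W: "pointwise_Kan E W"
  shows "cocontinuous_rfunctor TYPE('u) (PSh X) E W"
  using W pointwise_Kan_colimit_Total[OF W _ colimit_pointwise]
  unfolding cocontinuous_rfunctor_def preserves_Total_functor_iff
  by (simp add: pointwise_Kan_def)

text \<open>
  By density, every presheaf is the colimit in \<open>Total(PSh)\<close>, over its category of elements, of the
  splittings of the idempotents \<open>y e\<close> with \<open>e\<close> the domain of an element.  A cocontinuous functor
  preserves this colimit, and, like every functor, it preserves splittings; so it takes the presheaf
  to the weighted colimit.
\<close>

theorem cocontinuous_pointwise_Kan:
  assumes E: "cocomplete_rcat TYPE('u) E" and W: "cocontinuous_rfunctor TYPE('u) (PSh X) E W"
  shows "pointwise_Kan E W"
  unfolding pointwise_Kan_def
proof (intro conjI allI impI)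
  show W': "restriction_functor (PSh X) E W" using W by (simp add: cocontinuous_rfunctor_def)
  note WF = restriction_functorD(3)[OF W']
  interpret E: restriction_category E by (rule restriction_functorD(2)[OF W'])
  fix P assume P: "rpresheaf P"
  let ?F = "comp_functor X W (yoneda X)"
  obtain S m r where "element_splitting X (PSh X) (yoneda X) P S m r"
    using element_splitting_exists[OF restriction_functor_yoneda split_PSh P] by blast
  then interpret Y: element_splitting X "PSh X" "yoneda X" P S m r .
  have m: "m A x \<in> hom (PSh X) (S A x) (yo A)" and r: "r A x \<in> hom (PSh X) (yo A) (S A x)"
    if "A \<in> Obj X" "x \<in> elts P A" for A x
    using Y.m[OF that] Y.r[OF that] that by simp_all
  \<comment> \<open>the images under \<open>W\<close> of splittings of \<open>y e\<close> are splittings of \<open>W (y e)\<close>\<close>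
  interpret Z: element_splitting X E ?F P "\<lambda>A x. FObj W (S A x)" "\<lambda>A x. FArr W (m A x)" "\<lambda>A x. FArr W (r A x)"
  proof unfold_locales
    show "restriction_functor X E ?F" by (rule restriction_functor_comp[OF restriction_functor_yoneda W'])
    fix A x assume A: "A \<in> Obj X" and x: "x \<in> elts P A"
    show "FArr W (m A x) \<in> hom E (FObj W (S A x)) (FObj ?F A)"
      "FArr W (r A x) \<in> hom E (FObj ?F A) (FObj W (S A x))"
      using cat_functorD(6)[OF WF m[OF A x]] cat_functorD(6)[OF WF r[OF A x]] A by simp_all
    show "FArr W (m A x) \<cdot>\<^bsub>E\<^esub> FArr W (r A x) = FArr ?F (PRst P A x)"
      using cat_functorD(8)[OF WF r[OF A x] m[OF A x]] Y.mr[OF A x] PRst_hom[OF P A x] by (simp add: hom_iff)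
    show "FArr W (r A x) \<cdot>\<^bsub>E\<^esub> FArr W (m A x) = Ide E (FObj W (S A x))"
      using cat_functorD(8)[OF WF m[OF A x] r[OF A x]] Y.rm[OF A x]
        cat_functorD(7)[OF WF PSh.hom_Obj(1)[OF m[OF A x]]] by simp
  qed (fact P)
  define \<iota> where "\<iota> = (\<lambda>i. case unpair i of (A, x) \<Rightarrow> point P A x \<cdot>\<^bsub>PSh X\<^esub> m A x)"
  have c: "colimit (elements P) (Total (PSh X)) Y.diagram P \<iota>"
    unfolding \<iota>_def by (rule Y.weighted_imp_colimit[OF yoneda_dense[OF P]])
  have Z_diagram: "Z.diagram = comp_functor (elements P) W Y.diagram"
  proof (rule func.equality)
    have "FObj Z.diagram i = FObj W (FObj Y.diagram i)" if "i \<in> Obj (elements P)" for i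
      using that Z.diagram_Obj Y.diagram_Obj by auto
    then show "FObj Z.diagram = FObj (comp_functor (elements P) W Y.diagram)"
      by (intro extensionalityI[of _ "Obj (elements P)"]) (use cat_functorD(3,4)[OF Z.diagram] in \<open>simp_all add: comp_functor_def[of "elements P"]\<close>)
    have "FArr Z.diagram a = FArr W (FArr Y.diagram a)" if "a \<in> Arr (elements P)" for a
    proof -
      have "a \<in> hom (elements P) (Dom (elements P) a) (Cod (elements P) a)" using that by (simp add: hom_iff)
      then obtain f A B y where f: "f \<in> hom X A B" and y: "y \<in> elts P B" and a: "a = pair (f, y)"
        by (rule elements_homE)
      note A = hom_Obj(1)[OF f] and B = hom_Obj(2)[OF f] and x = act_elts[OF P f y]
      show ?thesis
        unfolding a Z.diagram_Arr[OF f y] Y.diagram_Arr[OF f y]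
        using cat_functorD(8)[OF WF m[OF A x] yoneda_hom[OF f]] f
          cat_functorD(8)[OF WF PSh_Comp_hom[OF m[OF A x] yoneda_hom[OF f]] r[OF B y]]
        by (simp add: hom_iff)
    qed
    then show "FArr Z.diagram = FArr (comp_functor (elements P) W Y.diagram)"
      by (intro extensionalityI[of _ "Arr (elements P)"]) (use cat_functorD(3,4)[OF Z.diagram] in \<open>simp_all add: comp_functor_def[of "elements P"]\<close>)
  qed simp
  have Wc: "colimit (elements P) (Total E) Z.diagram (FObj W P) (\<lambda>i. FArr W (\<iota> i))"
    using W c small_elements[OF P] Y.diagram
    unfolding cocontinuous_rfunctor_def preserves_Total_functor_iff Z_diagram by blast
  then have "cocone (elements P) (Total E) Z.diagram (FObj W P) (\<lambda>i. FArr W (\<iota> i))"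
    by (simp add: colimit_def)
  then have tot: "total_map E (FArr W (\<iota> i))" if "i \<in> Obj (elements P)" for i
    using coconeD(2) that by (metis hom_Total)
  have "FArr W (\<iota> (pair (A, x))) \<cdot>\<^bsub>E\<^esub> FArr W (r A x) = FArr W (point P A x)"
    if A: "A \<in> Obj X" and x: "x \<in> elts P A" for A x
  proof -
    note p = point_hom[OF P A x]
    have "point P A x \<cdot>\<^bsub>PSh X\<^esub> m A x \<cdot>\<^bsub>PSh X\<^esub> r A x = point P A x"
      using PSh.Comp_assoc[OF r[OF A x] m[OF A x] p] Y.mr[OF A x] Rst_point[OF P A x] PSh.R1[OF p] by simp
    then show ?thesis
      using cat_functorD(8)[OF WF r[OF A x] PSh_Comp_hom[OF m[OF A x] p]] by (simp add: \<iota>_def)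
  qed
  then show "weighted_colimit ?F E P (FObj W P) (\<lambda>A x. FArr W (point P A x))"
    by (rule weighted_colimit_cong[OF _ P Z.colimit_imp_weighted[OF
        cocomplete_rcatD(4)[OF E small_elements[OF P] Z.diagram Wc] tot]])
qed

end

section \<open>Categories of restriction functors\<close>

lemma restriction_transD:
  assumes "restriction_trans X Y F G t"
  shows "restriction_functor X Y F" and "restriction_functor X Y G" and "nat_trans X Y F G t"
    and "A \<in> Obj X \<Longrightarrow> total_map Y (t A)"
    and "t \<in> extensional (Obj X)"
    and "A \<in> Obj X \<Longrightarrow> t A \<in> hom Y (FObj F A) (FObj G A)"
    and "f \<in> hom X A B \<Longrightarrow> t B \<cdot>\<^bsub>Y\<^esub> FArr F f = FArr G f \<cdot>\<^bsub>Y\<^esub> t A"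
  using assms nat_transD[of X Y F G t] by (auto simp: restriction_trans_def)

lemma restriction_transI:
  assumes F: "restriction_functor X Y F" and G: "restriction_functor X Y G"
    and "t \<in> extensional (Obj X)"
    and "\<And>A. A \<in> Obj X \<Longrightarrow> t A \<in> hom Y (FObj F A) (FObj G A)"
    and "\<And>f A B. f \<in> hom X A B \<Longrightarrow> t B \<cdot>\<^bsub>Y\<^esub> FArr F f = FArr G f \<cdot>\<^bsub>Y\<^esub> t A"
    and "\<And>A. A \<in> Obj X \<Longrightarrow> total_map Y (t A)"
  shows "restriction_trans X Y F G t"
  unfolding restriction_trans_def
  using assms nat_transI[OF restriction_functorD(3)[OF F] restriction_functorD(3)[OF G], of t] by blast

lemma rCat_simps [simp]:
  "F \<in> Obj (rCat X Y) \<longleftrightarrow> restriction_functor X Y F"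
  "Dom (rCat X Y) = Src" "Cod (rCat X Y) = Tgt" "Comp (rCat X Y) = trans_comp X Y"
  "Ide (rCat X Y) F = \<lparr>Src = F, Tgt = F, Cmp = (\<lambda>A \<in> Obj X. Ide Y (FObj F A))\<rparr>"
  by (simp_all add: rCat_def)

lemma rCat_hom:
  "\<alpha> \<in> hom (rCat X Y) F G \<longleftrightarrow>
     Src \<alpha> = F \<and> Tgt \<alpha> = G \<and> restriction_trans X Y F G (Cmp \<alpha>)"
  by (auto simp: hom_def rCat_def)

lemma rCat_eqI:
  assumes \<alpha>: "\<alpha> \<in> hom (rCat X Y) F G" and \<beta>: "\<beta> \<in> hom (rCat X Y) F G"
    and eq: "\<And>A. A \<in> Obj X \<Longrightarrow> Cmp \<alpha> A = Cmp \<beta> A"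
  shows "\<alpha> = \<beta>"
proof (rule trans.equality)
  show "Cmp \<alpha> = Cmp \<beta>"
    by (rule extensionalityI[of _ "Obj X"]) (use \<alpha> \<beta> eq restriction_transD(5) in \<open>auto simp: rCat_hom\<close>)
qed (use \<alpha> \<beta> in \<open>auto simp: rCat_hom\<close>)

lemma Cmp_trans_comp [simp]: "A \<in> Obj X \<Longrightarrow> Cmp (trans_comp X Y \<beta> \<alpha>) A = Cmp \<beta> A \<cdot>\<^bsub>Y\<^esub> Cmp \<alpha> A"
  by (simp add: trans_comp_def)

lemma rCat_Comp_hom:
  assumes \<alpha>: "\<alpha> \<in> hom (rCat X Y) F G" and \<beta>: "\<beta> \<in> hom (rCat X Y) G H"
  shows "trans_comp X Y \<beta> \<alpha> \<in> hom (rCat X Y) F H"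
proof -
  have a: "restriction_trans X Y F G (Cmp \<alpha>)" and b: "restriction_trans X Y G H (Cmp \<beta>)"
    using assms by (simp_all add: rCat_hom)
  interpret X: restriction_category X by (rule restriction_functorD(1)[OF restriction_transD(1)[OF a]])
  interpret Y: restriction_category Y by (rule restriction_functorD(2)[OF restriction_transD(1)[OF a]])
  note F = restriction_functorD(3)[OF restriction_transD(1)[OF a]]
  note G = restriction_functorD(3)[OF restriction_transD(1)[OF b]]
  note H = restriction_functorD(3)[OF restriction_transD(2)[OF b]]
  note ah = restriction_transD(6)[OF a] and bh = restriction_transD(6)[OF b]
  have "restriction_trans X Y F H (\<lambda>A \<in> Obj X. Cmp \<beta> A \<cdot>\<^bsub>Y\<^esub> Cmp \<alpha> A)"
  proof (rule restriction_transI)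
    fix f A B assume f: "f \<in> hom X A B"
    note A = X.hom_Obj(1)[OF f] and B = X.hom_Obj(2)[OF f]
    have "Cmp \<beta> B \<cdot>\<^bsub>Y\<^esub> Cmp \<alpha> B \<cdot>\<^bsub>Y\<^esub> FArr F f = Cmp \<beta> B \<cdot>\<^bsub>Y\<^esub> (FArr G f \<cdot>\<^bsub>Y\<^esub> Cmp \<alpha> A)"
      using Y.Comp_assoc[OF cat_functorD(6)[OF F f] ah[OF B] bh[OF B]] restriction_transD(7)[OF a f] by simp
    also have "\<dots> = FArr H f \<cdot>\<^bsub>Y\<^esub> (Cmp \<beta> A \<cdot>\<^bsub>Y\<^esub> Cmp \<alpha> A)"
      using Y.Comp_assoc[OF ah[OF A] cat_functorD(6)[OF G f] bh[OF B]] restriction_transD(7)[OF b f]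
        Y.Comp_assoc[OF ah[OF A] bh[OF A] cat_functorD(6)[OF H f]] by simp
    finally show "(\<lambda>A \<in> Obj X. Cmp \<beta> A \<cdot>\<^bsub>Y\<^esub> Cmp \<alpha> A) B \<cdot>\<^bsub>Y\<^esub> FArr F f
        = FArr H f \<cdot>\<^bsub>Y\<^esub> (\<lambda>A \<in> Obj X. Cmp \<beta> A \<cdot>\<^bsub>Y\<^esub> Cmp \<alpha> A) A" using A B by simp
  qed (use restriction_transD(1)[OF a] restriction_transD(2)[OF b] Y.Comp_hom[OF ah bh]
      Y.total_Comp[OF ah bh restriction_transD(4)[OF a] restriction_transD(4)[OF b]] in auto)
  then show ?thesis using assms by (simp add: rCat_hom trans_comp_def)
qed

lemma rCat_Ide_hom:
  assumes F: "restriction_functor X Y F"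
  shows "Ide (rCat X Y) F \<in> hom (rCat X Y) F F"
proof -
  interpret X: restriction_category X by (rule restriction_functorD(1)[OF F])
  interpret Y: restriction_category Y by (rule restriction_functorD(2)[OF F])
  note FF = restriction_functorD(3)[OF F]
  have "restriction_trans X Y F F (\<lambda>A \<in> Obj X. Ide Y (FObj F A))"
  proof (rule restriction_transI)
    fix f A B assume f: "f \<in> hom X A B"
    show "(\<lambda>A \<in> Obj X. Ide Y (FObj F A)) B \<cdot>\<^bsub>Y\<^esub> FArr F f
        = FArr F f \<cdot>\<^bsub>Y\<^esub> (\<lambda>A \<in> Obj X. Ide Y (FObj F A)) A"
      using Y.Ide_Comp[OF cat_functorD(6)[OF FF f]] Y.Comp_Ide[OF cat_functorD(6)[OF FF f]]
        X.hom_Obj[OF f] by simp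
  qed (use F Y.Ide_hom Y.total_Ide cat_functorD(5)[OF FF] in auto)
  then show ?thesis by (simp add: rCat_hom)
qed

lemma category_rCat:
  assumes X: "restriction_category X" and Y: "restriction_category Y"
  shows "category (rCat X Y)"
proof -
  interpret X: restriction_category X by fact
  interpret Y: restriction_category Y by fact
  have Cmp_h: "Cmp \<alpha> A \<in> hom Y (FObj F A) (FObj G A)"
    if "\<alpha> \<in> hom (rCat X Y) F G" "A \<in> Obj X" for \<alpha> A F G
    using that restriction_transD(6) by (auto simp: rCat_hom)
  show ?thesis
  proof unfold_locales
    fix \<alpha> assume "\<alpha> \<in> Arr (rCat X Y)"
    then show "Dom (rCat X Y) \<alpha> \<in> Obj (rCat X Y)" "Cod (rCat X Y) \<alpha> \<in> Obj (rCat X Y)"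
      using restriction_transD(1,2) by (auto simp: rCat_def)
  next
    show "Ide (rCat X Y) F \<in> hom (rCat X Y) F F" if "F \<in> Obj (rCat X Y)" for F
      using rCat_Ide_hom that by (simp only: rCat_simps(1))
    show "\<beta> \<cdot>\<^bsub>rCat X Y\<^esub> \<alpha> \<in> hom (rCat X Y) F H"
      if "\<alpha> \<in> hom (rCat X Y) F G" "\<beta> \<in> hom (rCat X Y) G H" for \<alpha> \<beta> F G H
      using rCat_Comp_hom[OF that] by simp
  next
    fix \<alpha> F G assume \<alpha>: "\<alpha> \<in> hom (rCat X Y) F G"
    then have FG: "restriction_functor X Y F" "restriction_functor X Y G"
      using restriction_transD(1,2) by (auto simp: rCat_hom)
    show "\<alpha> \<cdot>\<^bsub>rCat X Y\<^esub> Ide (rCat X Y) F = \<alpha>"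
      unfolding rCat_simps(4)
      by (rule rCat_eqI[OF rCat_Comp_hom[OF rCat_Ide_hom[OF FG(1)] \<alpha>] \<alpha>])
         (use Y.Comp_Ide[OF Cmp_h[OF \<alpha>]] in simp)
    show "Ide (rCat X Y) G \<cdot>\<^bsub>rCat X Y\<^esub> \<alpha> = \<alpha>"
      unfolding rCat_simps(4)
      by (rule rCat_eqI[OF rCat_Comp_hom[OF \<alpha> rCat_Ide_hom[OF FG(2)]] \<alpha>])
         (use Y.Ide_Comp[OF Cmp_h[OF \<alpha>]] in simp)
  next
    fix \<alpha> \<beta> \<gamma> F G H K
    assume \<alpha>: "\<alpha> \<in> hom (rCat X Y) F G" and \<beta>: "\<beta> \<in> hom (rCat X Y) G H" and \<gamma>: "\<gamma> \<in> hom (rCat X Y) H K"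
    show "\<gamma> \<cdot>\<^bsub>rCat X Y\<^esub> (\<beta> \<cdot>\<^bsub>rCat X Y\<^esub> \<alpha>) = \<gamma> \<cdot>\<^bsub>rCat X Y\<^esub> \<beta> \<cdot>\<^bsub>rCat X Y\<^esub> \<alpha>"
      unfolding rCat_simps(4)
      by (rule rCat_eqI[OF rCat_Comp_hom[OF rCat_Comp_hom[OF \<alpha> \<beta>] \<gamma>] rCat_Comp_hom[OF \<alpha> rCat_Comp_hom[OF \<beta> \<gamma>]]])
         (use Y.Comp_assoc[OF Cmp_h[OF \<alpha>] Cmp_h[OF \<beta>] Cmp_h[OF \<gamma>]] in simp)
  qed
qed

text \<open>
  Componentwise inverses of a natural family are natural, and both families are total because
  isomorphisms are.
\<close>

lemma rCat_isoI:
  assumes F: "restriction_functor X Y F" and G: "restriction_functor X Y G"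
    and t: "\<And>A. A \<in> Obj X \<Longrightarrow> t A \<in> hom Y (FObj F A) (FObj G A)"
    and s: "\<And>A. A \<in> Obj X \<Longrightarrow> s A \<in> hom Y (FObj G A) (FObj F A)"
    and st: "\<And>A. A \<in> Obj X \<Longrightarrow> s A \<cdot>\<^bsub>Y\<^esub> t A = Ide Y (FObj F A)"
    and ts: "\<And>A. A \<in> Obj X \<Longrightarrow> t A \<cdot>\<^bsub>Y\<^esub> s A = Ide Y (FObj G A)"
    and nat: "\<And>f A B. f \<in> hom X A B \<Longrightarrow> t B \<cdot>\<^bsub>Y\<^esub> FArr F f = FArr G f \<cdot>\<^bsub>Y\<^esub> t A"
  shows "\<exists>k \<in> hom (rCat X Y) G F. iso (rCat X Y) k"
proof -
  interpret X: restriction_category X by (rule restriction_functorD(1)[OF F])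
  interpret Y: restriction_category Y by (rule restriction_functorD(2)[OF F])
  note FF = restriction_functorD(3)[OF F] and GG = restriction_functorD(3)[OF G]
  let ?\<tau> = "\<lparr>Src = F, Tgt = G, Cmp = (\<lambda>A \<in> Obj X. t A)\<rparr>"
  let ?\<sigma> = "\<lparr>Src = G, Tgt = F, Cmp = (\<lambda>A \<in> Obj X. s A)\<rparr>"
  have "restriction_trans X Y F G (\<lambda>A \<in> Obj X. t A)"
    by (rule restriction_transI) (use F G t nat X.hom_Obj Y.total_section[OF t s st] in auto)
  then have \<tau>: "?\<tau> \<in> hom (rCat X Y) F G" by (simp add: rCat_hom)
  have "s B \<cdot>\<^bsub>Y\<^esub> FArr G f = FArr F f \<cdot>\<^bsub>Y\<^esub> s A" if f: "f \<in> hom X A B" for f A B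
  proof -
    note A = X.hom_Obj(1)[OF f] and B = X.hom_Obj(2)[OF f]
    note Ff = cat_functorD(6)[OF FF f] and Gf = cat_functorD(6)[OF GG f]
    have "s B \<cdot>\<^bsub>Y\<^esub> FArr G f = s B \<cdot>\<^bsub>Y\<^esub> (FArr G f \<cdot>\<^bsub>Y\<^esub> (t A \<cdot>\<^bsub>Y\<^esub> s A))"
      using ts[OF A] Y.Comp_Ide[OF Gf] by simp
    also have "\<dots> = s B \<cdot>\<^bsub>Y\<^esub> (t B \<cdot>\<^bsub>Y\<^esub> (FArr F f \<cdot>\<^bsub>Y\<^esub> s A))"
      using Y.Comp_assoc[OF s[OF A] t[OF A] Gf] Y.Comp_assoc[OF s[OF A] Ff t[OF B]] nat[OF f] by simp
    also have "\<dots> = FArr F f \<cdot>\<^bsub>Y\<^esub> s A"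
      using Y.Comp_assoc[OF Y.Comp_hom[OF s[OF A] Ff] t[OF B] s[OF B]] st[OF B]
        Y.Ide_Comp[OF Y.Comp_hom[OF s[OF A] Ff]] by simp
    finally show ?thesis .
  qed
  then have "restriction_trans X Y G F (\<lambda>A \<in> Obj X. s A)"
    by (intro restriction_transI) (use F G s X.hom_Obj Y.total_section[OF s t ts] in auto)
  then have \<sigma>: "?\<sigma> \<in> hom (rCat X Y) G F" by (simp add: rCat_hom)
  have "?\<tau> \<cdot>\<^bsub>rCat X Y\<^esub> ?\<sigma> = Ide (rCat X Y) G" "?\<sigma> \<cdot>\<^bsub>rCat X Y\<^esub> ?\<tau> = Ide (rCat X Y) F"
    using st ts by (auto simp: trans_comp_def fun_eq_iff restrict_def)
  then show ?thesis using isoI[OF \<sigma> \<tau>] \<sigma> by blast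
qed

lemma rCocomp_simps [simp]:
  "F \<in> Obj (rCocomp U Y Z) \<longleftrightarrow> cocontinuous_rfunctor U Y Z F"
  "Dom (rCocomp U Y Z) = Src" "Cod (rCocomp U Y Z) = Tgt" "Comp (rCocomp U Y Z) = trans_comp Y Z"
  "Ide (rCocomp U Y Z) = Ide (rCat Y Z)"
  by (simp_all add: rCocomp_def rCat_def)

lemma rCocomp_hom:
  "\<alpha> \<in> hom (rCocomp U Y Z) F G \<longleftrightarrow>
     \<alpha> \<in> hom (rCat Y Z) F G \<and> cocontinuous_rfunctor U Y Z F \<and> cocontinuous_rfunctor U Y Z G"
  by (auto simp: hom_def rCocomp_def rCat_def)

lemma category_rCocomp:
  assumes "restriction_category Y" and "restriction_category Z"
  shows "category (rCocomp U Y Z)"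
proof -
  interpret R: category "rCat Y Z" by (rule category_rCat[OF assms])
  show ?thesis
  proof unfold_locales
    fix \<alpha> assume "\<alpha> \<in> Arr (rCocomp U Y Z)"
    then show "Dom (rCocomp U Y Z) \<alpha> \<in> Obj (rCocomp U Y Z)" "Cod (rCocomp U Y Z) \<alpha> \<in> Obj (rCocomp U Y Z)"
      unfolding rCocomp_simps by (simp_all add: rCocomp_def)
  next
    show "Ide (rCocomp U Y Z) F \<in> hom (rCocomp U Y Z) F F" if "F \<in> Obj (rCocomp U Y Z)" for F
      using that rCat_Ide_hom[of Y Z F] unfolding rCocomp_simps rCocomp_hom
      by (simp only: cocontinuous_rfunctor_def)
  qed (use R.Comp_hom R.Comp_Ide R.Ide_Comp R.Comp_assoc in \<open>auto simp: rCocomp_hom simp del: rCat_simps(5)\<close>)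
qed

lemma cat_functor_precomp:
  assumes K: "restriction_functor X Y K" and Z: "restriction_category Z"
  shows "cat_functor (rCocomp U Y Z) (rCat X Z) (precomp X K (rCocomp U Y Z))"
proof (rule cat_functorI)
  interpret X: restriction_category X by (rule restriction_functorD(1)[OF K])
  note Y = restriction_functorD(2)[OF K]
  note KF = restriction_functorD(3)[OF K]
  let ?C = "rCocomp U Y Z" let ?P = "precomp X K ?C"
  show "category ?C" by (rule category_rCocomp[OF Y Z])
  then interpret C: category ?C .
  show "category (rCat X Z)" by (rule category_rCat[OF restriction_functorD(1)[OF K] Z])
  show "FObj ?P \<in> extensional (Obj ?C)" "FArr ?P \<in> extensional (Arr ?C)" by (simp_all add: precomp_def)
  have PO: "FObj ?P F = comp_functor X F K" if "F \<in> Obj ?C" for F using that by (simp add: precomp_def)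
  have PA: "FArr ?P \<alpha> = \<lparr>Src = comp_functor X F K, Tgt = comp_functor X G K,
              Cmp = (\<lambda>A \<in> Obj X. Cmp \<alpha> (FObj K A))\<rparr>" if "\<alpha> \<in> hom ?C F G" for \<alpha> F G
    using that by (auto simp: precomp_def hom_iff)
  show "FObj ?P F \<in> Obj (rCat X Z)" if F: "F \<in> Obj ?C" for F
    using restriction_functor_comp[OF K, of Z F] F PO[OF F] by (simp add: cocontinuous_rfunctor_def)
  show "FArr ?P \<alpha> \<in> hom (rCat X Z) (FObj ?P F) (FObj ?P G)" if \<alpha>: "\<alpha> \<in> hom ?C F G" for \<alpha> F G
  proof -
    have a: "restriction_trans Y Z F G (Cmp \<alpha>)" using \<alpha> by (simp add: rCocomp_hom rCat_hom)
    have "restriction_trans X Z (comp_functor X F K) (comp_functor X G K) (\<lambda>A \<in> Obj X. Cmp \<alpha> (FObj K A))"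
    proof (rule restriction_transI)
      fix f A B assume f: "f \<in> hom X A B"
      show "(\<lambda>A \<in> Obj X. Cmp \<alpha> (FObj K A)) B \<cdot>\<^bsub>Z\<^esub> FArr (comp_functor X F K) f
          = FArr (comp_functor X G K) f \<cdot>\<^bsub>Z\<^esub> (\<lambda>A \<in> Obj X. Cmp \<alpha> (FObj K A)) A"
        using restriction_transD(7)[OF a cat_functorD(6)[OF KF f]] X.hom_Obj[OF f] f by (simp add: hom_iff)
    qed (use restriction_functor_comp[OF K] restriction_transD[OF a] cat_functorD(5)[OF KF] in auto)
    then show ?thesis using PA[OF \<alpha>] PO C.hom_Obj[OF \<alpha>] by (simp add: rCat_hom)
  qed
  show "FArr ?P (Ide ?C F) = Ide (rCat X Z) (FObj ?P F)" if F: "F \<in> Obj ?C" for F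
    using PA[OF C.Ide_hom[OF F]] PO[OF F] cat_functorD(5)[OF KF] by (auto simp: restrict_def fun_eq_iff)
  show "FArr ?P (\<beta> \<cdot>\<^bsub>?C\<^esub> \<alpha>) = FArr ?P \<beta> \<cdot>\<^bsub>rCat X Z\<^esub> FArr ?P \<alpha>"
    if \<alpha>: "\<alpha> \<in> hom ?C F G" and \<beta>: "\<beta> \<in> hom ?C G H" for \<alpha> \<beta> F G H
    using PA[OF C.Comp_hom[OF \<alpha> \<beta>]] PA[OF \<alpha>] PA[OF \<beta>] cat_functorD(5)[OF KF]
    by (auto simp: trans_comp_def restrict_def fun_eq_iff)
qed


section \<open>The universal property\<close>

context small_restriction_category
begin

text \<open>
  Naturality at the points of \<open>P\<close> expresses the composites of the component at \<open>P\<close> with the legs of a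
  weighted colimit through the components at representables.
\<close>

lemma pointwise_Kan_trans_eq:
  assumes G: "pointwise_Kan E G"
    and \<beta>: "\<beta> \<in> hom (rCat (PSh X) E) G H" and \<beta>': "\<beta>' \<in> hom (rCat (PSh X) E) G H"
    and eq: "\<And>A. A \<in> Obj X \<Longrightarrow> Cmp \<beta> (yo A) = Cmp \<beta>' (yo A)"
  shows "\<beta> = \<beta>'"
proof (rule rCat_eqI[OF \<beta> \<beta>'])
  have b: "restriction_trans (PSh X) E G H (Cmp \<beta>)" and b': "restriction_trans (PSh X) E G H (Cmp \<beta>')"
    using \<beta> \<beta>' by (simp_all add: rCat_hom)
  fix P assume PO: "P \<in> Obj (PSh X)"
  then have P: "rpresheaf P" by simp
  have wc: "weighted_colimit (comp_functor X G (yoneda X)) E P (FObj G P) (\<lambda>A x. FArr G (point P A x))"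
    using G P by (simp add: pointwise_Kan_def)
  show "Cmp \<beta> P = Cmp \<beta>' P"
  proof (rule weighted_colimit_eqI[OF wc restriction_functor_comp[OF restriction_functor_yoneda restriction_transD(1)[OF b]] P
        restriction_transD(6)[OF b PO] restriction_transD(6)[OF b' PO]])
    fix A x assume A: "A \<in> Obj X" and x: "x \<in> elts P A"
    show "Cmp \<beta> P \<cdot>\<^bsub>E\<^esub> FArr G (point P A x) = Cmp \<beta>' P \<cdot>\<^bsub>E\<^esub> FArr G (point P A x)"
      using restriction_transD(7)[OF b point_hom[OF P A x]] restriction_transD(7)[OF b' point_hom[OF P A x]]
        eq[OF A] by simp
  qed
qed

text \<open>
  The component at \<open>P\<close> is determined by its composites with the legs, and these can be prescribed, since the composites of \<open>\<alpha>\<close> with the images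
  of the points under \<open>H\<close> form a weighted cocone.
\<close>

lemma pointwise_Kan_trans_exists:
  assumes G: "pointwise_Kan E G" and H: "restriction_functor (PSh X) E H"
    and \<alpha>: "restriction_trans X E (comp_functor X G (yoneda X)) (comp_functor X H (yoneda X)) \<alpha>"
  shows "\<exists>\<beta>. restriction_trans (PSh X) E G H \<beta> \<and> (\<forall>A \<in> Obj X. \<beta> (yo A) = \<alpha> A)"
proof -
  let ?Gy = "comp_functor X G (yoneda X)" and ?Hy = "comp_functor X H (yoneda X)"
  have G': "restriction_functor (PSh X) E G" using G by (simp add: pointwise_Kan_def)
  interpret E: restriction_category E by (rule restriction_functorD(2)[OF G'])
  note GF = restriction_functorD(3)[OF G'] and HF = restriction_functorD(3)[OF H]
  note Gy = restriction_transD(1)[OF \<alpha>] and Hy = restriction_transD(2)[OF \<alpha>]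
  note GyF = restriction_functorD(3)[OF Gy] and HyF = restriction_functorD(3)[OF Hy]
  have wc: "weighted_colimit ?Gy E P (FObj G P) (\<lambda>A x. FArr G (point P A x))" if "rpresheaf P" for P
    using G that by (simp add: pointwise_Kan_def)
  note Gc = point_weighted_cocone[OF G'] and Hc = point_weighted_cocone[OF H]
  note \<alpha>h = restriction_transD(6)[OF \<alpha>]
  have "weighted_cocone ?Gy E P (FObj H P) (\<lambda>A x. FArr H (point P A x) \<cdot>\<^bsub>E\<^esub> \<alpha> A)" if P: "rpresheaf P" for P
  proof (rule weighted_coconeI)
    note Hp = weighted_coconeD(2)[OF Hc[OF P]]
    show "FObj H P \<in> Obj E" by (rule weighted_coconeD(1)[OF Hc[OF P]])
    show "FArr H (point P A x) \<cdot>\<^bsub>E\<^esub> \<alpha> A \<in> hom E (FObj ?Gy A) (FObj H P)"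
      if "A \<in> Obj X" "x \<in> elts P A" for A x
      using E.Comp_hom[OF \<alpha>h[OF that(1)] Hp[OF that]] .
    fix f A B y assume f: "f \<in> hom X A B" and y: "y \<in> elts P B"
    note A = hom_Obj(1)[OF f] and B = hom_Obj(2)[OF f]
    have "FArr H (point P B y) \<cdot>\<^bsub>E\<^esub> \<alpha> B \<cdot>\<^bsub>E\<^esub> FArr ?Gy f
        = FArr H (point P B y) \<cdot>\<^bsub>E\<^esub> (FArr ?Hy f \<cdot>\<^bsub>E\<^esub> \<alpha> A)"
      using E.Comp_assoc[OF cat_functorD(6)[OF GyF f] \<alpha>h[OF B] Hp[OF B y]] restriction_transD(7)[OF \<alpha> f] by simp
    also have "\<dots> = FArr H (point P A (act P y f)) \<cdot>\<^bsub>E\<^esub> \<alpha> A"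
      using E.Comp_assoc[OF \<alpha>h[OF A] cat_functorD(6)[OF HyF f] Hp[OF B y]]
        weighted_coconeD(3)[OF Hc[OF P] f y] by simp
    finally show "FArr H (point P B y) \<cdot>\<^bsub>E\<^esub> \<alpha> B \<cdot>\<^bsub>E\<^esub> FArr ?Gy f
        = FArr H (point P A (act P y f)) \<cdot>\<^bsub>E\<^esub> \<alpha> A" .
  qed
  then have "\<exists>b. b \<in> hom E (FObj G P) (FObj H P) \<and> (\<forall>A \<in> Obj X. \<forall>x \<in> elts P A.
      b \<cdot>\<^bsub>E\<^esub> FArr G (point P A x) = FArr H (point P A x) \<cdot>\<^bsub>E\<^esub> \<alpha> A)" if "rpresheaf P" for P
    using weighted_colimit_factor[OF wc[OF that]] that by (metis (no_types, lifting))
  then obtain b where b: "\<And>P. rpresheaf P \<Longrightarrow> b P \<in> hom E (FObj G P) (FObj H P)"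
    and bp: "\<And>P A x. \<lbrakk>rpresheaf P; A \<in> Obj X; x \<in> elts P A\<rbrakk> \<Longrightarrow>
               b P \<cdot>\<^bsub>E\<^esub> FArr G (point P A x) = FArr H (point P A x) \<cdot>\<^bsub>E\<^esub> \<alpha> A"
    by metis
  \<comment> \<open>the composite of \<open>b P\<close> with the leg at \<open>x\<close> is still defined on the whole domain of \<open>x\<close>, because
    \<open>\<alpha>\<close> is total, so the restriction of \<open>b P\<close> does not affect the legs\<close>
  have b_total: "total_map E (b P)" if P: "rpresheaf P" for P
  proof -
    have "Rst E (b P) = Ide E (FObj G P)"
    proof (rule weighted_colimit_eqI[OF wc[OF P] Gy P E.Rst_hom[OF b[OF P]] E.Ide_hom[OF E.hom_Obj(1)[OF b[OF P]]]])
      fix A x assume A: "A \<in> Obj X" and x: "x \<in> elts P A"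
      note p = weighted_coconeD(2)[OF Gc[OF P] A x] and q = weighted_coconeD(2)[OF Hc[OF P] A x]
      note e = PRst_hom[OF P A x]
      note Ge = cat_functorD(6)[OF GyF e]
      have "Rst E (FArr H (point P A x) \<cdot>\<^bsub>E\<^esub> \<alpha> A) = Rst E (FArr ?Hy (PRst P A x) \<cdot>\<^bsub>E\<^esub> \<alpha> A)"
        using E.Rst_Comp_Rst[OF \<alpha>h[OF A] q] Rst_W_point[OF H P A x] by simp
      also have "\<dots> = Rst E (FArr ?Gy (PRst P A x))"
        using restriction_transD(7)[OF \<alpha> e] E.Rst_total_Comp[OF Ge \<alpha>h[OF A] restriction_transD(4)[OF \<alpha> A]] by simp
      also have "\<dots> = FArr ?Gy (PRst P A x)"
        using restriction_functorD(4)[OF Gy e] Rst_PRst[OF P A x] by simp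
      finally have "Rst E (b P) \<cdot>\<^bsub>E\<^esub> FArr G (point P A x) = FArr G (point P A x) \<cdot>\<^bsub>E\<^esub> FArr ?Gy (PRst P A x)"
        using E.R4[OF p b[OF P]] bp[OF P A x] by simp
      then show "Rst E (b P) \<cdot>\<^bsub>E\<^esub> FArr G (point P A x) = Ide E (FObj G P) \<cdot>\<^bsub>E\<^esub> FArr G (point P A x)"
        using weighted_cocone_PRst[OF Gc[OF P] P A x] E.Ide_Comp[OF p] by simp
    qed
    then show ?thesis using E.total_map_iff[OF b[OF P]] by simp
  qed
  have "restriction_trans (PSh X) E G H (\<lambda>P \<in> Obj (PSh X). b P)"
  proof (rule restriction_transI)
    fix \<theta> P Q assume \<theta>: "\<theta> \<in> hom (PSh X) P Q"
    note P = PSh_homD(1)[OF \<theta>] and Q = PSh_homD(2)[OF \<theta>]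
    note G\<theta> = cat_functorD(6)[OF GF \<theta>] and H\<theta> = cat_functorD(6)[OF HF \<theta>]
    have "b Q \<cdot>\<^bsub>E\<^esub> FArr G \<theta> = FArr H \<theta> \<cdot>\<^bsub>E\<^esub> b P"
    proof (rule weighted_colimit_eqI[OF wc[OF P] Gy P E.Comp_hom[OF G\<theta> b[OF Q]] E.Comp_hom[OF b[OF P] H\<theta>]])
      fix A x assume A: "A \<in> Obj X" and x: "x \<in> elts P A"
      note p = weighted_coconeD(2)[OF Gc[OF P] A x] and q = weighted_coconeD(2)[OF Hc[OF P] A x]
      note \<theta>x = app_elts[OF \<theta> A x]
      have "b Q \<cdot>\<^bsub>E\<^esub> FArr G \<theta> \<cdot>\<^bsub>E\<^esub> FArr G (point P A x) = b Q \<cdot>\<^bsub>E\<^esub> FArr G (point Q A (app \<theta> A x))"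
        using E.Comp_assoc[OF p G\<theta> b[OF Q]] cat_functorD(8)[OF GF point_hom[OF P A x] \<theta>] Comp_point[OF \<theta> A x] by simp
      also have "\<dots> = FArr H \<theta> \<cdot>\<^bsub>E\<^esub> FArr H (point P A x) \<cdot>\<^bsub>E\<^esub> \<alpha> A"
        using bp[OF Q A \<theta>x] cat_functorD(8)[OF HF point_hom[OF P A x] \<theta>] Comp_point[OF \<theta> A x] by simp
      also have "\<dots> = FArr H \<theta> \<cdot>\<^bsub>E\<^esub> b P \<cdot>\<^bsub>E\<^esub> FArr G (point P A x)"
        using E.Comp_assoc[OF \<alpha>h[OF A] q H\<theta>] bp[OF P A x] E.Comp_assoc[OF p b[OF P] H\<theta>] by simp
      finally show "b Q \<cdot>\<^bsub>E\<^esub> FArr G \<theta> \<cdot>\<^bsub>E\<^esub> FArr G (point P A x)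
          = FArr H \<theta> \<cdot>\<^bsub>E\<^esub> b P \<cdot>\<^bsub>E\<^esub> FArr G (point P A x)" .
    qed
    then show "(\<lambda>P \<in> Obj (PSh X). b P) Q \<cdot>\<^bsub>E\<^esub> FArr G \<theta> = FArr H \<theta> \<cdot>\<^bsub>E\<^esub> (\<lambda>P \<in> Obj (PSh X). b P) P"
      using P Q by simp
  qed (use G' H b b_total in auto)
  moreover have "b (yo A) = \<alpha> A" if A: "A \<in> Obj X" for A
  proof -
    have IA: "Ide X A \<in> elts (yo A) A" using Ide_hom[OF A] A by simp
    have "\<alpha> A \<in> hom E (FObj G (yo A)) (FObj H (yo A))" using \<alpha>h[OF A] A by simp
    then show ?thesis
      using bp[OF rpresheaf_yo A IA] point_Ide[OF A] cat_functorD(7)[OF GF, of "yo A"]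
        cat_functorD(7)[OF HF, of "yo A"] rpresheaf_yo E.Comp_Ide[OF b[OF rpresheaf_yo]] E.Ide_Comp by simp
  qed
  ultimately show ?thesis using rpresheaf_yo by (intro exI[of _ "\<lambda>P \<in> Obj (PSh X). b P"]) simp
qed

text \<open>
  The extension of \<open>F\<close> sends \<open>P\<close> to the colimit of \<open>F\<close> weighted by \<open>P\<close>.  The leg at the identity
  of \<open>A\<close> identifies \<open>F A\<close> with the value of the extension at the representable \<open>y A\<close>.
\<close>

lemma pointwise_Kan_exists:
  assumes E: "cocomplete_rcat TYPE('u) E" and F: "restriction_functor X E F"
  shows "\<exists>W. pointwise_Kan E W \<and>
           (\<exists>k \<in> hom (rCat X E) (comp_functor X W (yoneda X)) F. iso (rCat X E) k)"
proof -
  interpret E: restriction_category E by (rule restriction_functorD(2)[OF F])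
  note FF = restriction_functorD(3)[OF F]
  obtain L t where wc: "\<And>P. rpresheaf P \<Longrightarrow> weighted_colimit F E P (L P) (t P)"
    using weighted_colimit_exists[OF F E] by metis
  note tc = weighted_colimitD(1)[OF wc]
  note th = weighted_coconeD(2)[OF tc]
  note t_act = weighted_coconeD(3)[OF tc]
  have LO: "L P \<in> Obj E" if "rpresheaf P" for P using weighted_coconeD(1)[OF tc[OF that]] .
  have "\<exists>h. h \<in> hom E (L (Src \<alpha>)) (L (Tgt \<alpha>)) \<and>
          (\<forall>A \<in> Obj X. \<forall>x \<in> elts (Src \<alpha>) A. h \<cdot>\<^bsub>E\<^esub> t (Src \<alpha>) A x = t (Tgt \<alpha>) A (app \<alpha> A x))"
    if \<alpha>: "\<alpha> \<in> hom (PSh X) (Src \<alpha>) (Tgt \<alpha>)" for \<alpha>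
  proof -
    note P = PSh_homD(1)[OF \<alpha>] and Q = PSh_homD(2)[OF \<alpha>]
    have "weighted_cocone F E (Src \<alpha>) (L (Tgt \<alpha>)) (\<lambda>A x. t (Tgt \<alpha>) A (app \<alpha> A x))"
      by (rule weighted_coconeI)
        (use LO[OF Q] th[OF Q] app_elts[OF \<alpha>] t_act[OF Q] app_act[OF \<alpha>] hom_Obj in auto)
    then show ?thesis using weighted_colimit_factor[OF wc[OF P]] by (metis (no_types, lifting))
  qed
  then obtain w where w0: "\<And>\<alpha>. \<alpha> \<in> hom (PSh X) (Src \<alpha>) (Tgt \<alpha>) \<Longrightarrow> w \<alpha> \<in> hom E (L (Src \<alpha>)) (L (Tgt \<alpha>)) \<and>
      (\<forall>A \<in> Obj X. \<forall>x \<in> elts (Src \<alpha>) A. w \<alpha> \<cdot>\<^bsub>E\<^esub> t (Src \<alpha>) A x = t (Tgt \<alpha>) A (app \<alpha> A x))"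
    by metis
  have w: "w \<alpha> \<in> hom E (L P) (L Q)" if "\<alpha> \<in> hom (PSh X) P Q" for \<alpha> P Q
    using w0[of \<alpha>] that PSh_homD(3,4)[OF that] by simp
  have wt: "w \<alpha> \<cdot>\<^bsub>E\<^esub> t P A x = t Q A (app \<alpha> A x)"
    if "\<alpha> \<in> hom (PSh X) P Q" "A \<in> Obj X" "x \<in> elts P A" for \<alpha> P Q A x
    using w0[of \<alpha>] that PSh_homD(3,4)[OF that(1)] by simp
  define W where "W = \<lparr>FObj = (\<lambda>P \<in> Obj (PSh X). L P), FArr = (\<lambda>\<alpha> \<in> Arr (PSh X). w \<alpha>)\<rparr>"
  have WO: "FObj W P = L P" if "rpresheaf P" for P using that by (simp add: W_def)
  have WA: "FArr W \<alpha> = w \<alpha>" if "\<alpha> \<in> hom (PSh X) P Q" for \<alpha> P Q using that by (simp add: W_def hom_iff)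
  have w_eqI: "h = k" if P: "rpresheaf P" and h: "h \<in> hom E (L P) e" and k: "k \<in> hom E (L P) e"
    and "\<And>A x. \<lbrakk>A \<in> Obj X; x \<in> elts P A\<rbrakk> \<Longrightarrow> h \<cdot>\<^bsub>E\<^esub> t P A x = k \<cdot>\<^bsub>E\<^esub> t P A x" for P h k e
    using weighted_colimit_eqI[OF wc[OF P] F P h k] that(4) .
  have W: "restriction_functor (PSh X) E W"
    unfolding restriction_functor_def
  proof (intro conjI ballI)
    show "cat_functor (PSh X) E W"
    proof (rule cat_functorI)
      show "FObj W \<in> extensional (Obj (PSh X))" "FArr W \<in> extensional (Arr (PSh X))"
        by (simp_all add: W_def)
      show "FObj W P \<in> Obj E" if "P \<in> Obj (PSh X)" for P using that LO WO by simp
      show "FArr W \<alpha> \<in> hom E (FObj W P) (FObj W Q)" if \<alpha>: "\<alpha> \<in> hom (PSh X) P Q" for \<alpha> P Q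
        using w[OF \<alpha>] WA[OF \<alpha>] WO PSh_homD(1,2)[OF \<alpha>] by simp
      show "FArr W (Ide (PSh X) P) = Ide E (FObj W P)" if "P \<in> Obj (PSh X)" for P
      proof -
        have P: "rpresheaf P" using that by simp
        have "w (Ide (PSh X) P) = Ide E (L P)"
          by (rule w_eqI[OF P w[OF PSh_Ide_hom[OF P]] E.Ide_hom[OF LO[OF P]]])
             (use wt[OF PSh_Ide_hom[OF P]] E.Ide_Comp[OF th[OF P]] in simp)
        then show ?thesis using WA[OF PSh_Ide_hom[OF P]] WO[OF P] by simp
      qed
      show "FArr W (\<beta> \<cdot>\<^bsub>PSh X\<^esub> \<alpha>) = FArr W \<beta> \<cdot>\<^bsub>E\<^esub> FArr W \<alpha>"
        if \<alpha>: "\<alpha> \<in> hom (PSh X) P Q" and \<beta>: "\<beta> \<in> hom (PSh X) Q R" for \<alpha> \<beta> P Q R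
      proof -
        note P = PSh_homD(1)[OF \<alpha>] and \<beta>\<alpha> = PSh_Comp_hom[OF \<alpha> \<beta>]
        have "w (\<beta> \<cdot>\<^bsub>PSh X\<^esub> \<alpha>) = w \<beta> \<cdot>\<^bsub>E\<^esub> w \<alpha>"
          by (rule w_eqI[OF P w[OF \<beta>\<alpha>] E.Comp_hom[OF w[OF \<alpha>] w[OF \<beta>]]])
             (use wt[OF \<beta>\<alpha>] wt[OF \<alpha>] wt[OF \<beta>] app_elts[OF \<alpha>] app_Comp[OF \<alpha> \<beta>]
                E.Comp_assoc[OF th[OF P] w[OF \<alpha>] w[OF \<beta>]] in simp)
        then show ?thesis using WA[OF \<alpha>] WA[OF \<beta>] WA[OF \<beta>\<alpha>] by simp
      qed
    qed (rule category_PSh E.category_axioms)+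
    fix \<alpha> assume "\<alpha> \<in> Arr (PSh X)"
    then have \<alpha>: "\<alpha> \<in> hom (PSh X) (Src \<alpha>) (Tgt \<alpha>)" by (simp add: hom_iff)
    note P = PSh_homD(1)[OF \<alpha>] and Q = PSh_homD(2)[OF \<alpha>]
    \<comment> \<open>(R4) moves the restriction of \<open>w \<alpha>\<close> past a leg; as the legs have known domains, it becomes
      the action of the domain of \<open>\<alpha> x\<close>\<close>
    have "w (Rst (PSh X) \<alpha>) = Rst E (w \<alpha>)"
    proof (rule w_eqI[OF P w[OF PSh_Rst_hom[OF \<alpha>]] E.Rst_hom[OF w[OF \<alpha>]]])
      fix A x assume A: "A \<in> Obj X" and x: "x \<in> elts (Src \<alpha>) A"
      note e = PRst_hom[OF Q A app_elts[OF \<alpha> A x]]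
      have "Rst E (w \<alpha>) \<cdot>\<^bsub>E\<^esub> t (Src \<alpha>) A x = t (Src \<alpha>) A x \<cdot>\<^bsub>E\<^esub> FArr F (PRst (Tgt \<alpha>) A (app \<alpha> A x))"
        using E.R4[OF th[OF P A x] w[OF \<alpha>]] wt[OF \<alpha> A x]
          weighted_colimitD(2)[OF wc[OF Q] A app_elts[OF \<alpha> A x]] by simp
      also have "\<dots> = t (Src \<alpha>) A (act (Src \<alpha>) x (PRst (Tgt \<alpha>) A (app \<alpha> A x)))"
        using t_act[OF P e x] .
      finally show "w (Rst (PSh X) \<alpha>) \<cdot>\<^bsub>E\<^esub> t (Src \<alpha>) A x = Rst E (w \<alpha>) \<cdot>\<^bsub>E\<^esub> t (Src \<alpha>) A x"
        using wt[OF PSh_Rst_hom[OF \<alpha>] A x] app_Rst[OF \<alpha> A x] by simp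
    qed
    then show "FArr W (Rst (PSh X) \<alpha>) = Rst E (FArr W \<alpha>)"
      using WA[OF \<alpha>] WA[OF PSh_Rst_hom[OF \<alpha>]] by simp
  qed (rule restriction_category_PSh E.restriction_category_axioms)+
  let ?Wy = "comp_functor X W (yoneda X)"
  have Wy: "restriction_functor X E ?Wy" by (rule restriction_functor_comp[OF restriction_functor_yoneda W])
  have WyO: "FObj ?Wy A = L (yo A)" if "A \<in> Obj X" for A using that WO rpresheaf_yo by simp
  \<comment> \<open>the representable \<open>y A\<close> also has the weighted colimit \<open>F A\<close>, with legs \<open>F f\<close>; \<open>\<eta>\<close> and \<open>\<epsilon>\<close> are the
    comparison maps\<close>
  define \<eta> where "\<eta> A = t (yo A) A (Ide X A)" for A
  have \<eta>: "\<eta> A \<in> hom E (FObj F A) (L (yo A))" if "A \<in> Obj X" for A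
    unfolding \<eta>_def using th[OF rpresheaf_yo that] Ide_hom[OF that] that by simp
  have point_\<eta>: "FArr W (point P A x) \<cdot>\<^bsub>E\<^esub> \<eta> A = t P A x"
    if P: "rpresheaf P" and A: "A \<in> Obj X" and x: "x \<in> elts P A" for P A x
    unfolding \<eta>_def WA[OF point_hom[OF P A x]]
    using wt[OF point_hom[OF P A x] A] Ide_hom[OF A] A app_point_Ide[OF P A x] by simp
  have "weighted_cocone F E (yo A) (FObj F A) (\<lambda>B f. FArr F f)" if A: "A \<in> Obj X" for A
  proof (rule weighted_coconeI)
    fix f B C y assume f: "f \<in> hom X B C" and "y \<in> elts (yo A) C"
    then have y: "y \<in> hom X C A" using hom_Obj[OF f] by simp
    show "FArr F y \<cdot>\<^bsub>E\<^esub> FArr F f = FArr F (act (yo A) y f)"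
      using cat_functorD(8)[OF FF f y] act_yo[OF y f] by simp
  qed (use cat_functorD(5,6)[OF FF] A in auto)
  then have "\<exists>h. h \<in> hom E (L (yo A)) (FObj F A) \<and>
      (\<forall>B \<in> Obj X. \<forall>f \<in> elts (yo A) B. h \<cdot>\<^bsub>E\<^esub> t (yo A) B f = FArr F f)" if "A \<in> Obj X" for A
    using weighted_colimit_factor[OF wc[OF rpresheaf_yo]] that by (metis (no_types, lifting))
  then obtain \<epsilon> where \<epsilon>: "\<And>A. A \<in> Obj X \<Longrightarrow> \<epsilon> A \<in> hom E (L (yo A)) (FObj F A)"
    and \<epsilon>t: "\<And>A B f. \<lbrakk>A \<in> Obj X; B \<in> Obj X; f \<in> elts (yo A) B\<rbrakk> \<Longrightarrow> \<epsilon> A \<cdot>\<^bsub>E\<^esub> t (yo A) B f = FArr F f"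
    by metis
  have \<epsilon>\<eta>: "\<epsilon> A \<cdot>\<^bsub>E\<^esub> \<eta> A = Ide E (FObj F A)" if A: "A \<in> Obj X" for A
    unfolding \<eta>_def using \<epsilon>t[OF A A] Ide_hom[OF A] A cat_functorD(7)[OF FF A] by simp
  have \<eta>_act: "\<eta> B \<cdot>\<^bsub>E\<^esub> FArr F f = t (yo B) A f" if f: "f \<in> hom X A B" for f A B
    unfolding \<eta>_def
    using t_act[OF rpresheaf_yo f, of "Ide X B" B] Ide_hom[OF hom_Obj(2)[OF f]] hom_Obj[OF f]
      act_yo[OF Ide_hom f] Ide_Comp[OF f] by simp
  have \<eta>\<epsilon>: "\<eta> A \<cdot>\<^bsub>E\<^esub> \<epsilon> A = Ide E (L (yo A))" if A: "A \<in> Obj X" for A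
  proof (rule w_eqI[OF rpresheaf_yo E.Comp_hom[OF \<epsilon>[OF A] \<eta>[OF A]] E.Ide_hom[OF LO[OF rpresheaf_yo]]])
    fix B f assume B: "B \<in> Obj X" and f: "f \<in> elts (yo A) B"
    have f': "f \<in> hom X B A" using f B by simp
    note tf = th[OF rpresheaf_yo B f]
    show "\<eta> A \<cdot>\<^bsub>E\<^esub> \<epsilon> A \<cdot>\<^bsub>E\<^esub> t (yo A) B f = Ide E (L (yo A)) \<cdot>\<^bsub>E\<^esub> t (yo A) B f"
      using E.Comp_assoc[OF tf \<epsilon>[OF A] \<eta>[OF A]] \<epsilon>t[OF A B f] \<eta>_act[OF f'] E.Ide_Comp[OF tf] by simp
  qed
  have \<eta>_nat: "\<eta> B \<cdot>\<^bsub>E\<^esub> FArr F f = FArr ?Wy f \<cdot>\<^bsub>E\<^esub> \<eta> A" if f: "f \<in> hom X A B" for f A B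
    using \<eta>_act[OF f] point_\<eta>[OF rpresheaf_yo hom_Obj(1)[OF f], of f B] f hom_Obj[OF f]
      yoneda_eq_point[OF f] by (simp add: hom_iff)
  have \<eta>_cancel: "h = k" if A: "A \<in> Obj X" and h: "h \<in> hom E (L (yo A)) e" and k: "k \<in> hom E (L (yo A)) e"
    and eq: "h \<cdot>\<^bsub>E\<^esub> \<eta> A = k \<cdot>\<^bsub>E\<^esub> \<eta> A" for A h k e
  proof -
    have "h \<cdot>\<^bsub>E\<^esub> \<eta> A \<cdot>\<^bsub>E\<^esub> \<epsilon> A = k \<cdot>\<^bsub>E\<^esub> \<eta> A \<cdot>\<^bsub>E\<^esub> \<epsilon> A" using eq by simp
    then show ?thesis
      using E.Comp_assoc[OF \<epsilon>[OF A] \<eta>[OF A] h] E.Comp_assoc[OF \<epsilon>[OF A] \<eta>[OF A] k] \<eta>\<epsilon>[OF A]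
        E.Comp_Ide[OF h] E.Comp_Ide[OF k] by simp
  qed
  have "weighted_colimit ?Wy E P (FObj W P) (\<lambda>A x. FArr W (point P A x))" if P: "rpresheaf P" for P
  proof (rule weighted_colimitI[OF point_weighted_cocone[OF W P] Rst_W_point[OF W P]])
    have Wp: "FArr W (point P A x) \<in> hom E (L (yo A)) (L P)" if "A \<in> Obj X" "x \<in> elts P A" for A x
      using w[OF point_hom[OF P that]] WA[OF point_hom[OF P that]] by simp
    show "\<exists>h \<in> hom E (FObj W P) e. \<forall>A \<in> Obj X. \<forall>x \<in> elts P A. h \<cdot>\<^bsub>E\<^esub> FArr W (point P A x) = u A x"
      if u: "weighted_cocone ?Wy E P e u" for e u
    proof -
      have uh: "u A x \<in> hom E (L (yo A)) e" if "A \<in> Obj X" "x \<in> elts P A" for A x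
        using weighted_coconeD(2)[OF u that] WyO[OF that(1)] by simp
      have "weighted_cocone F E P e (\<lambda>A x. u A x \<cdot>\<^bsub>E\<^esub> \<eta> A)"
      proof (rule weighted_coconeI)
        fix f A B y assume f: "f \<in> hom X A B" and y: "y \<in> elts P B"
        note A = hom_Obj(1)[OF f] and B = hom_Obj(2)[OF f]
        have "FArr ?Wy f \<in> hom E (L (yo A)) (L (yo B))"
          using cat_functorD(6)[OF restriction_functorD(3)[OF Wy] f] WyO[OF A] WyO[OF B] by simp
        note * = E.Comp_assoc[OF \<eta>[OF A] this uh[OF B y]]
        show "u B y \<cdot>\<^bsub>E\<^esub> \<eta> B \<cdot>\<^bsub>E\<^esub> FArr F f = u A (act P y f) \<cdot>\<^bsub>E\<^esub> \<eta> A"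
          using E.Comp_assoc[OF cat_functorD(6)[OF FF f] \<eta>[OF B] uh[OF B y]] \<eta>_nat[OF f] *
            weighted_coconeD(3)[OF u f y] by simp
      qed (use weighted_coconeD(1)[OF u] E.Comp_hom[OF \<eta> uh] in auto)
      then obtain h where h: "h \<in> hom E (L P) e"
        and ht: "\<And>A x. \<lbrakk>A \<in> Obj X; x \<in> elts P A\<rbrakk> \<Longrightarrow> h \<cdot>\<^bsub>E\<^esub> t P A x = u A x \<cdot>\<^bsub>E\<^esub> \<eta> A"
        using weighted_colimit_factor[OF wc[OF P]] by (metis (no_types, lifting))
      have "h \<cdot>\<^bsub>E\<^esub> FArr W (point P A x) = u A x" if A: "A \<in> Obj X" and x: "x \<in> elts P A" for A x
        by (rule \<eta>_cancel[OF A E.Comp_hom[OF Wp[OF A x] h] uh[OF A x]])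
           (use E.Comp_assoc[OF \<eta>[OF A] Wp[OF A x] h] point_\<eta>[OF P A x] ht[OF A x] in simp)
      then show ?thesis using h WO[OF P] by auto
    qed
    show "h = k" if h: "h \<in> hom E (FObj W P) e" and k: "k \<in> hom E (FObj W P) e"
      and eq: "\<And>A x. \<lbrakk>A \<in> Obj X; x \<in> elts P A\<rbrakk> \<Longrightarrow>
                 h \<cdot>\<^bsub>E\<^esub> FArr W (point P A x) = k \<cdot>\<^bsub>E\<^esub> FArr W (point P A x)" for e h k
    proof (rule w_eqI[OF P])
      show h': "h \<in> hom E (L P) e" and k': "k \<in> hom E (L P) e" using h k WO[OF P] by simp_all
      fix A x assume A: "A \<in> Obj X" and x: "x \<in> elts P A"
      show "h \<cdot>\<^bsub>E\<^esub> t P A x = k \<cdot>\<^bsub>E\<^esub> t P A x"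
        using E.Comp_assoc[OF \<eta>[OF A] Wp[OF A x] h'] E.Comp_assoc[OF \<eta>[OF A] Wp[OF A x] k']
          point_\<eta>[OF P A x] eq[OF A x] by simp
    qed
  qed
  then have "pointwise_Kan E W" using W by (simp add: pointwise_Kan_def)
  moreover have "\<exists>k \<in> hom (rCat X E) ?Wy F. iso (rCat X E) k"
    by (rule rCat_isoI[OF F Wy, of \<eta> \<epsilon>]) (use \<eta> \<epsilon> \<epsilon>\<eta> \<eta>\<epsilon> \<eta>_nat WyO in auto)
  ultimately show ?thesis by blast
qed

text \<open>
  Cocontinuous functors are pointwise Kan extensions, so precomposition with the Yoneda embedding is full
  and faithful; every functor on \<open>X\<close> has a pointwise Kan extension, which is cocontinuous, so it is
  essentially surjective.
\<close>

theorem yoneda_precomp_equivalence: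
  fixes E :: "('eo, 'em) rcat"
  assumes E: "cocomplete_rcat TYPE('u) E"
  shows "equivalence_functor (rCocomp TYPE('u) (PSh X) E) (rCat X E)
           (precomp X (yoneda X) (rCocomp TYPE('u) (PSh X) E))"
    (is "equivalence_functor ?C ?D ?P")
proof (rule equivalence_functorI)
  note E' = cocomplete_rcatD(1)[OF E]
  interpret C: category ?C by (rule category_rCocomp[OF restriction_category_PSh E'])
  show "cat_functor ?C ?D ?P" by (rule cat_functor_precomp[OF restriction_functor_yoneda E'])
  have PO: "FObj ?P G = comp_functor X G (yoneda X)" if "G \<in> Obj ?C" for G
    using that by (simp add: precomp_def)
  have Kan: "pointwise_Kan E G" if "G \<in> Obj ?C" for G
    using cocontinuous_pointwise_Kan[OF E] that by simp
  have PC: "Cmp (FArr ?P \<beta>) A = Cmp \<beta> (yo A)" if "\<beta> \<in> hom ?C G H" "A \<in> Obj X" for \<beta> G H A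
    using that by (simp add: precomp_def hom_iff)
  show "\<exists>\<beta> \<in> hom ?C G H. FArr ?P \<beta> = g"
    if G: "G \<in> Obj ?C" and H: "H \<in> Obj ?C" and g: "g \<in> hom ?D (FObj ?P G) (FObj ?P H)" for G H g
  proof -
    have H': "restriction_functor (PSh X) E H" using H by (simp add: cocontinuous_rfunctor_def)
    have gt: "restriction_trans X E (comp_functor X G (yoneda X)) (comp_functor X H (yoneda X)) (Cmp g)"
      using g PO[OF G] PO[OF H] by (simp add: rCat_hom)
    obtain b where b: "restriction_trans (PSh X) E G H b" and bg: "\<And>A. A \<in> Obj X \<Longrightarrow> b (yo A) = Cmp g A"
      using pointwise_Kan_trans_exists[OF Kan[OF G] H' gt] by blast
    let ?\<beta> = "\<lparr>Src = G, Tgt = H, Cmp = b\<rparr>"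
    have \<beta>: "?\<beta> \<in> hom ?C G H" using b G H by (simp add: rCocomp_hom rCat_hom)
    have "FArr ?P ?\<beta> = g"
      by (rule rCat_eqI[OF cat_functorD(6)[OF \<open>cat_functor ?C ?D ?P\<close> \<beta>] g])
         (use PC[OF \<beta>] bg in simp)
    then show ?thesis using \<beta> by blast
  qed
  show "\<beta> = \<beta>'" if \<beta>: "\<beta> \<in> hom ?C G H" and \<beta>': "\<beta>' \<in> hom ?C G H" and eq: "FArr ?P \<beta> = FArr ?P \<beta>'"
    for \<beta> \<beta>' G H
    by (rule pointwise_Kan_trans_eq[OF Kan[OF C.hom_Obj(1)[OF \<beta>]], where H = H])
       (use \<beta> \<beta>' PC[OF \<beta>] PC[OF \<beta>'] eq in \<open>auto simp: rCocomp_hom\<close>)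
  show "\<exists>W \<in> Obj ?C. \<exists>k \<in> hom ?D (FObj ?P W) F. iso ?D k" if F: "F \<in> Obj ?D" for F
  proof -
    have F': "restriction_functor X E F" using F by simp
    obtain W where W: "pointwise_Kan E W"
      and k: "\<exists>k \<in> hom (rCat X E) (comp_functor X W (yoneda X)) F. iso (rCat X E) k"
      using pointwise_Kan_exists[OF E F'] by blast
    have "W \<in> Obj ?C" using pointwise_Kan_cocontinuous[OF W] by simp
    then show ?thesis using k PO by metis
  qed
qed

end

theorem corollary35:
  fixes X :: "('u, 'u) rcat"
  assumes "universe TYPE('u)"
    and "restriction_category X"
    and "small_category X"
  shows "cocomplete_rcat TYPE('u) (PSh X) \<and>
    (\<forall>E :: ('eo, 'em) rcat. cocomplete_rcat TYPE('u) E \<longrightarrow>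
      equivalence_functor (rCocomp TYPE('u) (PSh X) E) (rCat X E)
        (precomp X (yoneda X) (rCocomp TYPE('u) (PSh X) E)))"
proof -
  interpret small_restriction_category X
    using assms by (simp add: small_restriction_category_def small_restriction_category_axioms_def)
  show ?thesis using cocomplete_PSh yoneda_precomp_equivalence by blast
qed

end
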